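(* Let $p$ and $p'$ be $n$-component nanophrases over $\alpha_v=\{a_+,a_-,b_+,b_-\}$ which are (extended) $M$-homotopic with respect to $(\alpha_v,\tau_v,S'_w)$, $\nu_v$ and $\sigma_v$. Let $u\ge1$ and let $c_1,c_2,\ldots,c_u,i$ be pairwise distinct integers between $1$ and $n$. Then $\bar\mu(p;c_1,c_2,\ldots,c_u,i)=\bar\mu(p';c_1,c_2,\ldots,c_u,i)$. In other words, $\bar\mu(\,\cdot\,;c_1,\ldots,c_u,i)$ is an invariant of nanophrases under this $M$-homotopy.
   Context: **Nanophrases.** Let $\alpha_v=\{a_+,a_-,b_+,b_-\}$. An $\alpha_v$-alphabet is a finite set $\mathcal A$ (of letters) with a map $\mathcal A\to\alpha_v$, $A\mapsto|A|$ (the projection). An $n$-component nanophrase over $\alpha_v$ is a pair $(\mathcal A,p)$ where $\mathcal A$ is an $\alpha_v$-alphabet and $p=w_1|w_2|\cdots|w_n$ is a sequence of $n$ (possibly empty) finite words in $\mathcal A$ such that each letter of $\mathcal A$ occurs exactly twice in the concatenation $w_1w_2\cdots w_n$. We write $p$ for $(\mathcal A,p)$. **Extended $M$-homotopy.** Let $\tau_v,\nu_v,\sigma_v$ be the involutions of $\alpha_v$ with $\tau_v:a_+\leftrightarrow b_-,\ a_-\leftrightarrow b_+$; $\nu_v:a_+\leftrightarrow b_+,\ a_-\leftrightarrow b_-$; $\sigma_v:a_+\leftrightarrow a_-,\ b_+\leftrightarrow b_-$. Let $\emptyset$ also denote an extra symbol not in $\alpha_v$, and put $|\emptyset|=\emptyset$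 for the empty word. Let $S'_w\subset(\alpha_v\cup\{\emptyset\})^3$ consist of: $(a_\pm,a_\pm,a_\pm)$, $(a_\pm,a_\pm,a_\mp)$, $(a_\pm,a_\mp,a_\mp)$, $(b_\pm,b_\pm,b_\pm)$, $(b_\pm,b_\pm,b_\mp)$, $(b_\pm,b_\mp,b_\mp)$ (in each triple take all upper signs or all lower signs); $(a_+,a_+,\emptyset)$, $(a_+,b_-,\emptyset)$, $(b_-,a_+,\emptyset)$, $(b_-,b_-,\emptyset)$; $(a_-,\emptyset,b_-)$, $(b_+,\emptyset,a_+)$, $(a_-,\emptyset,a_+)$, $(b_+,\emptyset,b_-)$; $(\emptyset,a_-,a_-)$, $(\emptyset,a_-,b_+)$, $(\emptyset,b_+,a_-)$, $(\emptyset,b_+,b_+)$. The (extended) $M$-homotopy with respect to $(\alpha_v,\tau_v,S'_w)$, $\nu_v$, $\sigma_v$ is the equivalence relation on nanophrases generated by the following; $x,y,z,t$ are arbitrary sequences of letters possibly containing separators `$|$', such that both sides are nanophrases, and projections of remaining letters are unchanged. - Isomorphism: a bijection $f:\mathcal A_1\to\mathcal A_2$ with $|f(A)|=|A|$ sending, letterwise, the $i$th component of $p_1$ to the $i$th component of $p_2$ for all $i$. - H1: $(\mathcal A,xAAy)\leftrightarrow(\mathcal A-\{A\},xy)$, for any $|A|$. - H2: $(\mathcal A,xAByBAz)\leftrightarrow(\mathcal A-\{A,B\},xyz)$, if $\tau_v(|A|)=|B|$. - H3 and extended H3: $(\mathcal A,xAByACzBCt)\leftrightarrow(\mathcal A,xBAyCAzCBt)$,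 if $(|A|,|B|,|C|)\in S'_w$, where each of $A,B,C$ is a letter or the empty word $\emptyset$. For example, when $C=\emptyset$ the move is $xAByAzBt\leftrightarrow xBAyAzBt$. - Shift move on the $i$th component: if this component is empty or a single letter, nothing changes. Otherwise it has the form $Ax$ and is replaced by $xA$, all other components unchanged; $|A|$ is replaced by $\nu_v(|A|)$ if $x$ contains $A$, and is unchanged otherwise; the projections of other letters are unchanged. - Self crossing move: if a letter $A$ occurs twice in one component, replace $|A|$ by $\sigma_v(|A|)$, keeping the phrase and all other projections. **Signed words.** Let $p=w_1|\cdots|w_n$ with $w_i=A_{i1}A_{i2}\cdots A_{im_i}$. For each position $(i,j)$, let $A$ be the letter $A_{ij}$ and let $(k,l)\ne(i,j)$ be the position of the other occurrence of $A$. Put $\varepsilon_{ij}=1$ if ($i<k$ and $|A|=b_+$) or ($i>k$ and $|A|=a_+$); $\varepsilon_{ij}=-1$ if ($i<k$ and $|A|=a_-$) or ($i>k$ and $|A|=b_-$); $\varepsilon_{ij}=0$ otherwise. Put $w_i^{\varepsilon}=A_{i1}^{\varepsilon_{i1}}\cdots A_{im_i}^{\varepsilon_{im_i}}$, a word on $\mathcal A\cup\mathcal A^{-1}$, with $A^0=\emptyset$ the empty word. Formal inverse: $(A_1A_2\cdots A_m)^{-1}=A_m^{-1}\cdots A_1^{-1}$, with $(A^{-1})^{-1}=A$; no cancellation is performed in words. A letter whose two occurrences lie in different components has exactly one occurrence with nonzero sign; only such letters appear in the words $w_i^\varepsilon$. **Maps $\rho^q$, $\eta$, $\varphi$.** For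 a letter $A$ whose two occurrences lie in different components, let $(i,j)$ be its occurrence with $\varepsilon_{ij}\neq0$, $(k,l)$ the other one, and $x_A=A_{k1}^{\varepsilon_{k1}}\cdots A_{k,l-1}^{\varepsilon_{k,l-1}}$. Define maps $\rho^q$ ($q\ge2$) on words in such letters and their inverses, multiplicative with respect to concatenation, with $\rho^q(\emptyset)=\emptyset$, by $\rho^2(A^{\pm1})=A^{\pm1}$ and $\rho^q(A^{\pm1})=\rho^{q-1}(x_A^{-1})\,A^{\pm1}\,\rho^{q-1}(x_A)$ for $q\ge3$. Let $\eta$ be the multiplicative map to words on $\{a_1^{\pm1},\ldots,a_n^{\pm1}\}$ with $\eta(A^{\pm1})=a_k^{\pm1}$, where $k$ is the index of the component containing the second occurrence of $A$ in $p$ if $|A|\in\{b_+,a_-\}$, and the first occurrence if $|A|\in\{a_+,b_-\}$. Let $\varphi$ be the multiplicative map from words on $\{a_1^{\pm1},\ldots,a_n^{\pm1}\}$ to the ring $\mathbb Z[[\kappa_1,\ldots,\kappa_n]]$ of formal power series in non-commuting variables, with $\varphi(\emptyset)=1$, $\varphi(a_h)=1+\kappa_h$, $\varphi(a_h^{-1})=1-\kappa_h+\kappa_h^2-\kappa_h^3+\cdots$. **$\mu$, $\Delta$, $\bar\mu$.** For each monomial, its coefficient in $\varphi\circ\eta(\rho^q(w_i^\varepsilon))$ is eventually constant in $q$. For $u\geq 1$ and indices $c_1,\ldots,c_u,i\in\{1,\ldots,n\}$ (not necessarily distinct), $\mu(p;c_1,\ldots,c_u,i)\in\mathbb Z$ is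 the eventual coefficient of $\kappa_{c_1}\kappa_{c_2}\cdots\kappa_{c_u}$. Put $\Delta(p;c_1,i)=0$, and for $u\ge2$ let $\Delta(p;c_1,\ldots,c_u,i)\geq 0$ be the greatest common divisor of the integers $\mu(p;d_1,\ldots,d_t)$, where $d_1,\ldots,d_t$ ($2\le t\le u$) ranges over all sequences obtained by eliminating at least one of $c_1,\ldots,c_u,i$ and permuting the remaining indices cyclically (the gcd of zeros is $0$). Then $\bar\mu(p;c_1,\ldots,c_u,i)$ is the residue class of $\mu(p;c_1,\ldots,c_u,i)$ modulo $\Delta(p;c_1,\ldots,c_u,i)$ (a residue class modulo $0$ is the integer itself). Equality of $\bar\mu$ for two nanophrases means that the moduli $\Delta$ agree and the residue classes agree. *)

theory Defs
  imports "HOL-Number_Theory.Cong"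
begin

section \<open>Nanophrases\<close>

datatype alpha_v = a_plus | a_minus | b_plus | b_minus

text \<open>
  Letters come from an arbitrary type \<open>'a\<close>; as alphabets are finite and may be renamed by
  isomorphisms, any infinite type supplies all of them up to isomorphism. The alphabet of a nanophrase is the domain of its
  partial map \<open>proj\<close>, so the alphabet and the projection \<open>A \<mapsto> |A|\<close> are one datum, and
  deleting letters means restricting the map. Components, positions and the indices of the variables
  are numbered from 0, so the index range \<open>1, \<dots>, n\<close> becomes \<open>0, \<dots>, n - 1\<close>.
\<close>

datatype 'a nanophrase = Nanophrase (proj: "'a \<rightharpoonup> alpha_v") (comps: "'a list list")

definition nanophrase :: "nat \<Rightarrow> 'a nanophrase \<Rightarrow> bool" where
  "nanophrase n P \<longleftrightarrow>
     length (comps P) = n \<and> finite (dom (proj P)) \<and> set (concat (comps P)) \<subseteq> dom (proj P) \<and>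
     (\<forall>A \<in> dom (proj P). count_list (concat (comps P)) A = 2)"


section \<open>Extended M-homotopy\<close>

fun tau_v :: "alpha_v \<Rightarrow> alpha_v" where
  "tau_v a_plus = b_minus" | "tau_v b_minus = a_plus"
| "tau_v a_minus = b_plus" | "tau_v b_plus = a_minus"

fun nu_v :: "alpha_v \<Rightarrow> alpha_v" where
  "nu_v a_plus = b_plus" | "nu_v b_plus = a_plus"
| "nu_v a_minus = b_minus" | "nu_v b_minus = a_minus"

fun sigma_v :: "alpha_v \<Rightarrow> alpha_v" where
  "sigma_v a_plus = a_minus" | "sigma_v a_minus = a_plus"
| "sigma_v b_plus = b_minus" | "sigma_v b_minus = b_plus"

text \<open>In the triples, \<open>None\<close> is the extra symbol \<open>\<emptyset>\<close>.\<close>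

definition S'_w :: "(alpha_v option \<times> alpha_v option \<times> alpha_v option) set" where
  "S'_w =
    {(Some a_plus, Some a_plus, Some a_plus),    (Some a_minus, Some a_minus, Some a_minus),
     (Some a_plus, Some a_plus, Some a_minus),   (Some a_minus, Some a_minus, Some a_plus),
     (Some a_plus, Some a_minus, Some a_minus),  (Some a_minus, Some a_plus, Some a_plus),
     (Some b_plus, Some b_plus, Some b_plus),    (Some b_minus, Some b_minus, Some b_minus),
     (Some b_plus, Some b_plus, Some b_minus),   (Some b_minus, Some b_minus, Some b_plus),
     (Some b_plus, Some b_minus, Some b_minus),  (Some b_minus, Some b_plus, Some b_plus),
     (Some a_plus, Some a_plus, None),   (Some a_plus, Some b_minus, None),
     (Some b_minus, Some a_plus, None),  (Some b_minus, Some b_minus, None),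
     (Some a_minus, None, Some b_minus), (Some b_plus, None, Some a_plus),
     (Some a_minus, None, Some a_plus),  (Some b_plus, None, Some b_minus),
     (None, Some a_minus, Some a_minus), (None, Some a_minus, Some b_plus),
     (None, Some b_plus, Some a_minus),  (None, Some b_plus, Some b_plus)}"

text \<open>
  The moves H1, H2, H3 cut a phrase into pieces that may contain separators, so they are stated on
  the flat sequence \<open>w\<^sub>1|w\<^sub>2|\<dots>|w\<^sub>n\<close>.
\<close>

datatype 'a token = Letter 'a | Sep

fun flat :: "'a list list \<Rightarrow> 'a token list" where
  "flat [] = []"
| "flat [w] = map Letter w"
| "flat (w # v # ws) = map Letter w @ Sep # flat (v # ws)"

fun tok :: "'a option \<Rightarrow> 'a token list" where
  "tok None = []"
| "tok (Some A) = [Letter A]"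

text \<open>
  In \<open>H3\<close>, each of \<open>A\<close>, \<open>B\<close>, \<open>C\<close> is a letter or the empty word \<open>None\<close>, and
  \<open>Option.bind A m\<close> is its projection, with \<open>|\<emptyset>| = \<emptyset>\<close>. That both sides of a move are
  nanophrases (which forces the displayed letters to be distinct and to have no further occurrences)
  is required in \<open>M_homotopic\<close>. On a component of length at most 1, \<open>Shift\<close> is the identity.
\<close>

inductive M_move :: "'a nanophrase \<Rightarrow> 'a nanophrase \<Rightarrow> bool" where
  Iso: "\<lbrakk>bij_betw f (dom m) (dom m'); \<forall>A \<in> dom m. m' (f A) = m A\<rbrakk> \<Longrightarrow>
    M_move (Nanophrase m p) (Nanophrase m' (map (map f) p))"
| H1: "\<lbrakk>flat p = x @ [Letter A, Letter A] @ y; flat p' = x @ y\<rbrakk> \<Longrightarrow>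
    M_move (Nanophrase m p) (Nanophrase (m |` (- {A})) p')"
| H2: "\<lbrakk>flat p = x @ [Letter A, Letter B] @ y @ [Letter B, Letter A] @ z; flat p' = x @ y @ z;
      m A = Some a; m B = Some (tau_v a)\<rbrakk> \<Longrightarrow>
    M_move (Nanophrase m p) (Nanophrase (m |` (- {A, B})) p')"
| H3: "\<lbrakk>flat p = x @ tok A @ tok B @ y @ tok A @ tok C @ z @ tok B @ tok C @ t;
      flat p' = x @ tok B @ tok A @ y @ tok C @ tok A @ z @ tok C @ tok B @ t;
      (Option.bind A m, Option.bind B m, Option.bind C m) \<in> S'_w\<rbrakk> \<Longrightarrow>
    M_move (Nanophrase m p) (Nanophrase m p')"
| Shift: "\<lbrakk>i < length p; p ! i = A # x\<rbrakk> \<Longrightarrow>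
    M_move (Nanophrase m p)
      (Nanophrase (if A \<in> set x then m(A := map_option nu_v (m A)) else m) (p[i := x @ [A]]))"
| Self_crossing: "\<lbrakk>i < length p; count_list (p ! i) A = 2\<rbrakk> \<Longrightarrow>
    M_move (Nanophrase m p) (Nanophrase (m(A := map_option sigma_v (m A))) p)"

definition M_homotopic :: "nat \<Rightarrow> 'a nanophrase \<Rightarrow> 'a nanophrase \<Rightarrow> bool" where
  "M_homotopic n = equivclp (\<lambda>P Q. nanophrase n P \<and> nanophrase n Q \<and> M_move P Q)"


section \<open>Signed words\<close>

definition occurrences :: "'a nanophrase \<Rightarrow> 'a \<Rightarrow> (nat \<times> nat) list" where
  "occurrences P A =
     [(i, j). i \<leftarrow> [0..<length (comps P)], j \<leftarrow> [0..<length (comps P ! i)], comps P ! i ! j = A]"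

definition first_occ :: "'a nanophrase \<Rightarrow> 'a \<Rightarrow> nat \<times> nat" where
  "first_occ P A = occurrences P A ! 0"

definition second_occ :: "'a nanophrase \<Rightarrow> 'a \<Rightarrow> nat \<times> nat" where
  "second_occ P A = occurrences P A ! 1"

definition other_occ :: "'a nanophrase \<Rightarrow> nat \<times> nat \<Rightarrow> nat \<times> nat" where
  "other_occ P = (\<lambda>(i, j). let A = comps P ! i ! j in
     if first_occ P A = (i, j) then second_occ P A else first_occ P A)"

definition eps :: "'a nanophrase \<Rightarrow> nat \<Rightarrow> nat \<Rightarrow> int" where
  "eps P i j = (let a = proj P (comps P ! i ! j); k = fst (other_occ P (i, j)) in
     if i < k \<and> a = Some b_plus \<or> i > k \<and> a = Some a_plus then 1
     else if i < k \<and> a = Some a_minus \<or> i > k \<and> a = Some b_minus then -1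
     else 0)"

text \<open>
  Words on \<open>X \<union> X\<^sup>-\<^sup>1\<close> are lists of pairs: \<open>(x, True)\<close> is \<open>x\<close> and \<open>(x, False)\<close> is
  \<open>x\<^sup>-\<^sup>1\<close>. No cancellation takes place.
\<close>

type_synonym 'x sword = "('x \<times> bool) list"

definition inv_word :: "'x sword \<Rightarrow> 'x sword" where
  "inv_word w = rev (map (\<lambda>(x, s). (x, \<not> s)) w)"

definition letter_power :: "'x \<Rightarrow> int \<Rightarrow> 'x sword" where
  "letter_power x e = (if e = 1 then [(x, True)] else if e = -1 then [(x, False)] else [])"

definition signed_prefix :: "'a nanophrase \<Rightarrow> nat \<Rightarrow> nat \<Rightarrow> 'a sword" where
  "signed_prefix P i l = concat (map (\<lambda>j. letter_power (comps P ! i ! j) (eps P i j)) [0..<l])"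

definition signed_comp :: "'a nanophrase \<Rightarrow> nat \<Rightarrow> 'a sword" where
  "signed_comp P i = signed_prefix P i (length (comps P ! i))"


section \<open>The maps \<open>\<rho>\<^sup>q\<close>, \<open>\<eta>\<close> and \<open>\<phi>\<close>\<close>

text \<open>
  The occurrence of \<open>A\<close> other than the one with nonzero sign; meaningful for letters whose two
  occurrences lie in different components.
\<close>

definition zero_occ :: "'a nanophrase \<Rightarrow> 'a \<Rightarrow> nat \<times> nat" where
  "zero_occ P A =
     (if case_prod (eps P) (first_occ P A) \<noteq> 0 then second_occ P A else first_occ P A)"

definition x_word :: "'a nanophrase \<Rightarrow> 'a \<Rightarrow> 'a sword" where
  "x_word P A = (case zero_occ P A of (k, l) \<Rightarrow> signed_prefix P k l)"

text \<open>\<open>\<rho>\<^sup>q\<close> is meant for \<open>q \<ge> 2\<close>; for \<open>q < 2\<close> it is set equal to \<open>\<rho>\<^sup>2\<close>.\<close>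

fun rho :: "'a nanophrase \<Rightarrow> nat \<Rightarrow> 'a sword \<Rightarrow> 'a sword" where
  "rho P q w = concat (map (\<lambda>(A, s).
     if q \<le> 2 then [(A, s)]
     else rho P (q - 1) (inv_word (x_word P A)) @ [(A, s)] @ rho P (q - 1) (x_word P A)) w)"

declare rho.simps [simp del]

text \<open>The generator \<open>a\<^sub>k\<close> is represented by its index \<open>k\<close>.\<close>

definition eta_index :: "'a nanophrase \<Rightarrow> 'a \<Rightarrow> nat" where
  "eta_index P A =
     (if proj P A \<in> {Some b_plus, Some a_minus} then fst (second_occ P A) else fst (first_occ P A))"

definition eta :: "'a nanophrase \<Rightarrow> 'a sword \<Rightarrow> nat sword" where
  "eta P w = map (\<lambda>(A, s). (eta_index P A, s)) w"

text \<open>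
  A formal power series over the integers in non-commuting variables \<open>\<kappa>\<^sub>h\<close> is its coefficient
  function; the monomial \<open>\<kappa>\<^bsub>h1\<^esub> \<cdots> \<kappa>\<^bsub>hr\<^esub>\<close> is the list \<open>[h1, \<dots>, hr]\<close>.
\<close>

type_synonym ncfps = "nat list \<Rightarrow> int"

definition nc_one :: ncfps where
  "nc_one m = (if m = [] then 1 else 0)"

definition nc_mult :: "ncfps \<Rightarrow> ncfps \<Rightarrow> ncfps" where
  "nc_mult f g m = (\<Sum>k \<le> length m. f (take k m) * g (drop k m))"

fun phi_gen :: "nat \<times> bool \<Rightarrow> ncfps" where
  "phi_gen (h, True) = (\<lambda>m. if m = [] \<or> m = [h] then 1 else 0)"
| "phi_gen (h, False) = (\<lambda>m. if m = replicate (length m) h then (-1) ^ length m else 0)"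

definition phi :: "nat sword \<Rightarrow> ncfps" where
  "phi w = foldr (\<lambda>g. nc_mult (phi_gen g)) w nc_one"


section \<open>The invariants\<close>

text \<open>
  The indices \<open>c\<^sub>1, \<dots>, c\<^sub>u, i\<close> form one list \<open>ds\<close>, whose last entry is \<open>i\<close>. The
  value of \<open>mu\<close> is the eventual value of the coefficient as \<open>q\<close> grows.
\<close>

definition mu :: "'a nanophrase \<Rightarrow> nat list \<Rightarrow> int" where
  "mu P ds = (THE z. eventually
     (\<lambda>q. phi (eta P (rho P q (signed_comp P (last ds)))) (butlast ds) = z) sequentially)"

text \<open>For two indices the set below is empty, and \<open>Delta\<close> is 0.\<close>

definition Delta :: "'a nanophrase \<Rightarrow> nat list \<Rightarrow> int" where
  "Delta P ds = Gcd {mu P (rotate r s) | r s.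
     s \<in> set (subseqs ds) \<and> 2 \<le> length s \<and> length s < length ds}"

text \<open>
  The residue class is recorded with its modulus, so that equality means equality of both. Modulo 0
  the class is a singleton.
\<close>

definition mu_bar :: "'a nanophrase \<Rightarrow> nat list \<Rightarrow> int \<times> int set" where
  "mu_bar P ds = (Delta P ds, {z. [z = mu P ds] (mod Delta P ds)})"

end

theory Submission
  imports Defs "HOL-Library.Sublist"
begin

text \<open>
  Give the \<open>k\<close>-th component the meridian \<open>1 + y k\<close> in a ring in which \<open>y k * r * y k = 0\<close> for all \<open>k\<close>
  and \<open>r\<close>. The arcs passing over at the crossings of different components then satisfy a Wirtinger
  system \<open>1 + X A = \<Lambda>\<^sup>-\<^sup>1 * (1 + y k) * \<Lambda>\<close>, where \<open>\<Lambda>\<close> is a word in other arcs. The words \<open>\<rho>\<^sup>q\<close> are the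
  iterates of this system, so for strictly upper triangular \<open>y k\<close> they converge to its unique solution,
  and the longitude of the component \<open>k\<close> expands as the sum of \<open>\<mu>(m, k) * y m\<close> over square-free
  monomials \<open>m\<close>. With elementary matrices for \<open>y\<close>, placed along \<open>i, c\<^sub>1, \<dots>, c\<^sub>u\<close>, the number
  \<open>\<mu>(c\<^sub>1, \<dots>, c\<^sub>u, i)\<close> is the top right entry of \<open>y i\<close> times the longitude of \<open>i\<close>.

  All moves except the shift carry a solution to a solution and preserve \<open>y k\<close> times the longitude of
  \<open>k\<close>. A shift past an undercrossing solves the new system for a conjugate meridian of the shifted
  component; expanding in these meridians changes the entry only by multiples of \<open>\<mu>\<close> of proper
  subsequences. A shift past an overcrossing replaces an arc by its conjugate by the longitude, and
  modulo \<open>\<Delta>\<close> the longitude commutes with its meridian. By induction on the number of indices the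
  moduli \<open>\<Delta>\<close> agree as well.
\<close>

section \<open>Upper triangular integer matrices\<close>

text \<open>Repeated variables can be killed because the indices are pairwise distinct: a
  coefficient of a square-free monomial is still visible in the quotient by all monomials with a
  repeated variable. There \<open>1 - y k\<close> is the inverse of \<open>1 + y k\<close>, so the
  series of inverse generators become linear, and conjugates of one meridian commute, as in Milnor's
  reduced group. The matrices have rows and columns indexed by all of \<open>nat\<close>, so that
  one type serves every number of indices; upper triangularity keeps the sums in products finite.
  Two kinds of smallness are needed: distance from the diagonal, to solve the system, and
  divisibility, for the residue classes; \<open>agree\<close> combines them. The obstacle is the
  shift: it moves the base point of a component, so the longitudes need not be preserved for the
  same meridians, and only there do residue classes matter. The comparison is made modulo a common
  divisor of the two moduli, because the equality of the moduli is a separate matter, settled from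
  the shorter index sequences.\<close>

typedef tri = "{f :: nat \<Rightarrow> nat \<Rightarrow> int. \<forall>a b. b < a \<longrightarrow> f a b = 0}"
  morphisms ent Abs_tri
  by (rule exI[of _ "\<lambda>_ _. 0"]) simp

setup_lifting type_definition_tri

lemma tri_eqI: "(\<And>a b. a \<le> b \<Longrightarrow> ent f a b = ent g a b) \<Longrightarrow> f = g"
  by transfer (metis linorder_not_le ext)

lemma ent_below [simp]: "b < a \<Longrightarrow> ent f a b = 0"
  by transfer simp

instantiation tri :: ring_1
begin

lift_definition zero_tri :: tri is "\<lambda>_ _. 0" by simp
lift_definition one_tri :: tri is "\<lambda>a b. if a = b then 1 else 0" by simp
lift_definition plus_tri :: "tri \<Rightarrow> tri \<Rightarrow> tri" is "\<lambda>f g a b. f a b + g a b" by simp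
lift_definition minus_tri :: "tri \<Rightarrow> tri \<Rightarrow> tri" is "\<lambda>f g a b. f a b - g a b" by simp
lift_definition uminus_tri :: "tri \<Rightarrow> tri" is "\<lambda>f a b. - f a b" by simp
lift_definition times_tri :: "tri \<Rightarrow> tri \<Rightarrow> tri" is
  "\<lambda>f g a b. \<Sum>x = a..b. f a x * g x b" by simp

instance
proof
  fix f g h :: tri
  show "f * g * h = f * (g * h)"
  proof (transfer, intro ext)
    fix f g h :: "nat \<Rightarrow> nat \<Rightarrow> int" and a b
    have "(\<Sum>x = a..b. (\<Sum>z = a..x. f a z * g z x) * h x b)
      = (\<Sum>x = a..b. \<Sum>z = a..x. f a z * g z x * h x b)"
      by (simp add: sum_distrib_right)
    also have "\<dots> = (\<Sum>(x, z) \<in> (SIGMA x : {a..b}. {a..x}). f a z * g z x * h x b)"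
      by (simp add: sum.Sigma)
    also have "\<dots> = (\<Sum>(z, x) \<in> (SIGMA z : {a..b}. {z..b}). f a z * g z x * h x b)"
      by (rule sum.reindex_bij_witness[of _ "\<lambda>(x, z). (z, x)" "\<lambda>(x, z). (z, x)"]) auto
    also have "\<dots> = (\<Sum>z = a..b. \<Sum>x = z..b. f a z * g z x * h x b)"
      by (simp add: sum.Sigma)
    also have "\<dots> = (\<Sum>z = a..b. f a z * (\<Sum>x = z..b. g z x * h x b))"
      by (simp add: sum_distrib_left mult.assoc)
    finally show "(\<Sum>x = a..b. (\<Sum>z = a..x. f a z * g z x) * h x b)
      = (\<Sum>x = a..b. f a x * (\<Sum>z = x..b. g x z * h z b))" .
  qed
  show "1 * f = f"
    by (transfer, intro ext) (auto simp: if_distrib[of "\<lambda>x. x * _"] cong: if_cong)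
  show "f * 1 = f"
    by (transfer, intro ext) (auto simp: if_distrib cong: if_cong)
  show "(0::tri) \<noteq> 1"
    by transfer (metis zero_neq_one)
qed (transfer; auto simp: algebra_simps sum.distrib)+

end

lemma ent_zero [simp]: "ent 0 a b = 0" by transfer simp
lemma ent_one: "ent 1 a b = (if a = b then 1 else 0)" by transfer simp
lemma ent_add [simp]: "ent (f + g) a b = ent f a b + ent g a b" by transfer simp
lemma ent_diff [simp]: "ent (f - g) a b = ent f a b - ent g a b" by transfer simp
lemma ent_uminus [simp]: "ent (- f) a b = - ent f a b" by transfer simp
lemma ent_mult: "ent (f * g) a b = (\<Sum>x = a..b. ent f a x * ent g x b)" by transfer simp

lemma ent_sum: "ent (sum f A) a b = (\<Sum>x\<in>A. ent (f x) a b)"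
  by (induction A rule: infinite_finite_induct) auto

lemma ent_of_int: "ent (of_int c) a b = (if a = b then c else 0)"
proof -
  have *: "ent (of_nat k) a b = (if a = b then int k else 0)" for k
    by (induction k) (auto simp: ent_one)
  show ?thesis
    by (cases c rule: int_cases2) (auto simp: *)
qed

lemma ent_of_int_mult [simp]: "ent (of_int c * f) a b = c * ent f a b"
  by (cases "a \<le> b") (auto simp: ent_mult ent_of_int if_distrib[of "\<lambda>x. x * _"] cong: if_cong)

text \<open>Congruence modulo \<open>d\<close> on the first \<open>k\<close> diagonals. For
  \<open>d = 0\<close> it is equality there, so one relation measures both convergence and
  congruence. Truncated subtraction also admits \<open>b < a\<close>, harmlessly, since the type
  forces zeros below the diagonal.\<close>

definition agree :: "int \<Rightarrow> nat \<Rightarrow> tri \<Rightarrow> tri \<Rightarrow> bool" where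
  "agree d k f g \<longleftrightarrow> (\<forall>a b. b - a < k \<longrightarrow> d dvd ent f a b - ent g a b)"

definition strict :: "tri \<Rightarrow> bool" where
  "strict f \<longleftrightarrow> (\<forall>a. ent f a a = 0)"

lemma agree_refl [simp]: "agree d k f f"
  by (simp add: agree_def)

lemma agree_zero_bound [simp]: "agree d 0 f g"
  by (simp add: agree_def)

lemma agree_sym: "agree d k f g \<Longrightarrow> agree d k g f"
  by (auto simp: agree_def dvd_diff_commute)

lemma agree_trans [trans]: "agree d k f g \<Longrightarrow> agree d k g h \<Longrightarrow> agree d k f h"
  unfolding agree_def
proof (intro allI impI)
  fix a b
  assume "\<forall>a b. b - a < k \<longrightarrow> d dvd ent f a b - ent g a b"
    "\<forall>a b. b - a < k \<longrightarrow> d dvd ent g a b - ent h a b" "b - a < k"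
  then have "d dvd (ent f a b - ent g a b) + (ent g a b - ent h a b)"
    by (blast intro: dvd_add)
  then show "d dvd ent f a b - ent h a b" by simp
qed

lemma agree_mono: "agree d l f g \<Longrightarrow> k \<le> l \<Longrightarrow> agree d k f g"
  by (auto simp: agree_def)

lemma agree_add: "agree d k f f' \<Longrightarrow> agree d k g g' \<Longrightarrow> agree d k (f + g) (f' + g')"
  unfolding agree_def
  using dvd_add[of d "ent f _ _ - ent f' _ _" "ent g _ _ - ent g' _ _"] by (simp add: algebra_simps)

lemma agree_diff: "agree d k f f' \<Longrightarrow> agree d k g g' \<Longrightarrow> agree d k (f - g) (f' - g')"
  unfolding agree_def
  using dvd_diff[of d "ent f _ _ - ent f' _ _" "ent g _ _ - ent g' _ _"] by (simp add: algebra_simps)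

lemma agree_0_mult_left: "agree d k f 0 \<Longrightarrow> agree d k (f * g) 0"
  unfolding agree_def ent_mult
  by (auto intro!: dvd_sum dvd_mult2) 

lemma agree_0_mult_right: "agree d k g 0 \<Longrightarrow> agree d k (f * g) 0"
  unfolding agree_def ent_mult
  by (auto intro!: dvd_sum dvd_mult)

text \<open>The term with \<open>x = a\<close> vanishes, and every other term meets an entry of
  \<open>g\<close> at least one diagonal closer to the main one. This gain of a diagonal is what
  makes the later recursion converge.\<close>

lemma agree_0_mult_strict_left:
  assumes "strict y" "agree d k g 0"
  shows "agree d (Suc k) (y * g) 0"
  unfolding agree_def
proof (intro allI impI)
  fix a b :: nat assume ab: "b - a < Suc k"
  have "d dvd ent y a x * ent g x b" if "x \<in> {a..b}" for x
  proof (cases "x = a")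
    case True
    then show ?thesis using assms(1) by (simp add: strict_def)
  next
    case False
    then have "b - x < k" using that ab by auto
    then show ?thesis using assms(2) by (auto simp: agree_def)
  qed
  then show "d dvd ent (y * g) a b - ent 0 a b"
    by (auto simp: ent_mult intro: dvd_sum)
qed

lemma agree_0_mult_strict_right:
  assumes "strict y" "agree d k g 0"
  shows "agree d (Suc k) (g * y) 0"
  unfolding agree_def
proof (intro allI impI)
  fix a b :: nat assume ab: "b - a < Suc k"
  have "d dvd ent g a x * ent y x b" if "x \<in> {a..b}" for x
  proof (cases "x = b")
    case True
    then show ?thesis using assms(1) by (simp add: strict_def)
  next
    case False
    then have "x - a < k" using that ab by auto
    then show ?thesis using assms(2) by (auto simp: agree_def)
  qed
  then show "d dvd ent (g * y) a b - ent 0 a b"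
    by (auto simp: ent_mult intro: dvd_sum)
qed

lemma agree_mult:
  assumes "agree d k f f'" "agree d k g g'"
  shows "agree d k (f * g) (f' * g')"
proof -
  have "f * g - f' * g' = (f - f') * g + f' * (g - g')"
    by (simp add: algebra_simps)
  moreover have "agree d k ((f - f') * g + f' * (g - g')) (0 + 0)"
    using assms by (intro agree_add agree_0_mult_left agree_0_mult_right) (simp_all add: agree_def)
  ultimately have "agree d k (f * g - f' * g') 0" by simp
  then show ?thesis by (simp add: agree_def)
qed

lemma agree_mult_strict_left:
  assumes "strict y" "agree d k g g'"
  shows "agree d (Suc k) (y * g) (y * g')"
  using agree_0_mult_strict_left[OF assms(1), of d k "g - g'"] assms(2)
  by (simp add: agree_def right_diff_distrib)

lemma agree_mult_strict_right:
  assumes "strict y" "agree d k g g'"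
  shows "agree d (Suc k) (g * y) (g' * y)"
  using agree_0_mult_strict_right[OF assms(1), of d k "g - g'"] assms(2)
  by (simp add: agree_def left_diff_distrib)

lemma strict_mult_left: "strict f \<Longrightarrow> strict (f * g)"
  by (auto simp: strict_def ent_mult)

lemma strict_mult_right: "strict g \<Longrightarrow> strict (f * g)"
  by (auto simp: strict_def ent_mult)

lemma agree_conj:
  assumes y: "strict y" and "agree d k v v'" "agree d k w w'"
  shows "agree d (Suc k) (v * y * w) (v' * y * w')"
proof -
  have "agree d (Suc k) (v * y) (v' * y)" and "agree d (Suc k) (y * w) (y * w')"
    using assms by (auto intro: agree_mult_strict_left agree_mult_strict_right)
  then have "agree d (Suc k) (v * y * w) (v' * y * w)" "agree d (Suc k) (v' * (y * w)) (v' * (y * w'))"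
    by (auto intro: agree_mult)
  then show ?thesis using agree_trans by (simp add: mult.assoc)
qed

lemma agree_0_eqI: "(\<And>k. agree 0 k f g) \<Longrightarrow> f = g"
  by (rule tri_eqI) (auto simp: agree_def dest: spec[of _ "Suc (_ - _)"])

section \<open>Values of signed words\<close>

text \<open>An inverse letter gets \<open>1 - X x\<close>, which inverts \<open>1 + X x\<close>
  exactly when \<open>X x\<close> squares to zero, as the arcs of a solution do
  (\<open>solves_square\<close>).\<close>

definition sval :: "('x \<Rightarrow> 'r::ring_1) \<Rightarrow> 'x sword \<Rightarrow> 'r" where
  "sval X w = prod_list (map (\<lambda>(x, s). if s then 1 + X x else 1 - X x) w)"

lemma sval_Nil [simp]: "sval X [] = 1"
  by (simp add: sval_def)

lemma sval_Cons [simp]: "sval X ((x, s) # w) = (if s then 1 + X x else 1 - X x) * sval X w"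
  by (simp add: sval_def)

lemma sval_append [simp]: "sval X (v @ w) = sval X v * sval X w"
  by (simp add: sval_def)

lemma inv_word_Nil [simp]: "inv_word [] = []"
  by (simp add: inv_word_def)

lemma inv_word_Cons: "inv_word ((x, s) # w) = inv_word w @ [(x, \<not> s)]"
  by (simp add: inv_word_def)

lemma inv_word_append: "inv_word (v @ w) = inv_word w @ inv_word v"
  by (simp add: inv_word_def)

lemma fst_set_inv_word [simp]: "fst ` set (inv_word w) = fst ` set w"
  by (force simp: inv_word_def)

lemma one_plus_minus: "x * x = 0 \<Longrightarrow> (1 + x) * (1 - x) = (1 :: 'r::ring_1)"
  "x * x = 0 \<Longrightarrow> (1 - x) * (1 + x) = (1 :: 'r::ring_1)"
  by (simp_all add: algebra_simps)

lemma sval_inv_left: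
  assumes "\<And>x. x \<in> fst ` set w \<Longrightarrow> X x * X x = 0"
  shows "sval X (inv_word w) * sval X w = 1"
  using assms
proof (induction w)
  case (Cons a w)
  obtain x s where a: "a = (x, s)" by force
  have xx: "X x * X x = 0" using Cons.prems a by force
  have "sval X (inv_word (a # w)) * sval X (a # w) = sval X (inv_word w) *
     ((if \<not> s then 1 + X x else 1 - X x) * (if s then 1 + X x else 1 - X x)) * sval X w"
    by (simp add: a inv_word_Cons mult.assoc)
  also have "\<dots> = sval X (inv_word w) * sval X w"
    using one_plus_minus[OF xx] by auto
  finally show ?case using Cons by auto
qed auto

lemma sval_agree:
  "(\<And>x. x \<in> fst ` set w \<Longrightarrow> agree d k (X x) (X' x)) \<Longrightarrow> agree d k (sval X w) (sval X' w)"
proof (induction w)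
  case (Cons a w)
  then show ?case by (cases a) (auto intro!: agree_mult agree_add agree_diff)
qed auto

section \<open>The recursion behind \<open>\<rho>\<^sup>q\<close>\<close>

text \<open>The right-hand side of the Wirtinger relation: the summand 1 of
  \<open>1 + y (e A)\<close> is unaffected by conjugation and is dropped on both sides. In the
  application \<open>e\<close> is \<open>eta_index P\<close> and \<open>x\<close> is
  \<open>x_word P\<close>.\<close>

definition conj_step ::
  "(nat \<Rightarrow> 'r::ring_1) \<Rightarrow> ('a \<Rightarrow> nat) \<Rightarrow> ('a \<Rightarrow> 'a sword) \<Rightarrow> ('a \<Rightarrow> 'r) \<Rightarrow> 'a \<Rightarrow> 'r" where
  "conj_step y e x X A = sval X (inv_word (x A)) * y (e A) * sval X (x A)"

text \<open>The factor \<open>r\<close> in the middle is essential: a monomial has to vanish even if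
  the two occurrences of its repeated variable are far apart.\<close>

definition nil_base :: "(nat \<Rightarrow> 'r::ring_1) \<Rightarrow> bool" where
  "nil_base y \<longleftrightarrow> (\<forall>k r. y k * r * y k = 0)"

lemma nil_baseD:
  assumes "nil_base y"
  shows "y k * r * y k = 0" "y k * (r * y k) = 0" "y k * (r * (y k * s)) = 0"
    "y k * y k = 0" "y k * (y k * s) = 0"
proof -
  have *: "y k * r * y k = 0" for r
    using assms by (simp add: nil_base_def)
  show "y k * r * y k = 0" "y k * (r * y k) = 0" "y k * (r * (y k * s)) = 0"
    using *[of r] by (simp_all add: mult.assoc[symmetric])
  show "y k * y k = 0" "y k * (y k * s) = 0"
    using *[of 1] by (simp_all add: mult.assoc[symmetric])
qed

definition rho_val ::
  "(nat \<Rightarrow> 'r::ring_1) \<Rightarrow> ('a \<Rightarrow> nat) \<Rightarrow> ('a \<Rightarrow> 'a sword) \<Rightarrow> nat \<Rightarrow> 'a \<Rightarrow> 'r" where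
  "rho_val y e x q = (conj_step y e x ^^ q) (y \<circ> e)"

lemma rho_val_0: "rho_val y e x 0 A = y (e A)"
  and rho_val_Suc: "rho_val y e x (Suc q) A = conj_step y e x (rho_val y e x q) A"
  by (simp_all add: rho_val_def)

lemma rho_val_square:
  assumes "nil_base y"
  shows "rho_val y e x q A * rho_val y e x q A = 0"
proof (cases q)
  case (Suc r)
  have "v * y (e A) * z * (z' * y (e A) * v') = 0" for v z z' v'
    by (metis nil_baseD(1)[OF assms] mult.assoc mult_zero_left mult_zero_right)
  then show ?thesis
    by (simp add: Suc rho_val_Suc conj_step_def)
qed (simp add: rho_val_0 nil_baseD[OF assms])

text \<open>One step of \<rho> conjugates each letter by the previous value of its
  \<open>x_word\<close>. The two conjugating values are inverse to each other, so the 1 in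
  \<open>1 + y\<close> or \<open>1 - y\<close> survives and the rest becomes a
  \<open>conj_step\<close>. The offset is 2 because \<open>rho P 2\<close> leaves words
  unchanged.\<close>

lemma sval_eta_rho:
  assumes "nil_base y"
  shows "sval y (eta P (rho P (q + 2) w)) = sval (rho_val y (eta_index P) (x_word P) q) w"
proof (induction q arbitrary: w)
  case 0
  show ?case
    by (induction w) (auto simp: rho.simps eta_def rho_val_0)
next
  case (Suc q)
  let ?Y = "rho_val y (eta_index P) (x_word P)"
  have IH: "sval y (eta P (rho P (Suc (Suc q)) v)) = sval (?Y q) v" for v
    using Suc by simp
  show ?case
  proof (induction w)
    case Nil
    then show ?case by (simp add: rho.simps eta_def)
  next
    case (Cons a w)
    obtain A s where a: "a = (A, s)" by force
    let ?V = "sval (?Y q) (x_word P A)" and ?V' = "sval (?Y q) (inv_word (x_word P A))"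
    have inv: "?V' * ?V = 1"
      by (rule sval_inv_left) (rule rho_val_square[OF assms])
    have "rho P (Suc q + 2) (a # w) = rho P (q + 2) (inv_word (x_word P A)) @ [(A, s)] @
        rho P (q + 2) (x_word P A) @ rho P (Suc q + 2) w"
      by (subst rho.simps, subst (4) rho.simps) (simp add: a)
    then have "sval y (eta P (rho P (Suc q + 2) (a # w))) =
        sval y (eta P (rho P (q + 2) (inv_word (x_word P A)))) *
        (if s then 1 + y (eta_index P A) else 1 - y (eta_index P A)) *
        sval y (eta P (rho P (q + 2) (x_word P A))) * sval y (eta P (rho P (Suc q + 2) w))"
      by (simp add: eta_def mult.assoc)
    also have "\<dots> = ?V' * (if s then 1 + y (eta_index P A) else 1 - y (eta_index P A)) * ?V
        * sval (?Y (Suc q)) w"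
      using Suc Cons.IH by simp
    also have "?V' * (if s then 1 + y (eta_index P A) else 1 - y (eta_index P A)) * ?V =
        (if s then 1 + ?Y (Suc q) A else 1 - ?Y (Suc q) A)"
      using inv by (simp add: rho_val_Suc conj_step_def algebra_simps)
    finally show ?case by (simp add: a)
  qed
qed

section \<open>Convergence of the recursion in triangular matrices\<close>

definition strict_base :: "(nat \<Rightarrow> tri) \<Rightarrow> bool" where
  "strict_base y \<longleftrightarrow> (\<forall>k. strict (y k))"

text \<open>The contraction property: the strict factor in the middle adds a diagonal, whatever
  happens in the conjugating words.\<close>

lemma conj_step_agree:
  assumes "strict_base y" and "\<And>B. B \<in> fst ` set (x A) \<Longrightarrow> agree d k (X B) (X' B)"
  shows "agree d (Suc k) (conj_step y e x X A) (conj_step y e x X' A)"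
  unfolding conj_step_def using assms
  by (intro agree_conj sval_agree) (auto simp: strict_base_def)

text \<open>The uniqueness half of a contraction argument, by induction on the number of diagonals.
  Approximate fixed points are allowed because after some shifts the old solution satisfies the new
  system only modulo a divisor of \<Delta>.\<close>

lemma conj_step_fixed_unique:
  assumes y: "strict_base y"
    and closed: "\<And>A. A \<in> S \<Longrightarrow> fst ` set (x A) \<subseteq> S"
    and X: "\<And>A. A \<in> S \<Longrightarrow> agree d k (X A) (conj_step y e x X A)"
    and X': "\<And>A. A \<in> S \<Longrightarrow> agree d k (X' A) (conj_step y e x X' A)"
    and A: "A \<in> S"
  shows "agree d k (X A) (X' A)"
proof -
  have "j \<le> k \<longrightarrow> (\<forall>A\<in>S. agree d j (X A) (X' A))" for j
  proof (induction j)
    case (Suc j)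
    show ?case
    proof (intro impI ballI)
      fix A assume j: "Suc j \<le> k" and A: "A \<in> S"
      have "agree d (Suc j) (conj_step y e x X A) (conj_step y e x X' A)"
        using Suc j closed[OF A] by (intro conj_step_agree[where k = j] y) auto
      then show "agree d (Suc j) (X A) (X' A)"
        using agree_mono[OF X[OF A] j] agree_mono[OF X'[OF A] j] by (meson agree_sym agree_trans)
    qed
  qed auto
  then show ?thesis using A by blast
qed

lemma rho_val_agree_Suc:
  assumes "strict_base y"
  shows "agree d q (rho_val y e x q A) (rho_val y e x (q + r) A)"
proof (induction q arbitrary: A)
  case (Suc q)
  show ?case using conj_step_agree[OF assms Suc] by (simp add: rho_val_Suc)
qed auto

lemma rho_val_agree_fixed:
  assumes y: "strict_base y"
    and closed: "\<And>A. A \<in> S \<Longrightarrow> fst ` set (x A) \<subseteq> S"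
    and X: "\<And>A. A \<in> S \<Longrightarrow> X A = conj_step y e x X A"
    and A: "A \<in> S"
  shows "agree d q (rho_val y e x q A) (X A)"
  using A
proof (induction q arbitrary: A)
  case (Suc q)
  have "agree d (Suc q) (conj_step y e x (rho_val y e x q) A) (conj_step y e x X A)"
    using Suc closed by (intro conj_step_agree y) blast
  then show ?case using X[OF Suc.prems] by (simp add: rho_val_Suc)
qed auto

lemma conj_step_fixed_exists:
  assumes y: "strict_base y"
  obtains X where "\<And>A. X A = conj_step y e x X A"
proof -
  let ?Y = "rho_val y e x"
  \<comment> \<open>The entry at \<open>(a, b)\<close> no longer changes from the iterate
    \<open>Suc (b - a)\<close> on, so the limit can be taken entry by entry.\<close>
  define X where "X A = Abs_tri (\<lambda>a b. ent (?Y (Suc (b - a)) A) a b)" for A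
  have ent_X: "ent (X A) a b = ent (?Y (Suc (b - a)) A) a b" for A a b
    unfolding X_def by (subst Abs_tri_inverse) auto
  have YX: "agree 0 q (?Y q A) (X A)" for q A
  proof (unfold agree_def, intro allI impI)
    fix a b :: nat assume "b - a < q"
    then obtain r where "q = Suc (b - a) + r" by (metis Suc_leI le_iff_add)
    then show "0 dvd ent (?Y q A) a b - ent (X A) a b"
      using rho_val_agree_Suc[OF y, of 0 "Suc (b - a)" e x A r] by (auto simp: ent_X agree_def)
  qed
  have "X A = conj_step y e x X A" for A
  proof (rule agree_0_eqI)
    fix k
    have "agree 0 (Suc k) (conj_step y e x (?Y k) A) (conj_step y e x X A)"
      by (intro conj_step_agree y YX)
    then show "agree 0 k (X A) (conj_step y e x X A)"
      using agree_trans[OF agree_sym[OF YX[of "Suc k" A]]] agree_mono[of 0 "Suc k" _ _ k]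
      by (simp add: rho_val_Suc)
  qed
  then show ?thesis using that by blast
qed

section \<open>Magnus expansion in square-free monomials\<close>

lemma phi_Nil: "phi [] m = (if m = [] then 1 else 0)"
  by (simp add: phi_def nc_one_def)

text \<open>A prefix of length at least 2 with nonzero coefficient in \<open>phi_gen\<close> would
  be a power of \<open>h\<close>, which a distinct list cannot contain. Hence only the prefixes
  \<open>[]\<close> and \<open>[h]\<close> count, and the geometric series of an inverse generator
  acts as its linear part.\<close>

lemma phi_Cons:
  assumes "distinct m"
  shows "phi ((h, s) # W) m =
    phi W m + (if m \<noteq> [] \<and> hd m = h then (if s then 1 else - 1) * phi W (tl m) else 0)"
proof -
  have gen: "phi_gen (h, s) (take k m) =
      (if k = 0 then 1 else if k = 1 \<and> hd m = h then (if s then 1 else - 1) else 0)"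
    if "k \<le> length m" for k
  proof -
    consider "k = 0" | "k = 1" | l where "k = Suc (Suc l)"
      by (metis One_nat_def not0_implies_Suc)
    then show ?thesis
    proof cases
      case 1
      then show ?thesis by (cases s) auto
    next
      case 2
      then show ?thesis using that by (cases m; cases s) auto
    next
      case 3
      have "\<not> distinct (replicate k h)" using 3 by simp
      then have "take k m \<noteq> replicate k h" using assms by (metis distinct_take)
      moreover have "length (take k m) = k" using that by simp
      moreover have "take k m \<noteq> []" "take k m \<noteq> [h]"
        using 3 that by (metis calculation(2) length_Cons list.size(3) nat.distinct(1) nat.inject)+
      ultimately show ?thesis using 3 by (cases s) simp_all
    qed
  qed
  have "phi ((h, s) # W) m = (\<Sum>k\<le>length m. phi_gen (h, s) (take k m) * phi W (drop k m))"
    by (simp add: phi_def nc_mult_def)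
  also have "\<dots> = (\<Sum>k\<le>length m. (if k = 0 then phi W m else 0) +
      (if k = 1 then (if hd m = h then (if s then 1 else - 1) else 0) * phi W (tl m) else 0))"
    by (intro sum.cong) (auto simp: gen drop_Suc)
  also have "\<dots> = phi W m + (if m \<noteq> [] \<and> hd m = h then (if s then 1 else - 1) * phi W (tl m) else 0)"
    by (cases m) (auto simp: sum.distrib Suc_le_eq)
  finally show ?thesis .
qed

lemma phi_empty_monomial [simp]: "phi W [] = 1"
  by (induction W) (auto simp: phi_Nil phi_Cons)

definition squarefree_lists :: "nat \<Rightarrow> nat list set" where
  "squarefree_lists n = {m. distinct m \<and> set m \<subseteq> {..<n}}"

lemma finite_squarefree_lists [simp]: "finite (squarefree_lists n)"
  unfolding squarefree_lists_def
  using finite_subset_distinct[of "{..<n}"] by (simp add: conj_commute)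

definition monomial :: "(nat \<Rightarrow> 'r::ring_1) \<Rightarrow> nat list \<Rightarrow> 'r" where
  "monomial y m = prod_list (map y m)"

lemma monomial_simps [simp]: "monomial y [] = 1" "monomial y (h # m) = y h * monomial y m"
  by (simp_all add: monomial_def)

lemma monomial_repeat:
  assumes "nil_base y" "h \<in> set m"
  shows "y h * monomial y m = 0"
proof -
  obtain m1 m2 where "m = m1 @ h # m2" using assms(2) by (meson split_list)
  then have "y h * monomial y m = (y h * monomial y m1 * y h) * monomial y m2"
    by (simp add: monomial_def mult.assoc)
  then show ?thesis using nil_baseD(1)[OF assms(1)] by simp
qed

lemma sval_expansion:
  fixes y :: "nat \<Rightarrow> 'r::ring_1"
  assumes y: "nil_base y" and zero: "\<And>k. k \<ge> n \<Longrightarrow> y k = 0"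
  shows "sval y W = (\<Sum>m\<in>squarefree_lists n. of_int (phi W m) * monomial y m)"
proof (induction W)
  case Nil
  have "(\<Sum>m\<in>squarefree_lists n. of_int (phi [] m) * monomial y m) =
      (\<Sum>m\<in>squarefree_lists n. if m = [] then 1 else 0)"
    by (intro sum.cong) (auto simp: phi_Nil)
  also have "\<dots> = 1"
  proof -
    have "[] \<in> squarefree_lists n" by (simp add: squarefree_lists_def)
    then show ?thesis by simp
  qed
  finally show ?case by simp
next
  case (Cons a W)
  obtain h s where a: "a = (h, s)" by force
  let ?s = "if s then 1 else - 1 :: 'r" and ?D = "squarefree_lists n"
  have "(\<Sum>m\<in>?D. of_int (phi (a # W) m) * monomial y m) =
      (\<Sum>m\<in>?D. of_int (phi W m) * monomial y m) +
      (\<Sum>m\<in>?D. if m \<noteq> [] \<and> hd m = h then ?s * of_int (phi W (tl m)) * monomial y m else 0)"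
    unfolding sum.distrib[symmetric]
    by (intro sum.cong) (auto simp: a phi_Cons squarefree_lists_def algebra_simps)
  also have "(\<Sum>m\<in>?D. if m \<noteq> [] \<and> hd m = h then ?s * of_int (phi W (tl m)) * monomial y m else 0) =
      (\<Sum>m\<in>{m \<in> ?D. m \<noteq> [] \<and> hd m = h}. ?s * of_int (phi W (tl m)) * monomial y m)"
    by (rule sum.inter_filter[symmetric]) simp
  \<comment> \<open>Stripping the leading \<open>h\<close> leaves the lists that avoid
    \<open>h\<close>, provided \<open>h < n\<close>. The next step readmits all lists, since the new
    terms vanish by \<open>monomial_repeat\<close> or because \<open>y h = 0\<close>.\<close>
  also have "\<dots> = (\<Sum>m\<in>{m \<in> ?D. h \<notin> set m \<and> h < n}. ?s * of_int (phi W m) * (y h * monomial y m))"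
    by (rule sum.reindex_bij_witness[of _ "(#) h" tl])
      (auto simp: squarefree_lists_def neq_Nil_conv)
  also have "\<dots> = (\<Sum>m\<in>?D. ?s * of_int (phi W m) * (y h * monomial y m))"
    using zero monomial_repeat[OF y]
    by (intro sum.mono_neutral_left) (auto, metis mult_zero_left mult_zero_right not_less)
  also have "\<dots> = ?s * y h * (\<Sum>m\<in>?D. of_int (phi W m) * monomial y m)"
    unfolding sum_distrib_left
    by (intro sum.cong refl) (metis mult.assoc mult_of_int_commute)
  finally have "(\<Sum>m\<in>?D. of_int (phi (a # W) m) * monomial y m) = sval y W + ?s * y h * sval y W"
    by (simp add: Cons)
  then show ?case by (simp add: a algebra_simps)
qed

text \<open>
  The elementary matrices that turn the coefficients of the contiguous factors of \<open>L\<close> into matrix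
  entries.
\<close>

lift_definition mer :: "nat list \<Rightarrow> nat \<Rightarrow> tri" is
  "\<lambda>L k a b. if b = Suc a \<and> a < length L \<and> L ! a = k then 1 else 0" by simp

lemma ent_mer: "ent (mer L k) a b = (if b = Suc a \<and> a < length L \<and> L ! a = k then 1 else 0)"
  by transfer simp

lemma strict_base_mer: "strict_base (mer L)"
  by (simp add: strict_base_def strict_def ent_mer)

lemma mer_outside: "k \<notin> set L \<Longrightarrow> mer L k = 0"
  by (rule tri_eqI) (auto simp: ent_mer)

lemma ent_mer_mult:
  "ent (mer L k * f) a b = (if a < length L \<and> L ! a = k then ent f (Suc a) b else 0)"
proof (cases "Suc a \<le> b")
  case True
  have "ent (mer L k * f) a b =
      (\<Sum>x = a..b. if x = Suc a then (if a < length L \<and> L ! a = k then ent f (Suc a) b else 0) else 0)"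
    unfolding ent_mult by (intro sum.cong) (auto simp: ent_mer)
  then show ?thesis using True by simp
next
  case False
  have "ent (mer L k * f) a b = 0"
    unfolding ent_mult using False by (intro sum.neutral) (auto simp: ent_mer)
  then show ?thesis using False by simp
qed

lemma ent_mult_mer:
  "ent (f * mer L k) a b = (if 0 < b \<and> b \<le> length L \<and> L ! (b - 1) = k then ent f a (b - 1) else 0)"
proof (cases "a < b")
  case True
  have "ent (f * mer L k) a b =
      (\<Sum>x = a..b. if x = b - 1 then (if b \<le> length L \<and> L ! (b - 1) = k then ent f a (b - 1) else 0) else 0)"
    unfolding ent_mult using True by (intro sum.cong) (auto simp: ent_mer)
  then show ?thesis using True by simp
next
  case False
  have "ent (f * mer L k) a b = 0"
    unfolding ent_mult using False by (intro sum.neutral) (auto simp: ent_mer)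
  then show ?thesis using False by auto
qed

lemma nil_base_mer:
  assumes "distinct L"
  shows "nil_base (mer L)"
  unfolding nil_base_def
proof (intro allI tri_eqI)
  fix k r a b
  show "ent (mer L k * r * mer L k) a b = ent 0 a b"
  proof (cases "a < length L \<and> L ! a = k \<and> 0 < b \<and> b \<le> length L \<and> L ! (b - 1) = k")
    case True
    have "b - 1 = a"
      by (rule nth_eq_iff_index_eq[OF assms, THEN iffD1]) (use True in auto)
    then show ?thesis by (simp add: ent_mult_mer ent_mer_mult)
  qed (auto simp: ent_mult_mer ent_mer_mult)
qed

lemma ent_monomial_mer:
  "a \<le> b \<Longrightarrow> b \<le> length L \<Longrightarrow>
    ent (monomial (mer L) m) a b = (if m = take (b - a) (drop a L) then 1 else 0)"
proof (induction m arbitrary: a)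
  case Nil
  then show ?case by (auto simp: ent_one)
next
  case (Cons h m)
  show ?case
  proof (cases "a = b")
    case True
    then show ?thesis by (simp add: ent_mer_mult)
  next
    case False
    then have "a < length L" "b - a = Suc (b - Suc a)" using Cons.prems by auto
    then have "take (b - a) (drop a L) = L ! a # take (b - Suc a) (drop (Suc a) L)"
      by (metis Cons_nth_drop_Suc take_Suc_Cons)
    then show ?thesis using Cons False by (auto simp: ent_mer_mult)
  qed
qed

text \<open>If the elementary matrices are laid out along \<open>m\<close> itself, then
  \<open>m\<close> is the only monomial with a nonzero entry at
  \<open>(0, length m)\<close>.\<close>

lemma phi_eta_rho_entry:
  assumes m: "distinct m"
  shows "phi (eta P (rho P (q + 2) w)) m =
    ent (sval (rho_val (mer m) (eta_index P) (x_word P) q) w) 0 (length m)"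
proof -
  define n where "n = Suc (Max (insert 0 (set m)))"
  have n: "set m \<subseteq> {..<n}" by (auto simp: n_def less_Suc_eq_le)
  let ?W = "eta P (rho P (q + 2) w)"
  have "sval (rho_val (mer m) (eta_index P) (x_word P) q) w = sval (mer m) ?W"
    by (rule sval_eta_rho[symmetric]) (rule nil_base_mer[OF m])
  also have "\<dots> = (\<Sum>l\<in>squarefree_lists n. of_int (phi ?W l) * monomial (mer m) l)"
    using n by (intro sval_expansion nil_base_mer[OF m] mer_outside) auto
  also have "ent \<dots> 0 (length m) = (\<Sum>l\<in>squarefree_lists n. if l = m then phi ?W m else 0)"
    unfolding ent_sum by (intro sum.cong) (auto simp: ent_monomial_mer)
  also have "\<dots> = phi ?W m"
  proof -
    have "m \<in> squarefree_lists n" using m n by (simp add: squarefree_lists_def)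
    then show ?thesis by simp
  qed
  finally show ?thesis by simp
qed

text \<open>This gives the \<open>THE\<close> in \<open>mu\<close> its meaning: a coefficient is a
  single matrix entry, and each entry of the iterates stabilises.\<close>

lemma mu_eventually:
  assumes m: "distinct m"
  shows "eventually (\<lambda>q. phi (eta P (rho P q (signed_comp P k))) m = mu P (m @ [k])) sequentially"
proof -
  let ?f = "\<lambda>q. phi (eta P (rho P q (signed_comp P k))) m"
  let ?Y = "rho_val (mer m) (eta_index P) (x_word P)" and ?w = "signed_comp P k"
  \<comment> \<open>The entry lies at distance \<open>length m\<close> from the diagonal, so
    agreement on one more diagonal than that is required.\<close>
  define N where "N = Suc (length m)"
  have "?f q = ?f (N + 2)" if "q \<ge> N + 2" for q
  proof -
    define r where "r = q - (N + 2)"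
    have q: "q = N + r + 2" using that by (simp add: r_def)
    have "agree 0 N (sval (?Y N) ?w) (sval (?Y (N + r)) ?w)"
      by (intro sval_agree rho_val_agree_Suc strict_base_mer)
    then have "ent (sval (?Y N) ?w) 0 (length m) = ent (sval (?Y (N + r)) ?w) 0 (length m)"
      by (auto simp: agree_def N_def)
    then show ?thesis by (simp only: q phi_eta_rho_entry[OF m])
  qed
  then have ev: "eventually (\<lambda>q. ?f q = ?f (N + 2)) sequentially"
    unfolding eventually_sequentially by blast
  have "mu P (m @ [k]) = ?f (N + 2)"
    unfolding mu_def last_snoc butlast_snoc
  proof (rule the_equality[where a = "?f (N + 2)"])
    fix z assume "eventually (\<lambda>q. ?f q = z) sequentially"
    with ev have "eventually (\<lambda>q. z = ?f (N + 2)) sequentially"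
      by eventually_elim simp
    then show "z = ?f (N + 2)" by simp
  qed (rule ev)
  then show ?thesis using ev by simp
qed

lemma mu_singleton [simp]: "mu P [k] = 1"
  using mu_eventually[of "[]" P k] by simp

lemma ent_longitude_expansion:
  assumes y: "nil_base y" "strict_base y" and zero: "\<And>k. k \<ge> n \<Longrightarrow> y k = 0"
    and closed: "\<And>A. A \<in> S \<Longrightarrow> fst ` set (x_word P A) \<subseteq> S"
    and X: "\<And>A. A \<in> S \<Longrightarrow> X A = conj_step y (eta_index P) (x_word P) X A"
    and w: "fst ` set (signed_comp P k) \<subseteq> S"
  shows "ent (sval X (signed_comp P k)) a b =
    (\<Sum>m\<in>squarefree_lists n. mu P (m @ [k]) * ent (monomial y m) a b)"
proof -
  let ?w = "signed_comp P k" and ?Y = "rho_val y (eta_index P) (x_word P)"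
  have "eventually (\<lambda>q. \<forall>m\<in>squarefree_lists n. phi (eta P (rho P q ?w)) m = mu P (m @ [k])) sequentially"
    by (intro eventually_ball_finite finite_squarefree_lists ballI mu_eventually) (simp add: squarefree_lists_def)
  then obtain N where N: "\<And>q m. q \<ge> N \<Longrightarrow> m \<in> squarefree_lists n \<Longrightarrow>
      phi (eta P (rho P q ?w)) m = mu P (m @ [k])"
    unfolding eventually_sequentially by blast
  \<comment> \<open>Large enough for two purposes: the finitely many coefficients are stable, and
    the iterate agrees with \<open>X\<close> on the diagonal through \<open>(a, b)\<close>.\<close>
  define q where "q = N + Suc (b - a)"
  have "agree 0 q (sval (?Y q) ?w) (sval X ?w)"
    using w by (intro sval_agree rho_val_agree_fixed[OF y(2) closed X]) auto
  then have "ent (sval X ?w) a b = ent (sval (?Y q) ?w) a b"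
    by (auto simp: agree_def q_def)
  also have "sval (?Y q) ?w = sval y (eta P (rho P (q + 2) ?w))"
    by (rule sval_eta_rho[symmetric, OF y(1)])
  also have "\<dots> = (\<Sum>m\<in>squarefree_lists n. of_int (phi (eta P (rho P (q + 2) ?w)) m) * monomial y m)"
    by (rule sval_expansion[OF y(1) zero])
  also have "\<dots> = (\<Sum>m\<in>squarefree_lists n. of_int (mu P (m @ [k])) * monomial y m)"
    by (intro sum.cong) (auto simp: N q_def)
  finally show ?thesis by (simp add: ent_sum)
qed

section \<open>Crossings of a nanophrase\<close>

text \<open>The sign of an occurrence depends only on the components that contain the letter, not on
  positions inside them. This relation is therefore unchanged by shifts and by the third move, which
  makes the invariance of signs immediate.\<close>

definition occ_rel :: "'a list list \<Rightarrow> ('a \<times> nat) set" where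
  "occ_rel p = {(A, k). k < length p \<and> A \<in> set (p ! k)}"

definition mixed :: "('a \<times> nat) set \<Rightarrow> 'a \<Rightarrow> bool" where
  "mixed R A \<longleftrightarrow> (\<exists>j k. j < k \<and> (A, j) \<in> R \<and> (A, k) \<in> R)"

text \<open>
  Letters occurring twice in one component get \<open>None\<close> and are skipped everywhere below; for the others
  the value is the sign \<open>\<epsilon>\<close> of the occurrence in component \<open>k\<close>.
\<close>

definition crossing :: "('a \<times> nat) set \<Rightarrow> ('a \<rightharpoonup> alpha_v) \<Rightarrow> 'a \<Rightarrow> nat \<Rightarrow> int option" where
  "crossing R m A k = (if \<not> mixed R A then None
     else if \<exists>l>k. (A, l) \<in> R
     then Some (if m A = Some b_plus then 1 else if m A = Some a_minus then - 1 else 0)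
     else Some (if m A = Some a_plus then 1 else if m A = Some b_minus then - 1 else 0))"

abbreviation crossing_of :: "'a nanophrase \<Rightarrow> 'a \<Rightarrow> nat \<Rightarrow> int option" where
  "crossing_of P \<equiv> crossing (occ_rel (comps P)) (proj P)"

abbreviation mixed_in :: "'a nanophrase \<Rightarrow> 'a \<Rightarrow> bool" where
  "mixed_in P \<equiv> mixed (occ_rel (comps P))"

definition cword :: "('a \<Rightarrow> nat \<Rightarrow> int option) \<Rightarrow> nat \<Rightarrow> 'a list \<Rightarrow> 'a sword" where
  "cword c k w = concat (map (\<lambda>A. case c A k of None \<Rightarrow> [] | Some e \<Rightarrow> letter_power A e) w)"

lemma cword_simps [simp]:
  "cword c k [] = []"
  "cword c k (A # w) = (case c A k of None \<Rightarrow> [] | Some e \<Rightarrow> letter_power A e) @ cword c k w"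
  "cword c k (v @ w) = cword c k v @ cword c k w"
  by (simp_all add: cword_def)

lemma letters_cword: "fst ` set (cword c k w) \<subseteq> {A \<in> set w. c A k \<noteq> None}"
proof (induction w)
  case (Cons A w)
  then show ?case by (cases "c A k") (auto simp: letter_power_def split: if_splits)
qed auto

lemma count_list_concat: "count_list (concat ws) A = sum_list (map (\<lambda>w. count_list w A) ws)"
  by (induction ws) auto

lemma length_occurrences: "length (occurrences P A) = count_list (concat (comps P)) A"
proof -
  have inner: "length (concat (map (\<lambda>j. if w ! j = A then [(i, j)] else []) [0..<length w])) = count_list w A"
    for w :: "'a list" and i :: nat
  proof -
    have "concat (map (\<lambda>j. if w ! j = A then [(i, j)] else []) js) = map (Pair i) (filter (\<lambda>j. w ! j = A) js)" for js
      by (induction js) auto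
    then have "length (concat (map (\<lambda>j. if w ! j = A then [(i, j)] else []) [0..<length w])) =
        card {j. j < length w \<and> w ! j = A}"
      by (simp add: length_filter_conv_card) (rule arg_cong[where f = card], auto)
    also have "\<dots> = count_list w A"
      by (simp add: count_list_eq_length_filter length_filter_conv_card eq_commute)
    finally show ?thesis .
  qed
  have "length (occurrences P A) =
      sum_list (map (\<lambda>i. count_list (comps P ! i) A) [0..<length (comps P)])"
    unfolding occurrences_def length_concat[of "map _ [0..<length (comps P)]"] map_map comp_def inner ..
  also have "map (\<lambda>i. count_list (comps P ! i) A) [0..<length (comps P)] = map (\<lambda>w. count_list w A) (comps P)"
    by (rule nth_equalityI) auto
  finally show ?thesis by (simp add: count_list_concat)
qed

lemma set_occurrences:
  "set (occurrences P A) = {(i, j). i < length (comps P) \<and> j < length (comps P ! i) \<and> comps P ! i ! j = A}"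
  unfolding occurrences_def by (auto split: if_splits)

lemma sorted_occurrences: "sorted_wrt (\<lambda>a b. fst a \<le> fst b) (occurrences P A)"
proof -
  have "sorted_wrt (\<lambda>a b. fst a \<le> fst b) (concat (map F [0..<n]))"
    if F: "\<And>i a. a \<in> set (F i) \<Longrightarrow> fst a = i" for F :: "nat \<Rightarrow> (nat \<times> nat) list" and n
  proof (induction n)
    case (Suc n)
    have "sorted_wrt (\<lambda>a b. fst a \<le> fst b) xs" if "\<And>a. a \<in> set xs \<Longrightarrow> fst a = n" for xs :: "(nat \<times> nat) list"
      using that by (induction xs) auto
    from this[of "F n"] Suc F show ?case
      by (auto simp: sorted_wrt_append)
  qed auto
  note * = this
  show ?thesis unfolding occurrences_def by (rule *) (auto split: if_splits)
qed

lemma nanophrase_letter: "nanophrase n P \<Longrightarrow> (A, k) \<in> occ_rel (comps P) \<Longrightarrow> A \<in> dom (proj P)"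
  unfolding nanophrase_def occ_rel_def by (auto dest!: subsetD[of _ _ A] nth_mem)

lemma occurrences_cases:
  assumes "nanophrase n P" "A \<in> dom (proj P)"
  obtains i j i' j' where "occurrences P A = [(i, j), (i', j')]" "i \<le> i'"
    "\<And>k l. k < length (comps P) \<Longrightarrow> l < length (comps P ! k) \<Longrightarrow> comps P ! k ! l = A \<longleftrightarrow> (k, l) = (i, j) \<or> (k, l) = (i', j')"
    "\<And>k. (A, k) \<in> occ_rel (comps P) \<longleftrightarrow> k = i \<or> k = i'"
    "mixed_in P A \<longleftrightarrow> i < i'"
    "i < length (comps P)" "i' < length (comps P)" "j < length (comps P ! i)" "j' < length (comps P ! i')"
    "comps P ! i ! j = A" "comps P ! i' ! j' = A"
proof -
  have "length (occurrences P A) = 2"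
    using assms by (simp add: length_occurrences nanophrase_def)
  then obtain u v where uv: "occurrences P A = [u, v]"
    by (auto simp: numeral_2_eq_2 length_Suc_conv)
  obtain i j i' j' where ij: "u = (i, j)" "v = (i', j')" by force
  have occ: "occurrences P A = [(i, j), (i', j')]" using uv ij by simp
  have le: "i \<le> i'" using sorted_occurrences[of P A] occ by simp
  have S: "{(i, j), (i', j')} = {(i, j). i < length (comps P) \<and> j < length (comps P ! i) \<and> comps P ! i ! j = A}"
    using set_occurrences[of P A] occ by simp
  have pos: "comps P ! k ! l = A \<longleftrightarrow> (k, l) = (i, j) \<or> (k, l) = (i', j')"
    if "k < length (comps P)" "l < length (comps P ! k)" for k l
    using S that by (auto simp: set_eq_iff)
  have R: "(A, k) \<in> occ_rel (comps P) \<longleftrightarrow> k = i \<or> k = i'" for k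
  proof -
    have "(A, k) \<in> occ_rel (comps P) \<longleftrightarrow> (\<exists>l. (k, l) \<in> {(i, j), (i', j')})"
      unfolding S by (auto simp: occ_rel_def in_set_conv_nth)
    then show ?thesis by auto
  qed
  have "mixed_in P A \<longleftrightarrow> i < i'" unfolding mixed_def R using le by auto
  moreover have "(i, j) \<in> {(i, j), (i', j')}" "(i', j') \<in> {(i, j), (i', j')}" by auto
  ultimately show ?thesis using that[OF occ le pos R] unfolding S by auto
qed

lemma eps_crossing:
  assumes P: "nanophrase n P" and i: "i < length (comps P)" "j < length (comps P ! i)"
  shows "eps P i j = (case crossing_of P (comps P ! i ! j) i of None \<Rightarrow> 0 | Some e \<Rightarrow> e)"
proof -
  let ?A = "comps P ! i ! j"
  have "(?A, i) \<in> occ_rel (comps P)" using i by (auto simp: occ_rel_def)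
  then have "?A \<in> dom (proj P)" by (rule nanophrase_letter[OF P])
  from P this show ?thesis
  proof (rule occurrences_cases)
    fix k l k' l'
    assume occ: "occurrences P ?A = [(k, l), (k', l')]" and le: "k \<le> k'"
      and pos: "\<And>a b. a < length (comps P) \<Longrightarrow> b < length (comps P ! a) \<Longrightarrow>
        comps P ! a ! b = ?A \<longleftrightarrow> (a, b) = (k, l) \<or> (a, b) = (k', l')"
      and R: "\<And>a. (?A, a) \<in> occ_rel (comps P) \<longleftrightarrow> a = k \<or> a = k'"
      and mixed: "mixed_in P ?A \<longleftrightarrow> k < k'"
    have ij: "(i, j) = (k, l) \<or> (i, j) = (k', l')" using pos[OF i] by simp
    have other: "other_occ P (i, j) = (if (k, l) = (i, j) then (k', l') else (k, l))"
      unfolding other_occ_def prod.case Let_def first_occ_def second_occ_def occ by simp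
    show ?thesis
    proof (cases "k < k'")
      case True
      then show ?thesis using ij
        by (auto simp: eps_def other crossing_def mixed R Let_def)
    next
      case False
      then have "k = k'" using le by simp
      then show ?thesis using ij
        by (auto simp: eps_def other crossing_def mixed Let_def)
    qed
  qed
qed

lemma signed_prefix_cword:
  assumes P: "nanophrase n P" and i: "i < length (comps P)" "l \<le> length (comps P ! i)"
  shows "signed_prefix P i l = cword (crossing_of P) i (take l (comps P ! i))"
proof -
  have "map (\<lambda>j. letter_power (comps P ! i ! j) (eps P i j)) [0..<l] =
      map (\<lambda>A. case crossing_of P A i of None \<Rightarrow> [] | Some e \<Rightarrow> letter_power A e) (take l (comps P ! i))"
    using i by (intro nth_equalityI)
      (auto simp: eps_crossing[OF P] letter_power_def split: option.splits)
  then show ?thesis by (simp add: signed_prefix_def cword_def)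
qed

lemma signed_comp_cword:
  "nanophrase n P \<Longrightarrow> i < length (comps P) \<Longrightarrow> signed_comp P i = cword (crossing_of P) i (comps P ! i)"
  by (simp add: signed_comp_def signed_prefix_cword)

lemma letters_cword_mixed: "fst ` set (cword (crossing R m) k w) \<subseteq> Collect (mixed R)"
  using letters_cword[of "crossing R m" k w] by (auto simp: crossing_def split: if_splits)

text \<open>For each of the four projections exactly one of the two occurrences in different
  components has sign 0, namely the one on the over strand. It is the occurrence from which
  \<open>x_word\<close> and \<open>eta_index\<close> are read.\<close>

lemma over_occurrence:
  assumes P: "nanophrase n P" and A: "mixed_in P A"
  obtains k l where "k < length (comps P)" "l < length (comps P ! k)" "comps P ! k ! l = A"
    "crossing_of P A k = Some 0" "x_word P A = signed_prefix P k l" "eta_index P A = k"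
    "\<And>k' l'. k' < length (comps P) \<Longrightarrow> l' < length (comps P ! k') \<Longrightarrow> comps P ! k' ! l' = A \<Longrightarrow>
      crossing_of P A k' = Some 0 \<Longrightarrow> k' = k \<and> l' = l"
proof -
  have "A \<in> dom (proj P)" using A nanophrase_letter[OF P] by (auto simp: mixed_def)
  then obtain a where a: "proj P A = Some a" by auto
  from P \<open>A \<in> dom (proj P)\<close> show ?thesis
  proof (rule occurrences_cases)
    fix i j i' j'
    assume occ: "occurrences P A = [(i, j), (i', j')]"
      and pos: "\<And>k l. k < length (comps P) \<Longrightarrow> l < length (comps P ! k) \<Longrightarrow>
        comps P ! k ! l = A \<longleftrightarrow> (k, l) = (i, j) \<or> (k, l) = (i', j')"
      and R: "\<And>k. (A, k) \<in> occ_rel (comps P) \<longleftrightarrow> k = i \<or> k = i'"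
      and mixed: "mixed_in P A \<longleftrightarrow> i < i'"
      and lt: "i < length (comps P)" "i' < length (comps P)" "j < length (comps P ! i)" "j' < length (comps P ! i')"
      and nth: "comps P ! i ! j = A" "comps P ! i' ! j' = A"
    have ii: "i < i'" using A mixed by simp
    have c: "crossing_of P A i = Some (if a = b_plus then 1 else if a = a_minus then - 1 else 0)"
      "crossing_of P A i' = Some (if a = a_plus then 1 else if a = b_minus then - 1 else 0)"
      using A ii by (auto simp: crossing_def R a)
    have e: "eps P i j = (if a = b_plus then 1 else if a = a_minus then - 1 else 0)"
      using eps_crossing[OF P lt(1,3)] nth c by simp
    show thesis
    proof (cases "a = b_plus \<or> a = a_minus")
      case True
      then have "zero_occ P A = (i', j')"
        using e by (auto simp: zero_occ_def first_occ_def second_occ_def occ)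
      then show ?thesis using True lt nth c pos ii
        by (intro that[of i' j']) (auto simp: x_word_def eta_index_def second_occ_def occ a split: if_splits)
    next
      case False
      then have "zero_occ P A = (i, j)" "a = a_plus \<or> a = b_minus"
        using e by (auto simp: zero_occ_def first_occ_def occ intro: alpha_v.exhaust[of a])
      then show ?thesis using False lt nth c pos ii
        by (intro that[of i j]) (auto simp: x_word_def eta_index_def first_occ_def occ a split: if_splits)
    qed
  qed
qed

section \<open>Solutions of the Wirtinger system\<close>

text \<open>
  \<open>1 + X A\<close> is the value of the arc passing over at the crossing \<open>A\<close>, expressed in the meridians
  \<open>1 + y k\<close>.
\<close>

definition solves_comp ::
  "(nat \<Rightarrow> 'r::ring_1) \<Rightarrow> ('a \<Rightarrow> 'r) \<Rightarrow> ('a \<Rightarrow> nat \<Rightarrow> int option) \<Rightarrow> nat \<Rightarrow> 'a list \<Rightarrow> bool" where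
  "solves_comp y X c k w \<longleftrightarrow> (\<forall>w1 B w2. w = w1 @ B # w2 \<longrightarrow> c B k = Some 0 \<longrightarrow>
     X B = sval X (inv_word (cword c k w1)) * y k * sval X (cword c k w1))"

definition solves :: "(nat \<Rightarrow> 'r::ring_1) \<Rightarrow> ('a \<Rightarrow> 'r) \<Rightarrow> 'a nanophrase \<Rightarrow> bool" where
  "solves y X P \<longleftrightarrow> (\<forall>k<length (comps P). solves_comp y X (crossing_of P) k (comps P ! k))"

definition longitude :: "('a \<Rightarrow> 'r::ring_1) \<Rightarrow> 'a nanophrase \<Rightarrow> nat \<Rightarrow> 'r" where
  "longitude X P k = sval X (cword (crossing_of P) k (comps P ! k))"

text \<open>Mixed letters correspond one to one to their over occurrences, so conditions on
  positions become conditions on letters. The predicate is left open because it is used both for the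
  exact relations and for relations that hold modulo \<open>d\<close>.\<close>

lemma all_over_occurrences_iff:
  assumes P: "nanophrase n P"
  shows "(\<forall>k w1 B w2. k < length (comps P) \<longrightarrow> comps P ! k = w1 @ B # w2 \<longrightarrow> crossing_of P B k = Some 0 \<longrightarrow>
      \<Phi> B (cword (crossing_of P) k w1) k) \<longleftrightarrow> (\<forall>A. mixed_in P A \<longrightarrow> \<Phi> A (x_word P A) (eta_index P A))"
proof (intro iffI allI impI)
  fix A
  assume *: "\<forall>k w1 B w2. k < length (comps P) \<longrightarrow> comps P ! k = w1 @ B # w2 \<longrightarrow> crossing_of P B k = Some 0 \<longrightarrow>
      \<Phi> B (cword (crossing_of P) k w1) k"
    and A: "mixed_in P A"
  from over_occurrence[OF P A] show "\<Phi> A (x_word P A) (eta_index P A)"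
  proof this
    fix k l
    assume kl: "k < length (comps P)" "l < length (comps P ! k)" "comps P ! k ! l = A"
      "crossing_of P A k = Some 0" "x_word P A = signed_prefix P k l" "eta_index P A = k"
    have "comps P ! k = take l (comps P ! k) @ A # drop (Suc l) (comps P ! k)"
      using kl id_take_nth_drop by metis
    then have "\<Phi> A (cword (crossing_of P) k (take l (comps P ! k))) k"
      using * kl by blast
    then show ?thesis using kl signed_prefix_cword[OF P, of k l] by simp
  qed
next
  fix k w1 B w2
  assume *: "\<forall>A. mixed_in P A \<longrightarrow> \<Phi> A (x_word P A) (eta_index P A)"
    and k: "k < length (comps P)" and w: "comps P ! k = w1 @ B # w2" and B: "crossing_of P B k = Some 0"
  have "mixed_in P B" using B by (auto simp: crossing_def split: if_splits)
  from over_occurrence[OF P this] obtain k' l' where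
    "x_word P B = signed_prefix P k' l'" "eta_index P B = k'"
    "\<And>k'' l''. k'' < length (comps P) \<Longrightarrow> l'' < length (comps P ! k'') \<Longrightarrow> comps P ! k'' ! l'' = B \<Longrightarrow>
    crossing_of P B k'' = Some 0 \<Longrightarrow> k'' = k' \<and> l'' = l'"
    by metis
  moreover from this(3)[OF k, of "length w1"] have "k = k' \<and> length w1 = l'" using w B by simp
  ultimately have "x_word P B = cword (crossing_of P) k w1" "eta_index P B = k"
    using signed_prefix_cword[OF P k, of "length w1"] w by simp_all
  then show "\<Phi> B (cword (crossing_of P) k w1) k"
    using * \<open>mixed_in P B\<close> by auto
qed

lemma solves_iff_fixed:
  assumes "nanophrase n P"
  shows "solves y X P \<longleftrightarrow> (\<forall>A. mixed_in P A \<longrightarrow> X A = conj_step y (eta_index P) (x_word P) X A)"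
  using all_over_occurrences_iff[OF assms,
      of "\<lambda>A u k. X A = sval X (inv_word u) * y k * sval X u"]
  unfolding solves_def solves_comp_def conj_step_def by blast

lemma letters_x_word:
  assumes "nanophrase n P" "mixed_in P A"
  shows "fst ` set (x_word P A) \<subseteq> Collect (mixed_in P)"
  using over_occurrence[OF assms] signed_prefix_cword[OF assms(1)] letters_cword_mixed
  by (metis less_imp_le)

lemma solves_exists:
  assumes "nanophrase n P" "strict_base y"
  obtains X where "solves y X P"
  using conj_step_fixed_exists[OF assms(2), of "eta_index P" "x_word P"] solves_iff_fixed[OF assms(1)] by metis

lemma solves_square:
  assumes P: "nanophrase n P" and y: "nil_base y" and X: "solves y X P" and A: "mixed_in P A"
  shows "X A * X A = 0"
proof -
  have "v * y k * z * (z' * y k * v') = 0" for v z z' v' k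
    by (metis nil_baseD(1)[OF y] mult.assoc mult_zero_left mult_zero_right)
  moreover have "X A = conj_step y (eta_index P) (x_word P) X A"
    using solves_iff_fixed[OF P] X A by blast
  ultimately show ?thesis by (simp add: conj_step_def)
qed

lemma ent_longitude:
  assumes P: "nanophrase n P" and k: "k < n"
    and y: "nil_base y" "strict_base y" "\<And>k. k \<ge> n \<Longrightarrow> y k = 0"
    and X: "solves y X P"
  shows "ent (longitude X P k) a b =
    (\<Sum>m\<in>squarefree_lists n. mu P (m @ [k]) * ent (monomial y m) a b)"
proof -
  have k': "k < length (comps P)" using P k by (simp add: nanophrase_def)
  show ?thesis
    unfolding longitude_def signed_comp_cword[OF P k', symmetric]
  proof (rule ent_longitude_expansion[OF y, where S = "Collect (mixed_in P)"])
    show "fst ` set (signed_comp P k) \<subseteq> Collect (mixed_in P)"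
      using letters_cword_mixed signed_comp_cword[OF P k'] by metis
    show "fst ` set (x_word P A) \<subseteq> Collect (mixed_in P)" if "A \<in> Collect (mixed_in P)" for A
      using letters_x_word[OF P] that by simp
    show "X A = conj_step y (eta_index P) (x_word P) X A" if "A \<in> Collect (mixed_in P)" for A
      using solves_iff_fixed[OF P, THEN iffD1, OF X] that by simp
  qed
qed

lemma ent_longitude_mer:
  assumes P: "nanophrase n P" and k: "k < n" and L: "distinct L" "set L \<subseteq> {..<n}"
    and X: "solves (mer L) X P" and ab: "a \<le> b" "b \<le> length L"
  shows "ent (longitude X P k) a b = mu P (take (b - a) (drop a L) @ [k])"
proof -
  let ?m = "take (b - a) (drop a L)"
  have "ent (longitude X P k) a b =
      (\<Sum>m\<in>squarefree_lists n. mu P (m @ [k]) * ent (monomial (mer L) m) a b)"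
    using L(2) by (intro ent_longitude[OF P k] nil_base_mer L strict_base_mer mer_outside X) auto
  also have "\<dots> = (\<Sum>m\<in>squarefree_lists n. if m = ?m then mu P (m @ [k]) else 0)"
    by (intro sum.cong) (auto simp: ent_monomial_mer[OF ab])
  also have "\<dots> = mu P (?m @ [k])"
  proof -
    have "?m \<in> squarefree_lists n"
      using L by (auto simp: squarefree_lists_def dest!: in_set_takeD in_set_dropD)
    then show ?thesis by simp
  qed
  finally show ?thesis .
qed

section \<open>Scanning a phrase\<close>

text \<open>
  A state \<open>(k, v, p)\<close> holds the current component, the product \<open>v = y k * \<Lambda>\<close> and the current arc
  \<open>p = \<Lambda>\<^sup>-\<^sup>1 * y k * \<Lambda>\<close>, where \<open>\<Lambda>\<close> is the value of the signed word read so far in the component.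
\<close>

type_synonym 'r state = "nat \<times> 'r \<times> 'r"

text \<open>The pieces of a phrase cut out by a move may contain separators. Processing tokens from
  left to right makes the effect of a piece depend only on the incoming state, so that a move has to
  be checked only at the crossings it displays.\<close>

fun scan_step :: "(nat \<Rightarrow> 'r::ring_1) \<Rightarrow> ('a \<Rightarrow> nat \<Rightarrow> int option) \<Rightarrow> ('a \<Rightarrow> 'r) \<Rightarrow> 'r state \<Rightarrow> 'a token \<Rightarrow> 'r state" where
  "scan_step y c X (k, v, p) (Letter A) = (case c A k of None \<Rightarrow> (k, v, p)
     | Some e \<Rightarrow> (k, v * (1 + of_int e * X A), (1 - of_int e * X A) * p * (1 + of_int e * X A)))"
| "scan_step y c X (k, v, p) Sep = (Suc k, y (Suc k), y (Suc k))"

fun scan where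
  "scan y c X s [] = s"
| "scan y c X s (t # T) = scan y c X (scan_step y c X s t) T"

fun ok_step :: "('a \<Rightarrow> nat \<Rightarrow> int option) \<Rightarrow> ('a \<Rightarrow> 'r::ring_1) \<Rightarrow> 'r state \<Rightarrow> 'a token \<Rightarrow> bool" where
  "ok_step c X (k, v, p) (Letter A) \<longleftrightarrow> (c A k = Some 0 \<longrightarrow> X A = p)"
| "ok_step c X s Sep \<longleftrightarrow> True"

fun ok where
  "ok y c X s [] \<longleftrightarrow> True"
| "ok y c X s (t # T) \<longleftrightarrow> ok_step c X s t \<and> ok y c X (scan_step y c X s t) T"

text \<open>No separator follows the last component; its value has to be taken from the final state
  of \<open>scan\<close>.\<close>

fun outs where
  "outs y c X s [] = []"
| "outs y c X s (t # T) = (if t = Sep then [fst (snd s)] else []) @ outs y c X (scan_step y c X s t) T"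

lemma scan_append [simp]: "scan y c X s (T @ T') = scan y c X (scan y c X s T) T'"
  by (induction T arbitrary: s) auto

lemma ok_append [simp]: "ok y c X s (T @ T') \<longleftrightarrow> ok y c X s T \<and> ok y c X (scan y c X s T) T'"
  by (induction T arbitrary: s) auto

lemma outs_append [simp]: "outs y c X s (T @ T') = outs y c X s T @ outs y c X (scan y c X s T) T'"
  by (induction T arbitrary: s) auto

lemma scan_cong:
  assumes "\<And>A. Letter A \<in> set T \<Longrightarrow> X A = X' A \<and> c A = c' A"
  shows "scan y c X s T = scan y c' X' s T" "ok y c X s T = ok y c' X' s T" "outs y c X s T = outs y c' X' s T"
proof -
  have step: "scan_step y c X s t = scan_step y c' X' s t \<and> ok_step c X s t = ok_step c' X' s t"
    if t: "\<And>A. t = Letter A \<Longrightarrow> X A = X' A \<and> c A = c' A" for s t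
  proof (cases t)
    case (Letter A)
    obtain k v p where s: "s = (k, v, p)" by (cases s) force
    have "X A = X' A" "c A = c' A" using t[OF Letter] by auto
    then show ?thesis by (simp add: Letter s cong: option.case_cong)
  next
    case Sep
    obtain k v p where s: "s = (k, v, p)" by (cases s) force
    show ?thesis by (simp add: Sep s)
  qed
  have "scan y c X s T = scan y c' X' s T \<and> ok y c X s T = ok y c' X' s T \<and> outs y c X s T = outs y c' X' s T"
    using assms
  proof (induction T arbitrary: s)
    case (Cons t T)
    have "scan_step y c X s t = scan_step y c' X' s t" "ok_step c X s t = ok_step c' X' s t"
      using step[of t s] Cons.prems by simp_all
    then show ?case using Cons.IH[of "scan_step y c' X' s t"] Cons.prems by simp
  qed auto
  then show "scan y c X s T = scan y c' X' s T" "ok y c X s T = ok y c' X' s T" "outs y c X s T = outs y c' X' s T"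
    by auto
qed

fun letters_at :: "nat \<Rightarrow> 'a token list \<Rightarrow> ('a \<times> nat) set" where
  "letters_at k [] = {}"
| "letters_at k (Letter A # T) = insert (A, k) (letters_at k T)"
| "letters_at k (Sep # T) = letters_at (Suc k) T"

fun nseps :: "'a token list \<Rightarrow> nat" where
  "nseps [] = 0"
| "nseps (Letter A # T) = nseps T"
| "nseps (Sep # T) = Suc (nseps T)"

lemma nseps_append [simp]: "nseps (T @ T') = nseps T + nseps T'"
  by (induction T rule: nseps.induct) auto

lemma nseps_map_Letter [simp]: "nseps (map Letter w) = 0"
  by (induction w) auto

lemma letters_at_append [simp]: "letters_at k (T @ T') = letters_at k T \<union> letters_at (k + nseps T) T'"
  by (induction k T rule: letters_at.induct) auto

lemma letters_at_map_Letter [simp]: "letters_at k (map Letter w) = {(A, k) | A. A \<in> set w}"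
  by (induction w) auto

lemma letters_at_absent: "Letter A \<notin> set T \<Longrightarrow> (A, j) \<notin> letters_at k T"
  by (induction k T rule: letters_at.induct) auto

lemma letters_at_flat: "letters_at k (flat p) = {(A, k + i) | A i. i < length p \<and> A \<in> set (p ! i)}"
proof (induction p arbitrary: k rule: flat.induct)
  case (3 w v ws)
  show ?case
  proof (rule set_eqI, clarify)
    fix A j
    have "(A, j) \<in> letters_at k (flat (w # v # ws)) \<longleftrightarrow> (j = k \<and> A \<in> set w) \<or>
        (\<exists>i. j = Suc k + i \<and> i < length (v # ws) \<and> A \<in> set ((v # ws) ! i))"
      using 3[of "Suc k"] by (simp add: set_eq_iff)
    also have "\<dots> \<longleftrightarrow> (\<exists>i. j = k + i \<and> i < length (w # v # ws) \<and> A \<in> set ((w # v # ws) ! i))"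
      by (auto simp: less_Suc_eq_0_disj)
    finally show "(A, j) \<in> letters_at k (flat (w # v # ws)) \<longleftrightarrow>
        (A, j) \<in> {(A, k + i) | A i. i < length (w # v # ws) \<and> A \<in> set ((w # v # ws) ! i)}"
      by auto
  qed
qed auto

lemma occ_rel_flat: "occ_rel p = letters_at 0 (flat p)"
  unfolding letters_at_flat occ_rel_def by auto

lemma fst_scan: "fst (scan y c X s T) = fst s + nseps T"
proof (induction T arbitrary: s)
  case (Cons t T)
  obtain k v p where s: "s = (k, v, p)" by (cases s) force
  show ?case by (cases t) (auto simp: Cons s split: option.splits)
qed auto

lemma count_flat: "count_list (flat p) (Letter A) = count_list (concat p) A"
proof -
  have "count_list (map Letter w) (Letter A) = count_list w A" for w
    by (induction w) auto
  then show ?thesis by (induction p rule: flat.induct) auto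
qed

definition sign_valued :: "('a \<Rightarrow> nat \<Rightarrow> int option) \<Rightarrow> bool" where
  "sign_valued c \<longleftrightarrow> (\<forall>A k. c A k \<in> {None, Some 0, Some 1, Some (- 1)})"

lemma sign_valued_crossing: "sign_valued (crossing R m)"
  by (auto simp: sign_valued_def crossing_def)

lemma scan_word:
  assumes "sign_valued c"
  shows "scan y c X (k, v, p) (map Letter w) =
    (k, v * sval X (cword c k w), sval X (inv_word (cword c k w)) * p * sval X (cword c k w))"
proof (induction w arbitrary: v p)
  case (Cons A w)
  have "c A k \<in> {None, Some 0, Some 1, Some (- 1)}"
    using assms by (simp add: sign_valued_def)
  then show ?case
    by (auto simp: Cons letter_power_def inv_word_append inv_word_Cons mult.assoc)
qed auto

lemma outs_word [simp]: "outs y c X s (map Letter w) = []"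
  by (induction w arbitrary: s) auto

lemma ok_word:
  assumes c: "sign_valued c"
  shows "ok y c X (k, y k, y k) (map Letter w) \<longleftrightarrow> solves_comp y X c k w"
proof (induction w rule: rev_induct)
  case Nil
  then show ?case by (simp add: solves_comp_def)
next
  case (snoc A w)
  have "solves_comp y X c k (w @ [A]) \<longleftrightarrow> solves_comp y X c k w \<and>
      (c A k = Some 0 \<longrightarrow> X A = sval X (inv_word (cword c k w)) * y k * sval X (cword c k w))"
    unfolding solves_comp_def
  proof (intro iffI conjI allI impI)
    fix w1 B w2
    assume *: "(\<forall>w1 B w2. w = w1 @ B # w2 \<longrightarrow> c B k = Some 0 \<longrightarrow>
        X B = sval X (inv_word (cword c k w1)) * y k * sval X (cword c k w1)) \<and>
      (c A k = Some 0 \<longrightarrow> X A = sval X (inv_word (cword c k w)) * y k * sval X (cword c k w))"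
      and w: "w @ [A] = w1 @ B # w2" and B: "c B k = Some 0"
    show "X B = sval X (inv_word (cword c k w1)) * y k * sval X (cword c k w1)"
      using * w B by (cases w2 rule: rev_cases) auto
  qed auto
  then show ?case using snoc by (auto simp: scan_word[OF c])
qed

lemma ok_flat:
  assumes c: "sign_valued c" and "p \<noteq> []"
  shows "ok y c X (k, y k, y k) (flat p) \<longleftrightarrow> (\<forall>i<length p. solves_comp y X c (k + i) (p ! i))"
    and "outs y c X (k, y k, y k) (flat p) @ [fst (snd (scan y c X (k, y k, y k) (flat p)))] =
      map (\<lambda>i. y (k + i) * sval X (cword c (k + i) (p ! i))) [0..<length p]"
proof -
  have "(ok y c X (k, y k, y k) (flat p) \<longleftrightarrow> (\<forall>i<length p. solves_comp y X c (k + i) (p ! i))) \<and>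
    outs y c X (k, y k, y k) (flat p) @ [fst (snd (scan y c X (k, y k, y k) (flat p)))] =
      map (\<lambda>i. y (k + i) * sval X (cword c (k + i) (p ! i))) [0..<length p]"
    using assms(2)
  proof (induction p arbitrary: k rule: flat.induct)
    case (2 w)
    then show ?case by (simp add: ok_word[OF c] scan_word[OF c])
  next
    case (3 w v ws)
    have len: "length (w # v # ws) = Suc (length (v # ws))" by simp
    have 1: "(\<forall>i<length (w # v # ws). Q i ((w # v # ws) ! i)) \<longleftrightarrow>
        Q 0 w \<and> (\<forall>i<length (v # ws). Q (Suc i) ((v # ws) ! i))" for Q
      unfolding len All_less_Suc2 by simp
    have 2: "map (\<lambda>i. F i ((w # v # ws) ! i)) [0..<length (w # v # ws)] =
        F 0 w # map (\<lambda>i. F (Suc i) ((v # ws) ! i)) [0..<length (v # ws)]" for F :: "nat \<Rightarrow> 'a list \<Rightarrow> 'b"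
      unfolding len upt_conv_Cons[OF zero_less_Suc] map_Suc_upt[symmetric] by (simp add: comp_def)
    show ?case
      unfolding 1[of "\<lambda>i. solves_comp y X c (k + i)"] 2[of "\<lambda>i u. y (k + i) * sval X (cword c (k + i) u)"]
      using "3.IH"[of "Suc k"] by (simp add: ok_word[OF c] scan_word[OF c] del: upt_Suc)
  qed auto
  then show "ok y c X (k, y k, y k) (flat p) \<longleftrightarrow> (\<forall>i<length p. solves_comp y X c (k + i) (p ! i))"
    "outs y c X (k, y k, y k) (flat p) @ [fst (snd (scan y c X (k, y k, y k) (flat p)))] =
      map (\<lambda>i. y (k + i) * sval X (cword c (k + i) (p ! i))) [0..<length p]"
    by auto
qed

text \<open>
  Only \<open>y k * longitude\<close> is preserved by the third move: when two of its strands lie on one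
  component, the longitude itself changes by terms that \<open>y k\<close> annihilates.
\<close>

definition transfers :: "nat \<Rightarrow> (nat \<Rightarrow> 'r::ring_1) \<Rightarrow> 'a nanophrase \<Rightarrow> 'a nanophrase \<Rightarrow> bool" where
  "transfers n y P Q \<longleftrightarrow> (\<forall>X. solves y X P \<longrightarrow>
     (\<exists>X'. solves y X' Q \<and> (\<forall>k<n. y k * longitude X' Q k = y k * longitude X P k)))"

text \<open>Emitted values and final state together contain \<open>y k\<close> times every
  longitude. A positive \<open>n\<close> is required because \<open>flat\<close> cannot tell a
  phrase without components from a single empty component.\<close>

lemma transfers_scan:
  assumes P: "nanophrase n P" and Q: "nanophrase n Q" and n: "n > 0"
    and step: "\<And>X. ok y (crossing_of P) X (0, y 0, y 0) (flat (comps P)) \<Longrightarrow>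
      \<exists>X'. ok y (crossing_of Q) X' (0, y 0, y 0) (flat (comps Q)) \<and>
        outs y (crossing_of Q) X' (0, y 0, y 0) (flat (comps Q)) = outs y (crossing_of P) X (0, y 0, y 0) (flat (comps P)) \<and>
        scan y (crossing_of Q) X' (0, y 0, y 0) (flat (comps Q)) = scan y (crossing_of P) X (0, y 0, y 0) (flat (comps P))"
  shows "transfers n y P Q"
  unfolding transfers_def
proof (intro allI impI)
  fix X assume X: "solves y X P"
  have len: "length (comps P) = n" "length (comps Q) = n" using P Q by (auto simp: nanophrase_def)
  then have ne: "comps P \<noteq> []" "comps Q \<noteq> []" using n by auto
  note flatP = ok_flat[where p = "comps P" and c = "crossing_of P" and k = 0, OF sign_valued_crossing ne(1)]
  note flatQ = ok_flat[where p = "comps Q" and c = "crossing_of Q" and k = 0, OF sign_valued_crossing ne(2)]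
  from X have "ok y (crossing_of P) X (0, y 0, y 0) (flat (comps P))"
    by (simp add: solves_def flatP(1))
  from step[OF this] obtain X' where X':
    "ok y (crossing_of Q) X' (0, y 0, y 0) (flat (comps Q))"
    "outs y (crossing_of Q) X' (0, y 0, y 0) (flat (comps Q)) = outs y (crossing_of P) X (0, y 0, y 0) (flat (comps P))"
    "scan y (crossing_of Q) X' (0, y 0, y 0) (flat (comps Q)) = scan y (crossing_of P) X (0, y 0, y 0) (flat (comps P))"
    by blast
  have "map (\<lambda>i. y i * longitude X' Q i) [0..<n] = map (\<lambda>i. y i * longitude X P i) [0..<n]"
    using flatP(2)[of y X] flatQ(2)[of y X'] X' by (simp add: longitude_def len)
  then have "y k * longitude X' Q k = y k * longitude X P k" if "k < n" for k
    using that by (auto dest: spec)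
  moreover have "solves y X' Q" using X'(1) by (simp add: solves_def flatQ(1))
  ultimately show "\<exists>X'. solves y X' Q \<and> (\<forall>k<n. y k * longitude X' Q k = y k * longitude X P k)" by blast
qed

lemma crossing_cong:
  "(\<And>j. (A, j) \<in> R \<longleftrightarrow> (A, j) \<in> R') \<Longrightarrow> m A = m' A \<Longrightarrow> crossing R m A = crossing R' m' A"
  unfolding crossing_def mixed_def by (intro ext) simp

lemma crossing_upd:
  assumes "\<not> mixed R A"
  shows "crossing R (m(A := v)) = crossing R m"
proof (intro ext)
  fix B k
  show "crossing R (m(A := v)) B k = crossing R m B k"
  proof (cases "B = A")
    case False
    then have "crossing R (m(A := v)) B = crossing R m B"
      by (intro crossing_cong) auto
    then show ?thesis by simp
  qed (simp add: assms crossing_def)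
qed

lemma crossing_self: "(\<And>j. (A, j) \<in> R \<longleftrightarrow> j = k) \<Longrightarrow> crossing R m A = (\<lambda>_. None)"
  unfolding crossing_def mixed_def by auto

lemma crossing_pair:
  assumes "\<And>j. (A, j) \<in> R \<longleftrightarrow> j = k \<or> j = l" and "k < l"
  shows "crossing R m A k = Some (if m A = Some b_plus then 1 else if m A = Some a_minus then - 1 else 0)"
    and "crossing R m A l = Some (if m A = Some a_plus then 1 else if m A = Some b_minus then - 1 else 0)"
  using assms(2) by (auto simp: crossing_def mixed_def assms(1))

text \<open>The invariant behind all cancellations: every arc of a component is a multiple, from
  both sides, of the same \<open>y k\<close>, so two arcs of one component annihilate each
  other.\<close>

definition at_strand :: "(nat \<Rightarrow> 'r::ring_1) \<Rightarrow> 'r state \<Rightarrow> bool" where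
  "at_strand y s \<longleftrightarrow> (case s of (k, v, p) \<Rightarrow> (\<exists>b. v = y k * b) \<and> (\<exists>a b. p = a * y k * b))"

lemma at_strand_scan: "at_strand y s \<Longrightarrow> at_strand y (scan y c X s T)"
proof (induction T arbitrary: s)
  case (Cons t T)
  obtain k v p where s: "s = (k, v, p)" by (cases s) force
  then obtain b a b' where vp: "v = y k * b" "p = a * y k * b'"
    using Cons.prems by (auto simp: at_strand_def)
  have 1: "\<exists>b. y j = y j * b" "\<exists>a b. y j = a * y j * b" for j
    by (rule exI[of _ 1], simp) (rule exI[of _ 1], rule exI[of _ 1], simp)
  have "at_strand y (scan_step y c X s t)"
  proof (cases t)
    case (Letter A)
    show ?thesis
    proof (cases "c A k")
      case None
      then show ?thesis using Cons.prems by (simp add: Letter s)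
    next
      case (Some e)
      have "\<exists>b. v * (1 + of_int e * X A) = y k * b"
        by (rule exI[of _ "b * (1 + of_int e * X A)"]) (simp add: vp mult.assoc)
      moreover have "\<exists>a b. (1 - of_int e * X A) * p * (1 + of_int e * X A) = a * y k * b"
        by (rule exI[of _ "(1 - of_int e * X A) * a"], rule exI[of _ "b' * (1 + of_int e * X A)"]) (simp add: vp mult.assoc)
      ultimately show ?thesis by (simp add: Letter s Some at_strand_def)
    qed
  qed (simp add: s at_strand_def 1)
  then show ?case using Cons.IH by simp
qed auto

lemma at_strand_start: "at_strand y (k, y k, y k)"
  unfolding at_strand_def by (auto intro!: exI[of _ 1])

text \<open>The products are listed in right-associated form, with and without further factors, so
  that they serve as rewrite rules once products have been expanded.\<close>

lemma at_strand_zero: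
  assumes y: "nil_base y" and "at_strand y (k, v, p)" "at_strand y (k, v', p')"
  shows "v * (r * p') = 0" "p * (r * p') = 0" "v * p' = 0" "p * p' = 0"
    "v * (r * (p' * s)) = 0" "p * (r * (p' * s)) = 0" "v * (p' * s) = 0" "p * (p' * s) = 0"
proof -
  obtain b a b' a'' b'' where vp: "v = y k * b" "p = a * y k * b'" "p' = a'' * y k * b''"
    using assms by (auto simp: at_strand_def)
  have "y k * z * y k * w = 0" for z w using nil_baseD(1)[OF y] by simp
  then have *: "v * r * p' = 0" "p * r * p' = 0" for r
    by (simp_all add: vp mult.assoc) (metis mult.assoc mult_zero_right)+
  show "v * (r * p') = 0" "p * (r * p') = 0" "v * p' = 0" "p * p' = 0"
    "v * (r * (p' * s)) = 0" "p * (r * (p' * s)) = 0" "v * (p' * s) = 0" "p * (p' * s) = 0"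
    using *[of r] *[of 1] by (simp_all add: mult.assoc[symmetric])
qed

lemma fst_scan_start: "fst (scan y c X (0, y 0, y 0) T) = nseps T"
  by (simp add: fst_scan)

section \<open>Moves that preserve the longitudes\<close>

text \<open>The third move with one crossing missing: the strand \<open>r\<close> meets
  \<open>p\<close> at \<open>D\<close> and \<open>q\<close> at \<open>E\<close>. Either
  \<open>r\<close> is over at both crossings and does not change between them, or \<open>p\<close>
  and \<open>q\<close> belong to one component, so that products of their arcs vanish and the order
  does not matter.\<close>

lemma swap_two_crossings:
  fixes X :: "'a \<Rightarrow> 'r::ring_1"
  assumes y: "nil_base y" and c: "sign_valued c" and DE: "D \<noteq> E"
    and s: "at_strand y (kp, vp, pp)" "at_strand y (kq, vq, pq)"
    and D: "c D kp = Some d1" "c D kr = Some d2" "d1 = 0 \<longleftrightarrow> d2 \<noteq> 0"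
    and E: "c E kq = Some e1" "c E kr = Some e2" "e1 = 0 \<longleftrightarrow> e2 \<noteq> 0"
    and k: "kp = kq \<or> d2 = 0 \<and> e2 = 0"
    and ok: "ok y c X (kp, vp, pp) [Letter D]" "ok y c X (kq, vq, pq) [Letter E]"
      "ok y c X (kr, vr, pr) [Letter D, Letter E]"
  shows "\<exists>X'. (\<forall>F. F \<noteq> D \<longrightarrow> F \<noteq> E \<longrightarrow> X' F = X F) \<and>
    ok y c X' (kp, vp, pp) [Letter D] \<and> ok y c X' (kq, vq, pq) [Letter E] \<and>
    ok y c X' (kr, vr, pr) [Letter E, Letter D] \<and>
    scan y c X' (kp, vp, pp) [Letter D] = scan y c X (kp, vp, pp) [Letter D] \<and>
    scan y c X' (kq, vq, pq) [Letter E] = scan y c X (kq, vq, pq) [Letter E] \<and>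
    scan y c X' (kr, vr, pr) [Letter E, Letter D] = scan y c X (kr, vr, pr) [Letter D, Letter E]"
proof -
  have vals: "d1 \<in> {0, 1, - 1}" "d2 \<in> {0, 1, - 1}" "e1 \<in> {0, 1, - 1}" "e2 \<in> {0, 1, - 1}"
    using c D(1,2) E(1,2) unfolding sign_valued_def by (metis insertE insertI1 insertI2 option.discI option.inject singletonD)+
  have XD: "d1 = 0 \<Longrightarrow> X D = pp" "d2 = 0 \<Longrightarrow> X D = pr"
    and XE: "e1 = 0 \<Longrightarrow> X E = pq"
      "e2 = 0 \<Longrightarrow> X E = (1 - of_int d2 * X D) * pr * (1 + of_int d2 * X D)"
    using ok by (simp_all add: D(1,2) E(1,2))
  note cs = D(1,2) E(1,2)
  consider "d2 = 0" "e2 = 0" | "d2 \<noteq> 0" "e2 \<noteq> 0" | "d2 \<noteq> 0" "e2 = 0" | "d2 = 0" "e2 \<noteq> 0" by blast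
  then show ?thesis
  proof cases
    case 1
    then have "X D = pr" "X E = pr" "d1 \<noteq> 0" "e1 \<noteq> 0" using XD XE D E by simp_all
    then show ?thesis by (intro exI[of _ X] conjI) (simp_all add: cs 1)
  next
    case 2
    then have eq: "kp = kq" "d1 = 0" "e1 = 0" using k D E by auto
    then have s': "at_strand y (kq, vp, pp)" using s by simp
    note z = at_strand_zero[OF y s' s(2)] at_strand_zero[OF y s(2) s']
    have X: "X D = pp" "X E = pq" using XD XE eq by simp_all
    show ?thesis using 2 eq(2,3) vals
      by (intro exI[of _ X] conjI) (auto simp: cs X algebra_simps z)
  next
    case 3
    then have eq: "kp = kq" "d1 = 0" "e1 \<noteq> 0" using k D E by auto
    then have s': "at_strand y (kq, vp, pp)" using s by simp
    note z = at_strand_zero[OF y s' s(2)] at_strand_zero[OF y s(2) s']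
    have X: "X D = pp" "X E = (1 - of_int d2 * pp) * pr * (1 + of_int d2 * pp)"
      using XD XE eq 3 by simp_all
    \<comment> \<open>Now \<open>r\<close> reaches \<open>E\<close> before passing under
      \<open>D\<close>, so its arc there is the unconjugated \<open>pr\<close>. The strand
      \<open>q\<close> below it does not notice the lost conjugation by \<open>pp\<close>, an arc of
      its own component.\<close>
    show ?thesis using 3 vals eq(2,3) DE
      by (intro exI[of _ "X(E := pr)"] conjI) (auto simp: cs X algebra_simps z)
  next
    case 4
    then have eq: "kp = kq" "d1 \<noteq> 0" "e1 = 0" using k D E by auto
    then have s': "at_strand y (kq, vp, pp)" using s by simp
    note z = at_strand_zero[OF y s' s(2)] at_strand_zero[OF y s(2) s']
    have X: "X D = pr" "X E = pq" using XD XE eq 4 by simp_all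
    \<comment> \<open>Conversely \<open>r\<close> now passes under \<open>E\<close> first, so its
      arc over \<open>D\<close> is conjugated by \<open>pq\<close>, which the strand
      \<open>p\<close> does not notice.\<close>
    show ?thesis using 4 vals eq(2,3) DE
      by (intro exI[of _ "X(D := (1 - of_int e2 * pq) * pr * (1 + of_int e2 * pq))"] conjI)
        (auto simp: cs X algebra_simps z)
  qed
qed

text \<open>Of the three strands one is on top; the crossing of the other two gets the new arc value.\<close>

lemma swap_three_crossings:
  fixes X :: "'a \<Rightarrow> 'r::ring_1"
  assumes y: "nil_base y" and c: "sign_valued c" and ABC: "A \<noteq> B" "A \<noteq> C" "B \<noteq> C"
    and s: "at_strand y (k1, v1, p1)" "at_strand y (k2, v2, p2)" "at_strand y (k3, v3, p3)"
    and cs: "c A k1 = Some a1" "c A k2 = Some a2" "c B k1 = Some b1" "c B k3 = Some b2"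
      "c C k2 = Some c1" "c C k3 = Some c2"
    and over: "a1 = 0 \<longleftrightarrow> a2 \<noteq> 0" "b1 = 0 \<longleftrightarrow> b2 \<noteq> 0" "c1 = 0 \<longleftrightarrow> c2 \<noteq> 0"
    and top: "a1 = 0 \<and> b1 = 0 \<and> a2 = b2 \<or> b2 = 0 \<and> c2 = 0 \<and> b1 = c1 \<or> a2 = 0 \<and> c1 = 0 \<and> c2 = - a1"
    and ok: "ok y c X (k1, v1, p1) [Letter A, Letter B]" "ok y c X (k2, v2, p2) [Letter A, Letter C]"
      "ok y c X (k3, v3, p3) [Letter B, Letter C]"
  shows "\<exists>X'. (\<forall>F. F \<noteq> A \<longrightarrow> F \<noteq> B \<longrightarrow> F \<noteq> C \<longrightarrow> X' F = X F) \<and>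
    ok y c X' (k1, v1, p1) [Letter B, Letter A] \<and> ok y c X' (k2, v2, p2) [Letter C, Letter A] \<and>
    ok y c X' (k3, v3, p3) [Letter C, Letter B] \<and>
    scan y c X' (k1, v1, p1) [Letter B, Letter A] = scan y c X (k1, v1, p1) [Letter A, Letter B] \<and>
    scan y c X' (k2, v2, p2) [Letter C, Letter A] = scan y c X (k2, v2, p2) [Letter A, Letter C] \<and>
    scan y c X' (k3, v3, p3) [Letter C, Letter B] = scan y c X (k3, v3, p3) [Letter B, Letter C]"
proof -
  have sq: "p1 * p1 = 0" "p1 * (p1 * w) = 0" "p2 * p2 = 0" "p2 * (p2 * w) = 0" "p3 * p3 = 0" "p3 * (p3 * w) = 0" for w
    using at_strand_zero(4,8)[OF y s(1) s(1)] at_strand_zero(4,8)[OF y s(2) s(2)]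
      at_strand_zero(4,8)[OF y s(3) s(3)] by simp_all
  have "c A k1 \<in> {None, Some 0, Some 1, Some (- 1)}" "c A k2 \<in> {None, Some 0, Some 1, Some (- 1)}"
    "c B k1 \<in> {None, Some 0, Some 1, Some (- 1)}" "c B k3 \<in> {None, Some 0, Some 1, Some (- 1)}"
    "c C k2 \<in> {None, Some 0, Some 1, Some (- 1)}" "c C k3 \<in> {None, Some 0, Some 1, Some (- 1)}"
    using c unfolding sign_valued_def by blast+
  then have vals: "a1 \<in> {0, 1, - 1}" "a2 \<in> {0, 1, - 1}" "b1 \<in> {0, 1, - 1}" "b2 \<in> {0, 1, - 1}"
    "c1 \<in> {0, 1, - 1}" "c2 \<in> {0, 1, - 1}"
    unfolding cs by auto
  have XA: "a1 = 0 \<Longrightarrow> X A = p1" "a2 = 0 \<Longrightarrow> X A = p2"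
    and XB: "b1 = 0 \<Longrightarrow> X B = (1 - of_int a1 * X A) * p1 * (1 + of_int a1 * X A)" "b2 = 0 \<Longrightarrow> X B = p3"
    and XC: "c1 = 0 \<Longrightarrow> X C = (1 - of_int a2 * X A) * p2 * (1 + of_int a2 * X A)"
      "c2 = 0 \<Longrightarrow> X C = (1 - of_int b2 * X B) * p3 * (1 + of_int b2 * X B)"
    using ok by (simp_all add: cs)
  \<comment> \<open>The three cases name the strand on top, which is over at two crossings. Where it
    meets the other strands, the signs required by \<open>top\<close> make both of them undergo
    matching conjugations.\<close>
  consider
      (top1) "a1 = 0" "b1 = 0" "b2 = a2" "a2 \<in> {1, - 1}"
    | (top3) "b2 = 0" "c2 = 0" "c1 = b1" "b1 \<in> {1, - 1}"
    | (top2) "a2 = 0" "c1 = 0" "c2 = - a1" "a1 \<in> {1, - 1}"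
    using top vals over by auto
  then show ?thesis
  proof cases
    case top1
    have X: "X A = p1" "X B = p1" using XA XB top1 by simp_all
    show ?thesis
    \<comment> \<open>The crossing not involving the top strand is \<open>C\<close>; the case
      distinction asks whether strand 2 or strand 3 is over there. The cases of the other two top
      strands are split in the same way.\<close>
    proof (cases "c1 = 0")
      case True
      have XC': "X C = (1 - of_int a2 * p1) * p2 * (1 + of_int a2 * p1)" using XC True X by simp
      have "c2 \<in> {1, - 1}" using True over vals by auto
      then show ?thesis using top1(4) ABC
        by (intro exI[of _ "X(C := p2)"] conjI) (auto simp: cs top1(1-3) True X XC' algebra_simps sq)
    next
      case False
      then have 0: "c2 = 0" "c1 \<in> {1, - 1}" using over vals by auto
      have XC': "X C = (1 - of_int a2 * p1) * p3 * (1 + of_int a2 * p1)" using XC 0 X top1 by simp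
      show ?thesis using top1(4) 0(2) ABC
        by (intro exI[of _ "X(C := p3)"] conjI) (auto simp: cs top1(1-3) 0(1) X XC' algebra_simps sq)
    qed
  next
    case top3
    have X: "X B = p3" "X C = p3" using XB XC top3 by simp_all
    show ?thesis
    proof (cases "a1 = 0")
      case True
      have XA': "X A = p1" using XA True by simp
      have "a2 \<in> {1, - 1}" using True over vals by auto
      then show ?thesis using top3(4) ABC
        by (intro exI[of _ "X(A := (1 - of_int b1 * p3) * p1 * (1 + of_int b1 * p3))"] conjI)
          (auto simp: cs top3(1-3) True X XA' algebra_simps sq)
    next
      case False
      then have 0: "a2 = 0" "a1 \<in> {1, - 1}" using over vals by auto
      have XA': "X A = p2" using XA 0 by simp
      show ?thesis using top3(4) 0(2) ABC
        by (intro exI[of _ "X(A := (1 - of_int b1 * p3) * p2 * (1 + of_int b1 * p3))"] conjI)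
          (auto simp: cs top3(1-3) 0(1) X XA' algebra_simps sq)
    qed
  next
    case top2
    have X: "X A = p2" "X C = p2" using XA XC top2 by simp_all
    show ?thesis
    proof (cases "b1 = 0")
      case True
      have XB': "X B = (1 - of_int a1 * p2) * p1 * (1 + of_int a1 * p2)" using XB True X by simp
      have "b2 \<in> {1, - 1}" using True over vals by auto
      then show ?thesis using top2(4) ABC
        by (intro exI[of _ "X(B := p1)"] conjI) (auto simp: cs top2(1-3) True X XB' algebra_simps sq)
    next
      case False
      then have 0: "b2 = 0" "b1 \<in> {1, - 1}" using over vals by auto
      have XB': "X B = p3" using XB 0 by simp
      show ?thesis using top2(4) 0(2) ABC
        by (intro exI[of _ "X(B := (1 - of_int c2 * p2) * p3 * (1 + of_int c2 * p2))"] conjI)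
          (auto simp: cs top2(1-3) 0(1) X XB' algebra_simps sq)
    qed
  qed
qed

lemma count_tok [simp]: "count_list (tok B) (Letter A) = (if B = Some A then 1 else 0)"
  by (cases B) auto

lemma nseps_tok [simp]: "nseps (tok A) = 0"
  by (cases A) auto

lemma letters_at_tok [simp]: "letters_at k (tok A) = (case A of None \<Rightarrow> {} | Some a \<Rightarrow> {(a, k)})"
  by (cases A) auto

lemma nanophrase_flat_letter:
  assumes "nanophrase n (Nanophrase m p)" "Letter A \<in> set (flat p)"
  shows "count_list (flat p) (Letter A) = 2" "m A \<noteq> None"
proof -
  have "count_list (concat p) A \<noteq> 0"
    using assms(2) by (metis count_flat count_list_0_iff)
  then have "A \<in> set (concat p)" by (metis count_list_0_iff)
  then have "A \<in> dom m" using assms(1) by (auto simp: nanophrase_def)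
  then show "m A \<noteq> None" "count_list (flat p) (Letter A) = 2"
    using assms(1) by (auto simp: nanophrase_def count_flat)
qed

lemma transfers_H1:
  assumes P: "nanophrase n (Nanophrase m p)" and Q: "nanophrase n (Nanophrase (m |` (- {A})) p')" and n: "n > 0"
    and flat: "flat p = x @ [Letter A, Letter A] @ z" "flat p' = x @ z"
  shows "transfers n y (Nanophrase m p) (Nanophrase (m |` (- {A})) p')"
proof -
  have "count_list (flat p) (Letter A) = 2"
    by (rule nanophrase_flat_letter[OF P]) (simp add: flat)
  then have notin: "Letter A \<notin> set x" "Letter A \<notin> set z"
    by (simp_all add: flat count_list_0_iff)
  define cP where "cP = crossing_of (Nanophrase m p)"
  define cQ where "cQ = crossing_of (Nanophrase (m |` (- {A})) p')"
  \<comment> \<open>Adjacent occurrences lie in one component, so the scan skips both and the same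
    \<open>X\<close> serves after the move.\<close>
  have A: "cP A = (\<lambda>_. None)"
    unfolding cP_def by (rule crossing_self[of _ _ "nseps x"])
      (auto simp: occ_rel_flat flat letters_at_absent notin)
  have other: "cP B = cQ B" if "B \<noteq> A" for B
    unfolding cP_def cQ_def using that by (intro crossing_cong) (auto simp: occ_rel_flat flat)
  have cong: "scan y cQ X s T = scan y cP X s T" "ok y cQ X s T = ok y cP X s T"
    "outs y cQ X s T = outs y cP X s T" if "Letter A \<notin> set T" for X s T
    by (rule scan_cong; use that other in metis)+
  have self: "scan_step y cP X s (Letter A) = s" for X s
    by (cases s) (simp add: A)
  show ?thesis
  proof (rule transfers_scan[OF P Q n], unfold cP_def[symmetric] cQ_def[symmetric])
    fix X assume "ok y cP X (0, y 0, y 0) (flat (comps (Nanophrase m p)))"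
    then show "\<exists>X'. ok y cQ X' (0, y 0, y 0) (flat (comps (Nanophrase (m |` (- {A})) p'))) \<and>
        outs y cQ X' (0, y 0, y 0) (flat (comps (Nanophrase (m |` (- {A})) p'))) =
          outs y cP X (0, y 0, y 0) (flat (comps (Nanophrase m p))) \<and>
        scan y cQ X' (0, y 0, y 0) (flat (comps (Nanophrase (m |` (- {A})) p'))) =
          scan y cP X (0, y 0, y 0) (flat (comps (Nanophrase m p)))"
      by (intro exI[of _ X]) (simp add: flat cong notin self)
  qed
qed

text \<open>If the two strands lie in different components, \<open>tau_v\<close> puts the same
  strand over at both crossings and gives the other strand opposite signs. Both letters carry the
  same arc, so the two factors cancel; on a single component the letters are skipped.\<close>

lemma transfers_H2:
  assumes P: "nanophrase n (Nanophrase m p)" and Q: "nanophrase n (Nanophrase (m |` (- {A, B})) p')" and n: "n > 0"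
    and flat: "flat p = x @ [Letter A, Letter B] @ z @ [Letter B, Letter A] @ t" "flat p' = x @ z @ t"
    and m: "m A = Some a" "m B = Some (tau_v a)" and y: "nil_base y"
  shows "transfers n y (Nanophrase m p) (Nanophrase (m |` (- {A, B})) p')"
proof -
  have cnt: "count_list (flat p) (Letter A) = 2" "count_list (flat p) (Letter B) = 2"
    by (rule nanophrase_flat_letter[OF P]; simp add: flat)+
  then have AB: "A \<noteq> B" by (auto simp: flat)
  then have notin: "Letter A \<notin> set x" "Letter A \<notin> set z" "Letter A \<notin> set t"
    "Letter B \<notin> set x" "Letter B \<notin> set z" "Letter B \<notin> set t"
    using cnt by (auto simp: flat count_list_0_iff)
  define cP where "cP = crossing_of (Nanophrase m p)"
  define cQ where "cQ = crossing_of (Nanophrase (m |` (- {A, B})) p')"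
  let ?k = "nseps x" and ?l = "nseps x + nseps z"
  have R: "(A, j) \<in> occ_rel p \<longleftrightarrow> j = ?k \<or> j = ?l" "(B, j) \<in> occ_rel p \<longleftrightarrow> j = ?k \<or> j = ?l" for j
    using AB by (auto simp: occ_rel_flat flat letters_at_absent notin)
  have other: "cP C = cQ C" if "C \<noteq> A" "C \<noteq> B" for C
    unfolding cP_def cQ_def using that by (intro crossing_cong) (auto simp: occ_rel_flat flat)
  have cong: "scan y cQ X s T = scan y cP X s T" "ok y cQ X s T = ok y cP X s T"
    "outs y cQ X s T = outs y cP X s T" if "Letter A \<notin> set T" "Letter B \<notin> set T" for X s T
    by (rule scan_cong; use that other in metis)+
  let ?step = "scan_step y cP"
  have cancel: "?step X (?step X s (Letter A)) (Letter B) = s \<and>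
      ?step X (?step X s' (Letter B)) (Letter A) = s'"
    if at: "at_strand y s" "at_strand y s'" and fst: "fst s = ?k" "fst s' = ?l"
      and ok: "ok y cP X s [Letter A, Letter B]" "ok y cP X s' [Letter B, Letter A]"
    for X s s'
  proof (cases "nseps z = 0")
    case True
    then have "cP A = (\<lambda>_. None)" "cP B = (\<lambda>_. None)"
      unfolding cP_def using R by (auto intro!: crossing_self[of _ _ ?k])
    then show ?thesis by (cases s; cases s') simp
  next
    case False
    then have lt: "?k < ?l" by simp
    obtain v q v' q' where s: "s = (?k, v, q)" "s' = (?l, v', q')"
      using fst by (metis prod.collapse)
    note cr = crossing_pair[of A "occ_rel p", OF R(1) lt, of m] crossing_pair[of B "occ_rel p", OF R(2) lt, of m]
    note sq = at_strand_zero(4,8)[OF y at(1)[unfolded s] at(1)[unfolded s]]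
      at_strand_zero(4,8)[OF y at(2)[unfolded s] at(2)[unfolded s]]
    show ?thesis using ok m
      by (cases a) (simp_all add: s cP_def cr algebra_simps sq)
  qed
  show ?thesis
  proof (rule transfers_scan[OF P Q n], unfold cP_def[symmetric] cQ_def[symmetric])
    fix X assume ok: "ok y cP X (0, y 0, y 0) (flat (comps (Nanophrase m p)))"
    let ?s = "(0, y 0, y 0)"
    define s1 where "s1 = scan y cP X ?s x"
    define s2 where "s2 = scan y cP X (?step X (?step X s1 (Letter A)) (Letter B)) z"
    have s2': "s2 = scan y cP X ?s (x @ [Letter A, Letter B] @ z)" by (simp add: s1_def s2_def)
    have at: "at_strand y s1" "at_strand y s2"
      unfolding s1_def s2' by (intro at_strand_scan at_strand_start)+
    have fst: "fst s1 = ?k" "fst s2 = ?l"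
      unfolding s1_def s2' by (simp_all only: fst_scan_start) simp_all
    have ok2: "ok y cP X s1 [Letter A, Letter B]" "ok y cP X s2 [Letter B, Letter A]"
      using ok by (simp_all add: flat s1_def s2_def)
    note eq = cancel[OF at fst ok2, THEN conjunct1] cancel[OF at fst ok2, THEN conjunct2]
    have s2: "scan y cP X s1 z = s2" by (simp add: s2_def eq(1))
    show "\<exists>X'. ok y cQ X' ?s (flat (comps (Nanophrase (m |` (- {A, B})) p'))) \<and>
        outs y cQ X' ?s (flat (comps (Nanophrase (m |` (- {A, B})) p'))) = outs y cP X ?s (flat (comps (Nanophrase m p))) \<and>
        scan y cQ X' ?s (flat (comps (Nanophrase (m |` (- {A, B})) p'))) = scan y cP X ?s (flat (comps (Nanophrase m p)))"
      using ok by (intro exI[of _ X]) (simp add: flat cong notin s1_def[symmetric] eq s2)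
  qed
qed

lemma crossing_self_crossing:
  assumes P: "nanophrase n P" and i: "i < length (comps P)" "count_list (comps P ! i) A = 2"
  shows "\<not> mixed_in P A"
proof
  assume "mixed_in P A"
  then obtain j where j: "j \<noteq> i" "j < length (comps P)" "A \<in> set (comps P ! j)" and
    A: "A \<in> dom (proj P)"
    using nanophrase_letter[OF P] unfolding mixed_def occ_rel_def
    by (smt (verit, best) case_prodD mem_Collect_eq nat_neq_iff)
  have "2 + 1 \<le> (\<Sum>k\<in>{i, j}. count_list (comps P ! k) A)"
    using i j count_list_0_iff[of "comps P ! j" A] by simp
  also have "\<dots> \<le> (\<Sum>k<length (comps P). count_list (comps P ! k) A)"
    using i j by (intro sum_mono2) auto
  also have "\<dots> = count_list (concat (comps P)) A"
    by (simp add: count_list_concat sum_list_sum_nth lessThan_atLeast0)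
  also have "\<dots> = 2" using P A by (simp add: nanophrase_def)
  finally show False by simp
qed

lemma transfers_Self_crossing:
  assumes P: "nanophrase n (Nanophrase m p)"
    and i: "i < length p" "count_list (p ! i) A = 2"
  shows "transfers n y (Nanophrase m p) (Nanophrase (m(A := map_option sigma_v (m A))) p)"
proof -
  have "\<not> mixed (occ_rel p) A"
    using crossing_self_crossing[OF P] i by simp
  then show ?thesis
    unfolding transfers_def solves_def longitude_def by (auto simp: crossing_upd)
qed

lemma transfers_Iso:
  assumes P: "nanophrase n (Nanophrase m p)"
    and f: "bij_betw f (dom m) (dom m')" and m': "\<forall>A\<in>dom m. m' (f A) = m A"
  shows "transfers n y (Nanophrase m p) (Nanophrase m' (map (map f) p))"
  unfolding transfers_def
proof (intro allI impI)
  fix X assume X: "solves y X (Nanophrase m p)"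
  let ?P = "Nanophrase m p" and ?Q = "Nanophrase m' (map (map f) p)"
  define X' where "X' B = X (inv_into (dom m) f B)" for B
  define c where "c = crossing_of ?P"
  define c' where "c' = crossing_of ?Q"
  have len: "length p = n" using P by (simp add: nanophrase_def)
  have inj: "inj_on f (dom m)" using f by (simp add: bij_betw_def)
  have letters: "set (p ! i) \<subseteq> dom m" if "i < n" for i
    using P that by (auto simp: nanophrase_def dest!: subsetD nth_mem)
  have R: "(f A, j) \<in> occ_rel (map (map f) p) \<longleftrightarrow> (A, j) \<in> occ_rel p" if "A \<in> dom m" for A j
    using inj_on_image_mem_iff[OF inj that letters[of j]] by (auto simp: occ_rel_def len)
  have cc: "c' (f A) k = c A k" if "A \<in> dom m" for A k
    unfolding c_def c'_def crossing_def mixed_def using R[OF that] m' that by simp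
  have X'f: "X' (f A) = X A" if "A \<in> dom m" for A
    using that inj by (simp add: X'_def)
  have word: "cword c' k (map f w) = map (\<lambda>(A, s). (f A, s)) (cword c k w)" if "set w \<subseteq> dom m" for k w
    using that by (induction w) (auto simp: cc letter_power_def split: option.splits)
  have val: "sval X' (map (\<lambda>(A, s). (f A, s)) w) = sval X w" if "fst ` set w \<subseteq> dom m" for w
    using that by (induction w) (auto simp: X'f[OF domI] split: prod.splits)
  have inv: "inv_word (map (\<lambda>(A, s). (f A, s)) w) = map (\<lambda>(A, s). (f A, s)) (inv_word w)" for w
    by (induction w) (auto simp: inv_word_Cons inv_word_append)
  have sub: "fst ` set (cword c k w) \<subseteq> dom m" if "set w \<subseteq> dom m" for k w
    using letters_cword[of c k w] that by blast
  have "solves_comp y X' c' k (map f w)" if "set w \<subseteq> dom m" "solves_comp y X c k w" for k w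
    unfolding solves_comp_def
  proof (intro allI impI)
    fix w1' B' w2'
    assume eq: "map f w = w1' @ B' # w2'" and B': "c' B' k = Some 0"
    then obtain w1 B w2 where w: "w = w1 @ B # w2" "w1' = map f w1" "B' = f B"
      by (auto simp: map_eq_append_conv map_eq_Cons_conv)
    then have "X B = sval X (inv_word (cword c k w1)) * y k * sval X (cword c k w1)"
      using that B' cc[of B] unfolding solves_comp_def by auto
    then show "X' B' = sval X' (inv_word (cword c' k w1')) * y k * sval X' (cword c' k w1')"
      using that w by (simp add: X'f word inv val sub)
  qed
  then have "solves y X' ?Q"
    using X letters by (simp add: solves_def c_def[symmetric] c'_def[symmetric, simplified] len)
      (simp add: c_def c'_def)
  moreover have "longitude X' ?Q k = longitude X ?P k" if "k < n" for k
    using word[OF letters[OF that]] val[OF sub[OF letters[OF that]]] that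
    by (simp add: longitude_def c_def c'_def len)
  ultimately show "\<exists>X'. solves y X' ?Q \<and> (\<forall>k<n. y k * longitude X' ?Q k = y k * longitude X ?P k)"
    by auto
qed

section \<open>The third move with letters that may be missing\<close>

definition local_swap where
  "local_swap y c X A B C s1 s2 s3 \<longleftrightarrow> (\<exists>X'. (\<forall>F. Some F \<noteq> A \<longrightarrow> Some F \<noteq> B \<longrightarrow> Some F \<noteq> C \<longrightarrow> X' F = X F) \<and>
    ok y c X' s1 (tok B @ tok A) \<and> ok y c X' s2 (tok C @ tok A) \<and> ok y c X' s3 (tok C @ tok B) \<and>
    scan y c X' s1 (tok B @ tok A) = scan y c X s1 (tok A @ tok B) \<and>
    scan y c X' s2 (tok C @ tok A) = scan y c X s2 (tok A @ tok C) \<and>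
    scan y c X' s3 (tok C @ tok B) = scan y c X s3 (tok B @ tok C))"

text \<open>For three letters, \<open>S'_w\<close> says that one strand is on top with suitable
  signs; for two letters, that the strand common to both is over. The further alternatives in
  \<open>S\<close> arise when self-crossings have been removed. None is listed for a missing
  \<open>B\<close> alone: \<open>k1 = k3\<close> would place all three strands on one component and
  remove \<open>A\<close> and \<open>C\<close> as well.\<close>

lemma local_swapI:
  assumes y: "nil_base y" and k: "k1 \<le> k2" "k2 \<le> k3"
    and s: "at_strand y (k1, v1, p1)" "at_strand y (k2, v2, p2)" "at_strand y (k3, v3, p3)"
    and A: "\<And>a. A = Some a \<Longrightarrow> k1 < k2 \<and> m a \<noteq> None \<and> B \<noteq> Some a \<and> C \<noteq> Some a \<and> (\<forall>j. (a, j) \<in> R \<longleftrightarrow> j = k1 \<or> j = k2)"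
    and B: "\<And>a. B = Some a \<Longrightarrow> k1 < k3 \<and> m a \<noteq> None \<and> C \<noteq> Some a \<and> (\<forall>j. (a, j) \<in> R \<longleftrightarrow> j = k1 \<or> j = k3)"
    and C: "\<And>a. C = Some a \<Longrightarrow> k2 < k3 \<and> m a \<noteq> None \<and> (\<forall>j. (a, j) \<in> R \<longleftrightarrow> j = k2 \<or> j = k3)"
    and S: "(Option.bind A m, Option.bind B m, Option.bind C m) \<in> S'_w \<or> A = None \<and> k1 = k2 \<or> C = None \<and> k2 = k3 \<or>
      length (filter (\<lambda>x. x \<noteq> None) [A, B, C]) \<le> 1"
    and c: "c = crossing R m"
    and ok: "ok y c X (k1, v1, p1) (tok A @ tok B)" "ok y c X (k2, v2, p2) (tok A @ tok C)"
      "ok y c X (k3, v3, p3) (tok B @ tok C)"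
  shows "local_swap y c X A B C (k1, v1, p1) (k2, v2, p2) (k3, v3, p3)"
proof -
  define u1 :: "_ \<Rightarrow> int" where
    "u1 a = (if m a = Some b_plus then 1 else if m a = Some a_minus then - 1 else 0)" for a
  define u2 :: "_ \<Rightarrow> int" where
    "u2 a = (if m a = Some a_plus then 1 else if m a = Some b_minus then - 1 else 0)" for a
  have over: "u1 a = 0 \<longleftrightarrow> u2 a \<noteq> 0" if "m a \<noteq> None" for a
  proof -
    from that obtain b where "m a = Some b" by blast
    then show ?thesis by (cases b) (simp_all add: u1_def u2_def)
  qed
  have over': "u2 a = 0 \<longleftrightarrow> u1 a \<noteq> 0" if "m a \<noteq> None" for a
    using over[OF that] by blast
  have mn: "A = Some a \<Longrightarrow> m a \<noteq> None" "B = Some a \<Longrightarrow> m a \<noteq> None" "C = Some a \<Longrightarrow> m a \<noteq> None" for a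
    using A B C by blast+
  have dist: "A = Some a \<Longrightarrow> B \<noteq> Some a \<and> C \<noteq> Some a" and dist': "B = Some a \<Longrightarrow> C \<noteq> Some a" for a
    using A B by blast+
  have sgn: "sign_valued c" by (simp add: c sign_valued_crossing)
  have cA: "c a k1 = Some (u1 a)" "c a k2 = Some (u2 a)" if "A = Some a" for a
    using crossing_pair[of a R k1 k2 m] A[OF that] by (simp_all add: c u1_def u2_def)
  have cB: "c a k1 = Some (u1 a)" "c a k3 = Some (u2 a)" if "B = Some a" for a
    using crossing_pair[of a R k1 k3 m] B[OF that] by (simp_all add: c u1_def u2_def)
  have cC: "c a k2 = Some (u1 a)" "c a k3 = Some (u2 a)" if "C = Some a" for a
    using crossing_pair[of a R k2 k3 m] C[OF that] by (simp_all add: c u1_def u2_def)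
  show ?thesis
  proof (cases A; cases B; cases C)
    fix a b d assume abd: "A = Some a" "B = Some b" "C = Some d"
    have "(m a, m b, m d) \<in> S'_w" using S abd by simp
    then have "u1 a = 0 \<and> u1 b = 0 \<and> u2 a = u2 b \<or> u2 b = 0 \<and> u2 d = 0 \<and> u1 b = u1 d \<or>
        u2 a = 0 \<and> u1 d = 0 \<and> u2 d = - u1 a"
      using mn(1)[OF abd(1)] mn(2)[OF abd(2)] mn(3)[OF abd(3)]
      unfolding S'_w_def u1_def u2_def by auto
    then have "\<exists>X'. (\<forall>F. F \<noteq> a \<longrightarrow> F \<noteq> b \<longrightarrow> F \<noteq> d \<longrightarrow> X' F = X F) \<and>
      ok y c X' (k1, v1, p1) [Letter b, Letter a] \<and> ok y c X' (k2, v2, p2) [Letter d, Letter a] \<and>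
      ok y c X' (k3, v3, p3) [Letter d, Letter b] \<and>
      scan y c X' (k1, v1, p1) [Letter b, Letter a] = scan y c X (k1, v1, p1) [Letter a, Letter b] \<and>
      scan y c X' (k2, v2, p2) [Letter d, Letter a] = scan y c X (k2, v2, p2) [Letter a, Letter d] \<and>
      scan y c X' (k3, v3, p3) [Letter d, Letter b] = scan y c X (k3, v3, p3) [Letter b, Letter d]"
      using dist[OF abd(1)] dist'[OF abd(2)] mn(1)[OF abd(1)] mn(2)[OF abd(2)] mn(3)[OF abd(3)] ok[unfolded abd tok.simps append_Cons append_Nil]
      by (intro swap_three_crossings[OF y sgn _ _ _ s cA[OF abd(1)] cB[OF abd(2)] cC[OF abd(3)]] over over')
        (auto simp only: abd option.inject)
    then show ?thesis
      unfolding abd local_swap_def tok.simps append_Cons append_Nil option.inject .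
  next
    fix b d assume abd: "A = None" "B = Some b" "C = Some d"
    have "(None, m b, m d) \<in> S'_w \<or> k1 = k2" using S mn(3)[OF abd(3)] abd by auto
    then have "k1 = k2 \<or> u2 b = 0 \<and> u2 d = 0"
      using mn(2)[OF abd(2)] mn(3)[OF abd(3)] unfolding S'_w_def u2_def by auto
    then have "\<exists>X'. (\<forall>F. F \<noteq> b \<longrightarrow> F \<noteq> d \<longrightarrow> X' F = X F) \<and>
      ok y c X' (k1, v1, p1) [Letter b] \<and> ok y c X' (k2, v2, p2) [Letter d] \<and>
      ok y c X' (k3, v3, p3) [Letter d, Letter b] \<and>
      scan y c X' (k1, v1, p1) [Letter b] = scan y c X (k1, v1, p1) [Letter b] \<and>
      scan y c X' (k2, v2, p2) [Letter d] = scan y c X (k2, v2, p2) [Letter d] \<and>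
      scan y c X' (k3, v3, p3) [Letter d, Letter b] = scan y c X (k3, v3, p3) [Letter b, Letter d]"
      using dist'[OF abd(2)] mn(2)[OF abd(2)] mn(3)[OF abd(3)] ok[unfolded abd tok.simps append_Cons append_Nil]
      by (intro swap_two_crossings[OF y sgn _ s(1,2) cB[OF abd(2)] _ cC[OF abd(3)]] over over')
        (auto simp only: abd option.inject)
    then show ?thesis
      unfolding abd local_swap_def tok.simps append_Cons append_Nil option.inject by (elim ex_forward) simp
  next
    fix a d assume abd: "A = Some a" "B = None" "C = Some d"
    have "(m a, None, m d) \<in> S'_w" using S abd by auto
    then have "u2 a = 0 \<and> u1 d = 0"
      using mn(1)[OF abd(1)] mn(3)[OF abd(3)] unfolding S'_w_def u1_def u2_def by auto
    then have "\<exists>X'. (\<forall>F. F \<noteq> a \<longrightarrow> F \<noteq> d \<longrightarrow> X' F = X F) \<and>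
      ok y c X' (k1, v1, p1) [Letter a] \<and> ok y c X' (k3, v3, p3) [Letter d] \<and>
      ok y c X' (k2, v2, p2) [Letter d, Letter a] \<and>
      scan y c X' (k1, v1, p1) [Letter a] = scan y c X (k1, v1, p1) [Letter a] \<and>
      scan y c X' (k3, v3, p3) [Letter d] = scan y c X (k3, v3, p3) [Letter d] \<and>
      scan y c X' (k2, v2, p2) [Letter d, Letter a] = scan y c X (k2, v2, p2) [Letter a, Letter d]"
      using dist[OF abd(1)] mn(1)[OF abd(1)] mn(3)[OF abd(3)] ok[unfolded abd tok.simps append_Cons append_Nil]
      by (intro swap_two_crossings[OF y sgn _ s(1,3) cA[OF abd(1)] _ cC(2,1)[OF abd(3)]] over over')
        (auto simp only: abd option.inject)
    then show ?thesis
      unfolding abd local_swap_def tok.simps append_Cons append_Nil option.inject by (elim ex_forward) simp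
  next
    fix a b assume abd: "A = Some a" "B = Some b" "C = None"
    have "(m a, m b, None) \<in> S'_w \<or> k2 = k3" using S mn(1)[OF abd(1)] abd by auto
    then have "k2 = k3 \<or> u1 a = 0 \<and> u1 b = 0"
      using mn(1)[OF abd(1)] mn(2)[OF abd(2)] unfolding S'_w_def u1_def by auto
    then have "\<exists>X'. (\<forall>F. F \<noteq> a \<longrightarrow> F \<noteq> b \<longrightarrow> X' F = X F) \<and>
      ok y c X' (k2, v2, p2) [Letter a] \<and> ok y c X' (k3, v3, p3) [Letter b] \<and>
      ok y c X' (k1, v1, p1) [Letter b, Letter a] \<and>
      scan y c X' (k2, v2, p2) [Letter a] = scan y c X (k2, v2, p2) [Letter a] \<and>
      scan y c X' (k3, v3, p3) [Letter b] = scan y c X (k3, v3, p3) [Letter b] \<and>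
      scan y c X' (k1, v1, p1) [Letter b, Letter a] = scan y c X (k1, v1, p1) [Letter a, Letter b]"
      using dist[OF abd(1)] mn(1)[OF abd(1)] mn(2)[OF abd(2)] ok[unfolded abd tok.simps append_Cons append_Nil]
      by (intro swap_two_crossings[OF y sgn _ s(2,3) cA(2,1)[OF abd(1)] _ cB(2,1)[OF abd(2)]] over over')
        (auto simp only: abd option.inject)
    then show ?thesis
      unfolding abd local_swap_def tok.simps append_Cons append_Nil option.inject by (elim ex_forward) simp
  qed (use ok in \<open>auto simp: local_swap_def simp del: ok.simps scan.simps intro!: exI[of _ X]\<close>)
qed

lemma transfers_H3:
  assumes P: "nanophrase n (Nanophrase m p)" and Q: "nanophrase n (Nanophrase m p')" and n: "n > 0"
    and flat: "flat p = x @ tok A @ tok B @ z @ tok A @ tok C @ w @ tok B @ tok C @ t"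
      "flat p' = x @ tok B @ tok A @ z @ tok C @ tok A @ w @ tok C @ tok B @ t"
    and S: "(Option.bind A m, Option.bind B m, Option.bind C m) \<in> S'_w"
    and y: "nil_base y"
  shows "transfers n y (Nanophrase m p) (Nanophrase m p')"
proof -
  have notin: "Letter a \<notin> set x \<and> Letter a \<notin> set z \<and> Letter a \<notin> set w \<and> Letter a \<notin> set t \<and> m a \<noteq> None"
    if "A = Some a \<or> B = Some a \<or> C = Some a" for a
  proof -
    have "Letter a \<in> set (flat p)" using that by (auto simp: flat)
    from nanophrase_flat_letter[OF P this] that show ?thesis
      by (auto simp: flat count_list_0_iff split: if_splits)
  qed
  have dist: "A = Some a \<Longrightarrow> B \<noteq> Some a \<and> C \<noteq> Some a" "B = Some a \<Longrightarrow> C \<noteq> Some a" for a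
  proof -
    have *: "count_list (flat p) (Letter a) = 2" if "A = Some a \<or> B = Some a"
      using that by (intro nanophrase_flat_letter[OF P]) (auto simp: flat)
    show "A = Some a \<Longrightarrow> B \<noteq> Some a \<and> C \<noteq> Some a" "B = Some a \<Longrightarrow> C \<noteq> Some a"
      using * by (auto simp: flat)
  qed
  define R where "R = occ_rel p"
  have R': "occ_rel p' = R"
    unfolding R_def occ_rel_flat flat by (auto split: option.splits)
  define c where "c = crossing R m"
  let ?k1 = "nseps x" and ?k2 = "nseps x + nseps z" and ?k3 = "nseps x + nseps z + nseps w"
  have RA: "(a, j) \<in> R \<longleftrightarrow> j = ?k1 \<or> j = ?k2" if "A = Some a" for a j
    using that notin[of a] dist(1)[of a]
    by (auto simp: R_def occ_rel_flat flat letters_at_absent split: option.splits)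
  have RB: "(a, j) \<in> R \<longleftrightarrow> j = ?k1 \<or> j = ?k3" if "B = Some a" for a j
    using that notin[of a] dist[of a]
    by (auto simp: R_def occ_rel_flat flat letters_at_absent split: option.splits)
  have RC: "(a, j) \<in> R \<longleftrightarrow> j = ?k2 \<or> j = ?k3" if "C = Some a" for a j
    using that notin[of a] dist[of a]
    by (auto simp: R_def occ_rel_flat flat letters_at_absent split: option.splits)
  \<comment> \<open>Letters whose two occurrences lie in one component are treated as empty, since
    the scan skips them. The coincidence of components that removes a letter is the one
    \<open>swap_two_crossings\<close> needs for the remaining two.\<close>
  define A' where "A' = (if ?k1 < ?k2 then A else None)"
  define B' where "B' = (if ?k1 < ?k3 then B else None)"
  define C' where "C' = (if ?k2 < ?k3 then C else None)"
  have skip: "scan y c X s (tok (Some a)) = s \<and> ok y c X s (tok (Some a))" if "c a = (\<lambda>_. None)" for X s a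
    using that by (cases s) simp
  have A': "scan y c X s (tok A) = scan y c X s (tok A')" "ok y c X s (tok A) = ok y c X s (tok A')" for X s
    using skip[of _ X s] crossing_self[of _ R ?k1 m] RA by (cases A; force simp: A'_def c_def)+
  have B': "scan y c X s (tok B) = scan y c X s (tok B')" "ok y c X s (tok B) = ok y c X s (tok B')" for X s
    using skip[of _ X s] crossing_self[of _ R ?k1 m] RB by (cases B; force simp: B'_def c_def)+
  have C': "scan y c X s (tok C) = scan y c X s (tok C')" "ok y c X s (tok C) = ok y c X s (tok C')" for X s
    using skip[of _ X s] crossing_self[of _ R ?k2 m] RC by (cases C; force simp: C'_def c_def)+
  have swap: "local_swap y c X A' B' C' (?k1, v1, p1) (?k2, v2, p2) (?k3, v3, p3)"
    if s: "at_strand y (?k1, v1, p1)" "at_strand y (?k2, v2, p2)" "at_strand y (?k3, v3, p3)"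
      and ok: "ok y c X (?k1, v1, p1) (tok A @ tok B)" "ok y c X (?k2, v2, p2) (tok A @ tok C)"
        "ok y c X (?k3, v3, p3) (tok B @ tok C)"
    for X v1 p1 v2 p2 v3 p3
  proof (rule local_swapI[OF y _ _ s])
    show "?k1 < ?k2 \<and> m a \<noteq> None \<and> B' \<noteq> Some a \<and> C' \<noteq> Some a \<and> (\<forall>j. (a, j) \<in> R \<longleftrightarrow> j = ?k1 \<or> j = ?k2)"
      if "A' = Some a" for a
    proof -
      have "A = Some a" "?k1 < ?k2" using that by (auto simp: A'_def split: if_splits)
      then show ?thesis using notin[of a] dist[of a] RA[of a] by (auto simp: B'_def C'_def split: if_splits)
    qed
    show "?k1 < ?k3 \<and> m a \<noteq> None \<and> C' \<noteq> Some a \<and> (\<forall>j. (a, j) \<in> R \<longleftrightarrow> j = ?k1 \<or> j = ?k3)"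
      if "B' = Some a" for a
    proof -
      have "B = Some a" "?k1 < ?k3" using that by (auto simp: B'_def split: if_splits)
      then show ?thesis using notin[of a] dist[of a] RB[of a] by (auto simp: C'_def split: if_splits)
    qed
    show "?k2 < ?k3 \<and> m a \<noteq> None \<and> (\<forall>j. (a, j) \<in> R \<longleftrightarrow> j = ?k2 \<or> j = ?k3)"
      if "C' = Some a" for a
    proof -
      have "C = Some a" "?k2 < ?k3" using that by (auto simp: C'_def split: if_splits)
      then show ?thesis using notin[of a] RC[of a] by auto
    qed
    show "(Option.bind A' m, Option.bind B' m, Option.bind C' m) \<in> S'_w \<or> A' = None \<and> ?k1 = ?k2 \<or>
        C' = None \<and> ?k2 = ?k3 \<or> length (filter (\<lambda>x. x \<noteq> None) [A', B', C']) \<le> 1"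
      using S by (auto simp: A'_def B'_def C'_def)
    show "ok y c X (?k1, v1, p1) (tok A' @ tok B')" "ok y c X (?k2, v2, p2) (tok A' @ tok C')"
      "ok y c X (?k3, v3, p3) (tok B' @ tok C')"
      using ok by (simp_all add: A' B' C')
  qed (simp_all add: c_def)
  show ?thesis
  proof (rule transfers_scan[OF P Q n], simp only: nanophrase.sel R' R_def[symmetric] c_def[symmetric])
    fix X assume ok: "ok y c X (0, y 0, y 0) (flat p)"
    let ?s = "(0, y 0, y 0)"
    define s1 where "s1 = scan y c X ?s x"
    define s1' where "s1' = scan y c X s1 (tok A @ tok B)"
    define s2 where "s2 = scan y c X s1' z"
    define s2' where "s2' = scan y c X s2 (tok A @ tok C)"
    define s3 where "s3 = scan y c X s2' w"
    define s3' where "s3' = scan y c X s3 (tok B @ tok C)"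
    have s2: "s2 = scan y c X ?s (x @ tok A @ tok B @ z)"
      by (simp add: s2_def s1'_def s1_def)
    have s3: "s3 = scan y c X ?s (x @ tok A @ tok B @ z @ tok A @ tok C @ w)"
      by (simp add: s3_def s2'_def s2)
    have at: "at_strand y s1" "at_strand y s2" "at_strand y s3"
      unfolding s1_def s2 s3 by (intro at_strand_scan at_strand_start)+
    have fst: "fst s1 = ?k1" "fst s2 = ?k2" "fst s3 = ?k3"
      unfolding s1_def s2 s3 fst_scan_start by simp_all
    have oks: "ok y c X s1 (tok A @ tok B)" "ok y c X s2 (tok A @ tok C)" "ok y c X s3 (tok B @ tok C)"
      using ok by (simp_all add: flat s1_def s2_def s3_def s1'_def s2'_def)
    have "local_swap y c X A' B' C' s1 s2 s3"
      using swap[of "fst (snd s1)" "snd (snd s1)" "fst (snd s2)" "snd (snd s2)" "fst (snd s3)" "snd (snd s3)" X]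
        at oks fst by (metis prod.collapse)
    then obtain X' where frame: "\<And>F. Some F \<noteq> A \<Longrightarrow> Some F \<noteq> B \<Longrightarrow> Some F \<noteq> C \<Longrightarrow> X' F = X F"
      and new: "ok y c X' s1 (tok B @ tok A)" "ok y c X' s2 (tok C @ tok A)" "ok y c X' s3 (tok C @ tok B)"
        "scan y c X' s1 (tok B @ tok A) = s1'" "scan y c X' s2 (tok C @ tok A) = s2'"
        "scan y c X' s3 (tok C @ tok B) = s3'"
      unfolding local_swap_def s1'_def s2'_def s3'_def
      by (simp add: A'[symmetric] B'[symmetric] C'[symmetric]) (metis A'_def B'_def C'_def option.distinct(1))
    \<comment> \<open>The new values are confined to the displayed letters, and the displayed places
      return the old states, so the remaining pieces start from the same states and act as
      before.\<close>
    have cong: "scan y c X' s T = scan y c X s T" "ok y c X' s T = ok y c X s T" "outs y c X' s T = outs y c X s T"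
      if "T \<in> {x, z, w, t}" for s T
    proof -
      have "X' F = X F \<and> c F = c F" if "Letter F \<in> set T" for F
        using frame[of F] notin[of F] that \<open>T \<in> {x, z, w, t}\<close> by auto
      then show "scan y c X' s T = scan y c X s T" "ok y c X' s T = ok y c X s T"
        "outs y c X' s T = outs y c X s T" by (rule scan_cong[of T X' X c c], simp)+
    qed
    have no_outs: "outs y c X s (tok F) = []" for X s F
      by (cases F) auto
    show "\<exists>X'. ok y c X' ?s (flat p') \<and> outs y c X' ?s (flat p') = outs y c X ?s (flat p) \<and>
        scan y c X' ?s (flat p') = scan y c X ?s (flat p)"
      using ok new cong s1_def s2_def s3_def s1'_def s2'_def s3'_def
      by (intro exI[of _ X']) (simp add: flat no_outs)
  qed
qed

section \<open>Rotations of subsequences\<close>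

text \<open>A rotation exchanges two blocks; exchanging the corresponding parts of \<open>s\<close>
  undoes it. Thus eliminating and permuting cyclically may be done in either order.\<close>

lemma subseq_rotate:
  assumes "subseq s (rotate r xs)"
  obtains r' s' where "subseq s' xs" "s = rotate r' s'"
proof -
  let ?k = "r mod length xs"
  have "subseq s (drop ?k xs @ take ?k xs)" using assms by (simp add: rotate_drop_take)
  then obtain s1 s2 where s: "s = s1 @ s2" "subseq s1 (drop ?k xs)" "subseq s2 (take ?k xs)"
    by (auto simp: subseq_append_iff)
  then have "subseq (s2 @ s1) (take ?k xs @ drop ?k xs)" by (intro list_emb_append_mono)
  then show ?thesis using that[of "s2 @ s1" "length s2"] s by (simp add: rotate_append)
qed

lemma dvd_mu_of_Delta:
  assumes d: "d dvd Delta P ds" and s: "subseq s (rotate r ds)" "2 \<le> length s" "length s < length ds"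
  shows "d dvd mu P (rotate r' s)"
proof -
  obtain r0 s0 where s0: "subseq s0 ds" "s = rotate r0 s0" using s(1) by (rule subseq_rotate)
  then have "rotate r' s = rotate (r' + r0) s0" by (simp add: rotate_rotate)
  then have "mu P (rotate r' s) \<in> {mu P (rotate r s) | r s. s \<in> set (subseqs ds) \<and> 2 \<le> length s \<and> length s < length ds}"
    using s0 s by auto
  then have "Delta P ds dvd mu P (rotate r' s)" unfolding Delta_def by (rule Gcd_dvd)
  then show ?thesis using d by (rule dvd_trans[rotated])
qed

section \<open>The shift move\<close>

lemma longitude_expansion:
  assumes P: "nanophrase n P" and k: "k < n"
    and y: "nil_base y" "strict_base y" "\<And>k. k \<ge> n \<Longrightarrow> y k = 0"
    and X: "solves y X P"
  shows "longitude X P k = (\<Sum>m\<in>squarefree_lists n. of_int (mu P (m @ [k])) * monomial y m)"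
  by (rule tri_eqI) (simp add: ent_longitude[OF assms] ent_sum)

lemma ent_monomial_mer_outside:
  "a < b \<Longrightarrow> length L < b \<Longrightarrow> ent (monomial (mer L) m) a b = 0"
proof (induction m arbitrary: a)
  case (Cons h m)
  then show ?case by (cases "Suc a < b") (auto simp: ent_mer_mult)
qed (simp add: ent_one)

lemma ent_longitude_mer_outside:
  assumes P: "nanophrase n P" and k: "k < n" and L: "distinct L" "set L \<subseteq> {..<n}"
    and X: "solves (mer L) X P" and ab: "a < b" "length L < b"
  shows "ent (longitude X P k) a b = 0"
proof -
  have "ent (longitude X P k) a b =
      (\<Sum>m\<in>squarefree_lists n. mu P (m @ [k]) * ent (monomial (mer L) m) a b)"
    using L(2) by (intro ent_longitude[OF P k] nil_base_mer L strict_base_mer mer_outside X) auto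
  then show ?thesis using ab by (simp add: ent_monomial_mer_outside)
qed

lemma subseq_segment: "subseq (take k (drop a L)) L"
  by (metis append_take_drop_id subseq_drop_many subseq_rev_drop_many subseq_order.refl)

text \<open>Away from the diagonals next to the main one, the entries in question are values of
  \<open>mu\<close> on cyclic permutations of contiguous segments of \<open>L\<close>. Fewer than
  \<open>length L\<close> diagonals means proper segments, whose values \<open>d\<close> divides.
  Modulo \<open>d\<close> the meridian thus absorbs its longitude from either side, up to but
  excluding the corner entry.\<close>

lemma meridian_longitude_agree:
  assumes P: "nanophrase n P" and k: "k < n" and L: "distinct L" "set L \<subseteq> {..<n}"
    and X: "solves (mer L) X P" and d: "d dvd Delta P ds" "L = rotate r ds"
  shows "agree d (length L) (mer L k * longitude X P k) (mer L k)"
    and "agree d (length L) (longitude X P k * mer L k) (mer L k)"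
proof -
  have mu: "d dvd mu P (rotate r' (take l (drop a L)))" if "2 \<le> l" "l < length L" "a + l \<le> length L" for r' a l
    using that subseq_segment[of l a L] d(2) by (intro dvd_mu_of_Delta[OF d(1), of _ r]) auto
  show "agree d (length L) (mer L k * longitude X P k) (mer L k)"
    unfolding agree_def
  proof (intro allI impI)
    fix a b assume ab: "b - a < length L"
    show "d dvd ent (mer L k * longitude X P k) a b - ent (mer L k) a b"
    proof (cases "a < length L \<and> L ! a = k \<and> Suc a < b")
      case False
      have "ent (longitude X P k) (Suc a) (Suc a) = 1" if "a < length L"
        using that ent_longitude_mer[OF P k L X, of "Suc a" "Suc a"] by simp
      then show ?thesis using False by (cases "b = Suc a") (auto simp: ent_mer_mult ent_mer)
    next
      case True
      have "d dvd ent (longitude X P k) (Suc a) b"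
      proof (cases "b \<le> length L")
        case b: True
        \<comment> \<open>On the left, \<open>mer L k\<close> uses up the index \<open>k\<close> at
          the front of the segment while \<open>mu\<close> has it at the end, hence one rotation. In
          the other half of the lemma \<open>k\<close> already ends the segment.\<close>
        have "take (b - Suc a) (drop (Suc a) L) @ [k] = rotate 1 (take (b - a) (drop a L))"
        proof -
          have "drop a L = k # drop (Suc a) L" using True Cons_nth_drop_Suc by metis
          moreover have "b - a = Suc (b - Suc a)" using True by linarith
          ultimately show ?thesis by simp
        qed
        moreover have "2 \<le> b - a" using True by linarith
        ultimately show ?thesis
          using True b ab mu[of "b - a" a 1] by (simp add: ent_longitude_mer[OF P k L X] del: rotate_Suc One_nat_def)
      next
        case False
        then show ?thesis using True by (simp add: ent_longitude_mer_outside[OF P k L X])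
      qed
      then show ?thesis using True by (simp add: ent_mer_mult ent_mer)
    qed
  qed
  show "agree d (length L) (longitude X P k * mer L k) (mer L k)"
    unfolding agree_def
  proof (intro allI impI)
    fix a b assume ab: "b - a < length L"
    show "d dvd ent (longitude X P k * mer L k) a b - ent (mer L k) a b"
    proof (cases "0 < b \<and> b \<le> length L \<and> L ! (b - 1) = k \<and> Suc a < b")
      case False
      have "ent (longitude X P k) a a = 1" if "a < length L"
        using that ent_longitude_mer[OF P k L X, of a a] by simp
      then show ?thesis using False by (cases "b = Suc a") (auto simp: ent_mult_mer ent_mer)
    next
      case True
      have "take (b - 1 - a) (drop a L) @ [k] = take (b - a) (drop a L)"
      proof -
        have len: "b - a = Suc (b - 1 - a)" "b - 1 - a < length (drop a L)"
          using True unfolding length_drop by linarith+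
        have "drop a L ! (b - 1 - a) = L ! (a + (b - 1 - a))" using len(2) by (intro nth_drop) simp
        moreover have "a + (b - 1 - a) = b - 1" using True by linarith
        ultimately have "drop a L ! (b - 1 - a) = k" using True by simp
        with len show ?thesis by (metis take_Suc_conv_app_nth)
      qed
      moreover have "2 \<le> b - a" "a \<le> b - 1" "b - 1 \<le> length L" using True by linarith+
      ultimately have "d dvd ent (longitude X P k) a (b - 1)"
        using True ab mu[of "b - a" a 0] ent_longitude_mer[OF P k L X, of a "b - 1"] by simp
      then show ?thesis using True by (simp add: ent_mult_mer ent_mer)
    qed
  qed
qed

lemma mu_as_entry:
  assumes P: "nanophrase n P" and L: "distinct (i # c)" "set (i # c) \<subseteq> {..<n}"
    and X: "solves (mer (i # c)) X P"
  shows "ent (mer (i # c) i * longitude X P i) 0 (Suc (length c)) = mu P (c @ [i])"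
  using ent_longitude_mer[OF P _ L X, of i 1 "Suc (length c)"] L
  by (simp add: ent_mer_mult)

lemma mu_transfers:
  assumes P: "nanophrase n P" and Q: "nanophrase n Q" and L: "distinct (i # c)" "set (i # c) \<subseteq> {..<n}"
    and "transfers n (mer (i # c)) P Q"
  shows "mu P (c @ [i]) = mu Q (c @ [i])"
proof -
  obtain X where X: "solves (mer (i # c)) X P"
    using solves_exists[OF P strict_base_mer] by blast
  then obtain X' where X': "solves (mer (i # c)) X' Q" "\<forall>k<n. mer (i # c) k * longitude X' Q k = mer (i # c) k * longitude X P k"
    using assms(5) unfolding transfers_def by blast
  have "i < n" using L by simp
  then show ?thesis
    using X'(2) mu_as_entry[OF P L X] mu_as_entry[OF Q L X'(1)] by simp
qed

section \<open>Monomials in conjugated meridians\<close>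

lemma agree_0_mult:
  assumes "agree d k f 0" "agree d l g 0"
  shows "agree d (k + l) (f * g) 0"
  unfolding agree_def
proof (intro allI impI)
  fix a b :: nat assume ab: "b - a < k + l"
  have "d dvd ent f a x * ent g x b" if "x \<in> {a..b}" for x
  proof (cases "x - a < k")
    case True
    then show ?thesis using assms(1) by (simp add: agree_def)
  next
    case False
    then have "b - x < l" using that ab by auto
    then show ?thesis using assms(2) by (simp add: agree_def)
  qed
  then show "d dvd ent (f * g) a b - ent 0 a b"
    by (auto simp: ent_mult intro: dvd_sum)
qed

lemma strict_agree: "strict f \<longleftrightarrow> agree 0 1 f 0"
  by (auto simp: strict_def agree_def) (metis ent_below le_neq_implies_less)

lemma monomial_degree: "strict_base y \<Longrightarrow> agree 0 (length m) (monomial y m) 0"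
proof (induction m)
  case (Cons h m)
  then show ?case
    using agree_0_mult[of 0 1 "y h" "length m" "monomial y m"] by (simp add: strict_base_def strict_agree)
qed simp

text \<open>Factors that differ only beyond the first superdiagonal have products with the same
  leading diagonal. After a change of base point this keeps the coefficient 1 in front of the value
  of \<open>mu\<close> that is sought.\<close>

lemma monomial_agree:
  assumes y: "strict_base y" and y': "strict_base y'" and yy': "\<And>h. agree 0 2 (y' h) (y h)"
  shows "agree 0 (Suc (length m)) (monomial y' m) (monomial y m)"
proof (induction m)
  case (Cons h m)
  have "agree 0 (Suc (Suc (length m))) (y' h * monomial y' m) (y' h * monomial y m)"
    using y' Cons by (intro agree_mult_strict_left) (simp_all add: strict_base_def)
  moreover have "agree 0 (2 + length m) ((y' h - y h) * monomial y m) 0"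
    using yy'[of h] monomial_degree[OF y] by (intro agree_0_mult) (simp_all add: agree_def)
  then have "agree 0 (Suc (Suc (length m))) (y' h * monomial y m) (y h * monomial y m)"
    by (simp add: agree_def left_diff_distrib)
  ultimately show ?case by (simp add: agree_trans)
qed simp

lemma ent_mult_nonzero:
  assumes "ent (f * g) a b \<noteq> 0"
  obtains x where "x \<in> {a..b}" "ent f a x \<noteq> 0" "ent g x b \<noteq> 0"
proof -
  have "\<exists>x\<in>{a..b}. ent f a x * ent g x b \<noteq> 0"
    using assms unfolding ent_mult by (meson sum.neutral)
  then show ?thesis using that by auto
qed

text \<open>Each factor has to step across a position of its own index in \<open>L\<close>, but may
  skip others. So conjugated meridians detect arbitrary subsequences of \<open>L\<close>, where
  \<open>mer L\<close> detects only contiguous segments; these are the sequences that \<Delta>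
  controls.\<close>

lemma monomial_support:
  assumes shape: "\<And>h a b. ent (y h) a b \<noteq> 0 \<Longrightarrow> \<exists>j<length L. L ! j = h \<and> a \<le> j \<and> j < b"
  shows "ent (monomial y m) a b \<noteq> 0 \<Longrightarrow> subseq m (drop a L)"
proof (induction m arbitrary: a)
  case (Cons h m)
  then obtain x where x: "ent (y h) a x \<noteq> 0" "ent (monomial y m) x b \<noteq> 0"
    by (auto elim: ent_mult_nonzero)
  obtain j where j: "j < length L" "L ! j = h" "a \<le> j" "j < x" using shape[OF x(1)] by blast
  have "drop (Suc j) L = take (x - Suc j) (drop (Suc j) L) @ drop x L"
    using j(4) by (metis Suc_leI append_take_drop_id drop_drop le_add_diff_inverse2)
  then have "subseq m (drop (Suc j) L)"
    using Cons.IH[OF x(2)] by (metis subseq_drop_many)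
  then have "subseq (h # m) (drop j L)"
    using j(1,2) by (metis Cons_nth_drop_Suc subseq_Cons2)
  moreover have "drop a L = take (j - a) (drop a L) @ drop j L"
    using j(3) by (metis append_take_drop_id drop_drop le_add_diff_inverse2)
  ultimately show ?case by (metis subseq_drop_many)
qed simp

lemma ent_conj_mer_support:
  assumes "ent (f * mer L h * g) a b \<noteq> 0"
  shows "\<exists>j<length L. L ! j = h \<and> a \<le> j \<and> j < b"
proof -
  obtain x where x: "x \<in> {a..b}" "ent (f * mer L h) a x \<noteq> 0"
    using assms by (rule ent_mult_nonzero)
  then have "0 < x" "x \<le> length L" "L ! (x - 1) = h" "\<not> x - 1 < a"
    by (auto simp: ent_mult_mer split: if_splits)
  then show ?thesis using x(1) by (intro exI[of _ "x - 1"]) auto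
qed

section \<open>Moving the base point of a component\<close>

lemma occ_rel_shift:
  assumes "k < length p" "p ! k = A # x"
  shows "occ_rel (p[k := x @ [A]]) = occ_rel p"
  using assms by (auto simp: occ_rel_def nth_list_update split: if_splits)

text \<open>The projection changes by \<open>nu_v\<close> only if both occurrences lie in the
  shifted component, and such letters have no sign.\<close>

lemma shift_crossing:
  assumes P: "nanophrase n (Nanophrase m p)" and k: "k < length p" "p ! k = A # x"
  shows "crossing (occ_rel (p[k := x @ [A]])) (if A \<in> set x then m(A := map_option nu_v (m A)) else m) =
    crossing (occ_rel p) m"
proof (cases "A \<in> set x")
  case True
  have "(A, k) \<in> occ_rel p" using k by (auto simp: occ_rel_def)
  then have "A \<in> dom m" using nanophrase_letter[OF P] by simp
  then have "count_list (concat p) A = 2" using P by (simp add: nanophrase_def)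
  moreover have "count_list (p ! k) A \<le> count_list (concat p) A"
    unfolding count_list_concat using nth_mem[OF k(1)] by (intro member_le_sum_list) simp_all
  moreover have "count_list x A \<noteq> 0" using True by (simp add: count_list_0_iff)
  ultimately have "count_list (p ! k) A = 2" using k by simp
  then have "\<not> mixed (occ_rel p) A" using crossing_self_crossing[OF P] k by simp
  then show ?thesis using True occ_rel_shift[OF k] by (simp add: crossing_upd)
qed (simp add: occ_rel_shift[OF k])

text \<open>Dropping the leading \<open>A\<close> from every prefix is compensated by passing to the
  meridian \<open>y'\<close>; since \<open>A\<close> is not an over occurrence, its new place at the
  end imposes no relation.\<close>

lemma solves_comp_rotate:
  assumes "solves_comp y X c k (A # x)" and "c A k \<noteq> Some 0"
    and conj: "\<And>w. sval X (inv_word (cword c k (A # w))) * y k * sval X (cword c k (A # w)) =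
      sval X (inv_word (cword c k w)) * y' * sval X (cword c k w)" and y': "y' = z k"
  shows "solves_comp z X c k (x @ [A])"
  unfolding solves_comp_def
proof (intro allI impI)
  fix w1 B w2 assume w: "x @ [A] = w1 @ B # w2" and B: "c B k = Some 0"
  then have "w2 \<noteq> []" using assms(2) by auto
  then obtain w2' where "A # x = (A # w1) @ B # w2'"
    using w by (cases w2 rule: rev_cases) auto
  then have "X B = sval X (inv_word (cword c k (A # w1))) * y k * sval X (cword c k (A # w1))"
    using assms(1) B unfolding solves_comp_def by blast
  then show "X B = sval X (inv_word (cword c k w1)) * z k * sval X (cword c k w1)"
    using conj[of w1] y' by simp
qed

lemma mu_shift:
  assumes P0: "nanophrase n P" and Q0: "nanophrase n Q"
    and P_eq: "P = Nanophrase m p"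
    and Q_eq: "Q = Nanophrase (if A \<in> set x then m(A := map_option nu_v (m A)) else m) (p[k := x @ [A]])"
    and k: "k < length p" "p ! k = A # x"
    and L: "distinct (i # c)" "set (i # c) \<subseteq> {..<n}" and c: "c \<noteq> []"
    and dP0: "d dvd Delta P (c @ [i])" and dQ0: "d dvd Delta Q (c @ [i])"
  shows "d dvd mu P (c @ [i]) - mu Q (c @ [i])"
  unfolding P_eq Q_eq
proof -
  let ?P = "Nanophrase m p"
    and ?Q = "Nanophrase (if A \<in> set x then m(A := map_option nu_v (m A)) else m) (p[k := x @ [A]])"
  note P = P0[unfolded P_eq] and Q = Q0[unfolded Q_eq] and dP = dP0[unfolded P_eq] and dQ = dQ0[unfolded Q_eq]
  define L where "L = i # c"
  define C where "C = crossing (occ_rel p) m"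
  let ?y = "mer L" and ?u = "Suc (length c)"
  note LL = L[folded L_def]
  have n: "length p = n" using P by (simp add: nanophrase_def)
  then have kn: "k < n" using k by simp
  have "i < n" using L by simp
  have CP: "crossing_of ?P = C" by (simp add: C_def)
  have CQ: "crossing_of ?Q = C" using shift_crossing[OF P k] by (simp add: C_def)
  have rot: "L = rotate (length c) (c @ [i])" by (simp add: L_def rotate_append)
  note y = nil_base_mer[OF LL(1)] strict_base_mer[of L]
  obtain X where X: "solves ?y X ?P" using solves_exists[OF P strict_base_mer] by blast
  have Xc: "solves_comp ?y X C j (p ! j)" if "j < n" for j
    using X that n by (simp add: solves_def C_def)
  have Xk: "solves_comp ?y X C k (A # x)" using Xc[OF kn] k by simp
  have muP: "ent (?y i * longitude X ?P i) 0 ?u = mu ?P (c @ [i])"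
    unfolding L_def by (rule mu_as_entry[OF P L X[unfolded L_def]])
  have lengths: "length (p[k := x @ [A]]) = n" by (simp add: n)
  have longP: "longitude X ?P j = sval X (cword C j (p ! j))" for j
    by (simp add: longitude_def C_def)
  have longQ: "longitude X' ?Q j = sval X' (cword C j (p[k := x @ [A]] ! j))" for X' :: "'a \<Rightarrow> tri" and j
    unfolding longitude_def CQ by simp
  have "C A k \<in> {None, Some 0, Some 1, Some (- 1)}"
    using sign_valued_crossing[of "occ_rel p" m] unfolding sign_valued_def C_def by blast
  then consider (skip) "C A k = None" | (over) "C A k = Some 0" | (under) e where "C A k = Some e" "e = 1 \<or> e = - 1"
    by auto
  then show "d dvd mu ?P (c @ [i]) - mu ?Q (c @ [i])"
  proof cases
    case skip
    have "transfers n ?y ?P ?Q"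
      unfolding transfers_def
    proof (intro allI impI)
      fix X assume X: "solves ?y X ?P"
      have "solves_comp ?y X C j (p[k := x @ [A]] ! j)" if "j < n" for j
      proof (cases "j = k")
        case True
        have "solves_comp ?y X C k (A # x)" using X k by (auto simp: solves_def C_def)
        then have "solves_comp ?y X C k (x @ [A])"
          by (rule solves_comp_rotate[where y' = "?y k"]) (simp_all add: skip)
        then show ?thesis using True k by simp
      next
        case False
        then show ?thesis using X that n by (simp add: solves_def C_def)
      qed
      then have "solves ?y X ?Q" unfolding solves_def CQ by (simp add: n)
      moreover have "longitude X ?Q j = longitude X ?P j" for j
        using k skip by (cases "j = k") (simp_all add: longitude_def CQ[simplified] C_def[symmetric])
      ultimately show "\<exists>X'. solves ?y X' ?Q \<and> (\<forall>k<n. ?y k * longitude X' ?Q k = ?y k * longitude X ?P k)"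
        by auto
    qed
    then show ?thesis using mu_transfers[OF P Q L] by (simp add: L_def)
  next
    case over
    obtain X' where X': "solves ?y X' ?Q" using solves_exists[OF Q strict_base_mer] by blast
    let ?V = "sval X (cword C k x)" and ?V' = "sval X (inv_word (cword C k x))"
    have V: "longitude X ?P k = ?V" using over k by (simp add: longP letter_power_def)
    have "\<And>B. B \<in> fst ` set (cword C k x) \<Longrightarrow> X B * X B = 0"
      using solves_square[OF P y(1) X] letters_cword_mixed unfolding C_def by fastforce
    then have inv: "?V' * ?V = 1" by (rule sval_inv_left)
    have XA: "X A = ?y k"
      using Xk over unfolding solves_comp_def by (metis append_Nil cword_simps(1) inv_word_Nil mult.left_neutral mult.right_neutral sval_Nil)
    \<comment> \<open>Only the relation of \<open>A\<close> changes: its prefix was empty and is now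
      all of \<open>x\<close>, so it asks for \<open>y k\<close> conjugated by the longitude. Modulo
      \<open>d\<close> this is still \<open>y k\<close>, hence \<open>X\<close> solves the new
      system approximately and can be compared with the exact solution \<open>X'\<close>.\<close>
    have 1: "agree d (length L) (?y k * ?V) (?y k)" "agree d (length L) (?V * ?y k) (?y k)"
      using meridian_longitude_agree[OF P kn LL X dP rot] by (simp_all add: V)
    have "agree d (length L) (?V' * (?V * ?y k)) (?V' * ?y k)"
      using 1(2) by (intro agree_mult) auto
    then have "agree d (length L) (?y k) (?V' * ?y k)" by (simp add: mult.assoc[symmetric] inv)
    then have "agree d (length L) (?y k * ?V) (?V' * ?y k * ?V)" by (intro agree_mult) auto
    then have conj: "agree d (length L) (X A) (?V' * ?y k * ?V)"
      unfolding XA using 1(1) agree_sym agree_trans by blast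
    have "agree d (length L) (X B) (sval X (inv_word (cword C j w1)) * ?y j * sval X (cword C j w1))"
      if j: "j < n" and w: "p[k := x @ [A]] ! j = w1 @ B # w2" and B: "C B j = Some 0" for j w1 B w2
    proof (cases "j = k")
      case False
      then have "X B = sval X (inv_word (cword C j w1)) * ?y j * sval X (cword C j w1)"
        using Xc[OF j] w B unfolding solves_comp_def by auto
      then show ?thesis by simp
    next
      case True
      then have w: "x @ [A] = w1 @ B # w2" using w k by simp
      show ?thesis
      proof (cases w2 rule: rev_cases)
        case Nil
        then have "B = A" "w1 = x" using w by auto
        then show ?thesis using conj True by simp
      next
        case (snoc w2' A')
        then have "A # x = (A # w1) @ B # w2'" using w by simp
        then have "X B = sval X (inv_word (cword C k (A # w1))) * ?y k * sval X (cword C k (A # w1))"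
          using Xk B True unfolding solves_comp_def by blast
        then show ?thesis using over True by (simp add: letter_power_def)
      qed
    qed
    then have "\<forall>B. mixed_in ?Q B \<longrightarrow> agree d (length L) (X B) (conj_step ?y (eta_index ?Q) (x_word ?Q) X B)"
      using all_over_occurrences_iff[OF Q, of "\<lambda>B u j. agree d (length L) (X B) (sval X (inv_word u) * ?y j * sval X u)"]
      unfolding CQ by (simp add: n conj_step_def)
    note fixX = this
    have fixX': "\<forall>B. mixed_in ?Q B \<longrightarrow> X' B = conj_step ?y (eta_index ?Q) (x_word ?Q) X' B"
      using solves_iff_fixed[OF Q] X' by blast
    have "agree d (length L) (X B) (X' B)" if "mixed_in ?Q B" for B
    proof (rule conj_step_fixed_unique[OF y(2), of "Collect (mixed_in ?Q)" "x_word ?Q"])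
      show "fst ` set (x_word ?Q B) \<subseteq> Collect (mixed_in ?Q)" if "B \<in> Collect (mixed_in ?Q)" for B
        using letters_x_word[OF Q] that by simp
      show "agree d (length L) (X B) (conj_step ?y (eta_index ?Q) (x_word ?Q) X B)"
        if "B \<in> Collect (mixed_in ?Q)" for B
        using fixX that by simp
      show "agree d (length L) (X' B) (conj_step ?y (eta_index ?Q) (x_word ?Q) X' B)"
        if "B \<in> Collect (mixed_in ?Q)" for B
        using fixX' that by (metis agree_refl mem_Collect_eq)
    qed (use that in simp)
    moreover have "fst ` set (cword C i (p[k := x @ [A]] ! i)) \<subseteq> Collect (mixed_in ?Q)"
      using letters_cword_mixed[of "occ_rel (comps ?Q)" "proj ?Q" i "p[k := x @ [A]] ! i", unfolded CQ] .
    ultimately have "agree d (length L) (longitude X ?Q i) (longitude X' ?Q i)"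
      unfolding longQ by (intro sval_agree) blast
    moreover have "longitude X ?Q i = longitude X ?P i"
      using over k by (cases "i = k") (simp_all add: longP longQ letter_power_def)
    \<comment> \<open>Multiplying by \<open>y i\<close> gains the one diagonal needed to reach the
      corner entry, which lies at distance \<open>length L\<close>.\<close>
    ultimately have "agree d (Suc (length L)) (?y i * longitude X ?P i) (?y i * longitude X' ?Q i)"
      using y(2) by (intro agree_mult_strict_left) (simp_all add: strict_base_def)
    then have "d dvd ent (?y i * longitude X ?P i) 0 ?u - ent (?y i * longitude X' ?Q i) 0 ?u"
      by (simp add: agree_def L_def)
    moreover have "ent (?y i * longitude X' ?Q i) 0 ?u = mu ?Q (c @ [i])"
      unfolding L_def by (rule mu_as_entry[OF Q L X'[unfolded L_def]])
    ultimately show ?thesis using muP by simp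
  next
    case under
    let ?E = "of_int e * X A"
    \<comment> \<open>The meridian of component \<open>k\<close> as seen from the base point behind
      the undercrossing \<open>A\<close>. With it, the old \<open>X\<close> is an exact solution
      after the shift.\<close>
    define y' where "y' h = (if h = k then (1 - ?E) * ?y k * (1 + ?E) else ?y h)" for h
    have mixed: "mixed_in ?P A" using under(1) by (auto simp: C_def crossing_def split: if_splits)
    have "X A * X A = 0" by (rule solves_square[OF P y(1) X mixed])
    then have EE: "(1 + ?E) * (1 - ?E) = 1" "(1 - ?E) * (1 + ?E) = 1"
      using under(2) by (auto simp: algebra_simps)
    have "X A = conj_step ?y (eta_index ?P) (x_word ?P) X A"
      using solves_iff_fixed[OF P] X mixed by blast
    then have "strict (X A)"
      using y(2) unfolding conj_step_def strict_base_def by (metis strict_mult_left strict_mult_right)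
    then have strictE: "strict ?E" by (rule strict_mult_right)
    have y'_mer: "\<exists>f g. y' h = f * ?y h * g \<and> agree 0 1 f 1 \<and> agree 0 1 g 1" for h
    proof (cases "h = k")
      case True
      have "agree 0 1 (1 - ?E) 1" "agree 0 1 (1 + ?E) 1"
        using strictE by (simp_all add: strict_agree agree_def)
      then show ?thesis using True unfolding y'_def by auto
    next
      case False
      then show ?thesis by (intro exI[of _ 1]) (simp add: y'_def)
    qed
    have nil': "nil_base y'"
      unfolding nil_base_def
    proof (intro allI)
      fix h r
      obtain f g where "y' h = f * ?y h * g" using y'_mer by blast
      moreover have "f * ?y h * g * r * (f * ?y h * g) = f * (?y h * (g * r * f) * ?y h) * g"
        by (simp add: mult.assoc)
      ultimately show "y' h * r * y' h = 0" using nil_baseD(1)[OF y(1)] by simp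
    qed
    have strict': "strict_base y'"
      unfolding strict_base_def using y'_mer y(2) by (metis strict_base_def strict_mult_left strict_mult_right)
    have zero': "y' h = 0" if "h \<ge> n" for h
    proof -
      have "h \<notin> set L" using that LL(2) by auto
      then show ?thesis using that kn by (simp add: y'_def mer_outside)
    qed
    have near: "agree 0 2 (y' h) (?y h)" for h
    proof -
      obtain f g where "y' h = f * ?y h * g" "agree 0 1 f 1" "agree 0 1 g 1" using y'_mer by blast
      then show ?thesis
        using agree_conj[of "?y h" 0 1 f 1 g 1] y(2) by (simp add: strict_base_def numeral_2_eq_2)
    qed
    have shape: "\<exists>j<length L. L ! j = h \<and> a \<le> j \<and> j < b" if "ent (y' h) a b \<noteq> 0" for h a b
      using that y'_mer[of h] ent_conj_mer_support by metis
    have X': "solves y' X ?Q"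
      unfolding solves_def CQ
    proof (intro allI impI)
      fix j assume "j < length (comps ?Q)"
      then have j: "j < n" by (simp add: n)
      show "solves_comp y' X C j (comps ?Q ! j)"
      proof (cases "j = k")
        case True
        have "sval X (inv_word (cword C k (A # w))) * ?y k * sval X (cword C k (A # w)) =
            sval X (inv_word (cword C k w)) * y' k * sval X (cword C k w)" for w
          using under by (auto simp: letter_power_def y'_def inv_word_append inv_word_Cons mult.assoc)
        note conj = this
        have "solves_comp y' X C k (x @ [A])"
          by (rule solves_comp_rotate[OF Xk _ conj]) (use under in auto)
        then show ?thesis using True k by simp
      next
        case False
        then show ?thesis using Xc[OF j] by (simp add: solves_comp_def y'_def)
      qed
    qed
    let ?S = "squarefree_lists n"
    define F where "F l = mu ?Q (l @ [i]) * ent (monomial y' (i # l)) 0 ?u" for l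
    have expansion: "longitude X ?Q i = (\<Sum>l\<in>?S. of_int (mu ?Q (l @ [i])) * monomial y' l)"
      by (rule longitude_expansion[OF Q \<open>i < n\<close> nil' strict' _ X']) (rule zero')
    have "y' i * longitude X ?Q i = (\<Sum>l\<in>?S. of_int (mu ?Q (l @ [i])) * monomial y' (i # l))"
      unfolding expansion sum_distrib_left
      by (intro sum.cong refl) (metis monomial_simps(2) mult.assoc mult_of_int_commute)
    then have "ent (y' i * longitude X ?Q i) 0 ?u = (\<Sum>l\<in>?S. F l)"
      by (simp add: ent_sum F_def)
    \<comment> \<open>The constant term contributes the meridian alone, \<open>c\<close> the value
      sought with leading coefficient 1, and every other list a multiple of \<open>mu\<close> on a
      proper subsequence.\<close>
    also have "\<dots> = F [] + F c + (\<Sum>l\<in>?S - {[], c}. F l)"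
    proof -
      have "[] \<in> ?S" "c \<in> ?S - {[]}" using L c by (auto simp: squarefree_lists_def)
      then have "(\<Sum>l\<in>?S. F l) = F [] + (F c + (\<Sum>l\<in>?S - {[]} - {c}. F l))"
        by (simp add: sum.remove)
      then show ?thesis by (simp add: Diff_insert2[symmetric] insert_commute)
    qed
    also have "F [] = ent (y' i) 0 ?u" by (simp add: F_def)
    also have "F c = mu ?Q (c @ [i])"
    proof -
      have "ent (monomial y' L) 0 ?u = ent (monomial ?y L) 0 ?u"
        using monomial_agree[OF y(2) strict' near, of L] by (auto simp: agree_def L_def)
      also have "\<dots> = 1" by (subst ent_monomial_mer) (simp_all add: L_def)
      finally show ?thesis by (simp add: F_def L_def)
    qed
    finally have eqQ: "ent (y' i * longitude X ?Q i) 0 ?u - ent (y' i) 0 ?u =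
        mu ?Q (c @ [i]) + (\<Sum>l\<in>?S - {[], c}. F l)" by simp
    have "d dvd F l" if l: "l \<in> ?S - {[], c}" for l
    proof (cases "ent (monomial y' (i # l)) 0 ?u = 0")
      case False
      then have "subseq (i # l) L"
        using monomial_support[of y' L "i # l" 0, OF shape] by simp
      then have sub: "subseq l c" by (simp add: L_def)
      then have "length l < length c"
        using l by (metis Diff_iff insertCI list_emb_length order_le_imp_less_or_eq subseq_same_length)
      moreover have "subseq (l @ [i]) (rotate 0 (c @ [i]))" using sub by simp
      moreover have "2 \<le> length (l @ [i])" using l by (cases l) auto
      ultimately have "d dvd mu ?Q (rotate 0 (l @ [i]))"
        by (intro dvd_mu_of_Delta[OF dQ, of _ 0]) auto
      then show ?thesis by (simp add: F_def)
    qed (simp add: F_def)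
    then have dvdQ: "d dvd (ent (y' i * longitude X ?Q i) 0 ?u - ent (y' i) 0 ?u) - mu ?Q (c @ [i])"
      unfolding eqQ by (auto intro: dvd_sum)
    have yi0: "ent (?y i) 0 ?u = 0" using c by (simp add: ent_mer)
    have dvdP: "d dvd (ent (y' i * longitude X ?Q i) 0 ?u - ent (y' i) 0 ?u) - mu ?P (c @ [i])"
    proof (cases "i = k")
      case False
      then have "y' i = ?y i" "longitude X ?Q i = longitude X ?P i" by (simp_all add: y'_def longP longQ)
      then show ?thesis using muP yi0 by simp
    next
      case True
      \<comment> \<open>Since \<open>i\<close> heads \<open>L\<close>, the only nonzero entry of
        \<open>?y i\<close> is at \<open>(0, 1)\<close>, and the strict matrix \<open>X A\<close>
        has nothing at \<open>(0, 0)\<close> to meet it. So the left conjugating factor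
        disappears.\<close>
      have "X A * ?y i = 0"
      proof (rule tri_eqI)
        fix a b
        show "ent (X A * ?y i) a b = ent 0 a b"
        proof (cases "0 < b \<and> b \<le> length L \<and> L ! (b - 1) = i")
          case True
          then have "b - 1 < length L" by linarith
          then have "b - 1 = 0" using True nth_eq_iff_index_eq[OF LL(1), of "b - 1" 0] by (simp add: L_def)
          then show ?thesis
            using True \<open>strict (X A)\<close> by (cases "a = 0") (simp_all add: ent_mult_mer strict_def)
        qed (auto simp: ent_mult_mer)
      qed
      then have "(1 - ?E) * ?y i = ?y i" by (simp add: left_diff_distrib mult.assoc)
      then have y'i: "y' i = ?y i * (1 + ?E)" using True by (simp add: y'_def)
      have "longitude X ?P i = (1 + ?E) * sval X (cword C k x)"
        using True k under by (auto simp: longP letter_power_def)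
      moreover have "longitude X ?Q i = sval X (cword C k x) * (1 + ?E)"
        using True k under by (auto simp: longQ letter_power_def)
      ultimately have "y' i * longitude X ?Q i = ?y i * longitude X ?P i * (1 + ?E)"
        by (simp add: y'i mult.assoc)
      then have diff: "y' i * longitude X ?Q i - y' i = (?y i * longitude X ?P i - ?y i) * (1 + ?E)"
        by (simp add: y'i left_diff_distrib)
      \<comment> \<open>The shift multiplies \<open>M\<close> by \<open>1 + ?E\<close>. Below the
        corner \<open>M\<close> is divisible by \<open>d\<close>, and the strict factor
        \<open>?E\<close> gains a diagonal, so the extra term \<open>M * ?E\<close> is divisible at
        the corner as well.\<close>
      define M where "M = ?y i * longitude X ?P i - ?y i"
      have "agree d (length L) M 0"
        using meridian_longitude_agree(1)[OF P \<open>i < n\<close> LL X dP rot] by (simp add: M_def agree_def)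
      then have "agree d (Suc (length L)) (M * ?E) 0" by (rule agree_0_mult_strict_right[OF strictE])
      then have "d dvd ent (M * ?E) 0 ?u" by (auto simp: agree_def L_def)
      moreover have "ent (y' i * longitude X ?Q i) 0 ?u - ent (y' i) 0 ?u = ent M 0 ?u + ent (M * ?E) 0 ?u"
        using arg_cong[OF diff, of "\<lambda>f. ent f 0 ?u"] by (simp add: M_def distrib_left)
      moreover have "ent M 0 ?u = mu ?P (c @ [i])" using muP yi0 by (simp add: M_def)
      ultimately show ?thesis by simp
    qed
    show ?thesis using dvd_diff[OF dvdQ dvdP] by simp
  qed
qed

section \<open>Invariance of \<open>\<mu>\<close> modulo \<open>\<Delta>\<close>\<close>

lemma mu_move:
  assumes "M_move P Q" and P: "nanophrase n P" and Q: "nanophrase n Q"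
    and L: "distinct (i # c)" "set (i # c) \<subseteq> {..<n}" and c: "c \<noteq> []"
    and d: "d dvd Delta P (c @ [i])" "d dvd Delta Q (c @ [i])"
  shows "d dvd mu P (c @ [i]) - mu Q (c @ [i])"
proof -
  have n: "n > 0" using L by auto
  let ?y = "mer (i # c)"
  have nil: "nil_base ?y" by (rule nil_base_mer[OF L(1)])
  have transfers: "d dvd mu P (c @ [i]) - mu Q (c @ [i])" if "transfers n ?y P Q"
    using mu_transfers[OF P Q L that] by simp
  show ?thesis
    using assms(1)
  proof cases
    case (Iso f m m' p)
    then show ?thesis using transfers transfers_Iso[of n m p f m' ?y] P by simp
  next
    case (H1 p x A y p' m)
    then show ?thesis using transfers transfers_H1[of n m p A p' x y ?y] P Q n by simp
  next
    case (H2 p x A B y z p' m a)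
    then show ?thesis using transfers transfers_H2[of n m p A B p' x y z a ?y] P Q n nil by simp
  next
    case (H3 p x A B y C z t p' m)
    then show ?thesis using transfers transfers_H3[of n m p p' x A B y C z t ?y] P Q n nil by simp
  next
    case (Shift k p A x m)
    then show ?thesis using mu_shift[OF P Q Shift(1,2) _ _ L c d] by blast
  next
    case (Self_crossing k p A m)
    then show ?thesis using transfers transfers_Self_crossing[of n m p k A ?y] P by simp
  qed
qed

text \<open>The two values of \<open>mu\<close> on a proper subsequence \<open>s\<close> differ by a
  multiple of its own modulus. That modulus is in turn a multiple of \<open>Delta P ds\<close>,
  because what remains after further eliminations from \<open>s\<close> also arises from
  \<open>ds\<close>.\<close>

lemma Delta_dvd_Delta_of_mu_bar:
  assumes "\<And>s r. subseq s ds \<Longrightarrow> 2 \<le> length s \<Longrightarrow> length s < length ds \<Longrightarrow>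
    mu_bar P (rotate r s) = mu_bar Q (rotate r s)"
  shows "Delta P ds dvd Delta Q ds"
  unfolding Delta_def[of Q ds]
proof (intro Gcd_greatest, clarify)
  fix r s assume s: "s \<in> set (subseqs ds)" "2 \<le> length s" "length s < length ds"
  let ?s = "rotate r s"
  have eq: "mu_bar P ?s = mu_bar Q ?s" using assms s by simp
  have "mu P ?s \<in> snd (mu_bar P ?s)" by (simp add: mu_bar_def)
  then have "[mu P ?s = mu Q ?s] (mod Delta Q ?s)" unfolding eq by (simp add: mu_bar_def)
  moreover have "Delta P ?s = Delta Q ?s" using eq by (simp add: mu_bar_def)
  ultimately have "Delta P ?s dvd mu P ?s - mu Q ?s"
    by (simp add: cong_iff_dvd_diff)
  moreover have "Delta P ds dvd Delta P ?s"
  proof -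
    have "Delta P ds dvd mu P (rotate r' t)" if t: "subseq t ?s" "2 \<le> length t" "length t < length ?s" for r' t
    proof -
      obtain r0 t0 where "subseq t0 s" "t = rotate r0 t0" using t(1) by (rule subseq_rotate)
      then have "Delta P ds dvd mu P (rotate (r' + r0) t0)"
        using s t by (intro dvd_mu_of_Delta[of _ P ds t0 0]) (auto intro: subseq_order.trans)
      then show ?thesis using \<open>t = rotate r0 t0\<close> by (simp add: rotate_rotate)
    qed
    then show ?thesis unfolding Delta_def[of P ?s] by (intro Gcd_greatest) auto
  qed
  moreover have "Delta P ds dvd mu P ?s"
    using s by (intro dvd_mu_of_Delta[of _ P ds s 0]) auto
  ultimately have "Delta P ds dvd mu P ?s - (mu P ?s - mu Q ?s)"
    by (blast intro: dvd_diff dvd_trans)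
  then show "Delta P ds dvd mu Q ?s" by simp
qed

lemma mu_bar_move:
  assumes M: "M_move P Q" and P: "nanophrase n P" and Q: "nanophrase n Q"
  shows "distinct ds \<Longrightarrow> set ds \<subseteq> {..<n} \<Longrightarrow> 2 \<le> length ds \<Longrightarrow> mu_bar P ds = mu_bar Q ds"
proof (induction "length ds" arbitrary: ds rule: less_induct)
  case less
  have IH: "mu_bar P (rotate r s) = mu_bar Q (rotate r s)"
    if s: "subseq s ds" "2 \<le> length s" "length s < length ds" for s r
  proof -
    have "distinct s" "set s \<subseteq> set ds"
      using s(1) less.prems(1) subseqs_distinctD[of s ds] subseqs_powset[of ds] by auto
    then show ?thesis using less s by (intro less.hyps) auto
  qed
  have "Delta P ds dvd Delta Q ds" "Delta Q ds dvd Delta P ds"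
    using IH by (intro Delta_dvd_Delta_of_mu_bar; metis)+
  then have D: "Delta P ds = Delta Q ds"
    by (intro zdvd_antisym_nonneg) (simp_all add: Delta_def)
  obtain c i where ds: "ds = c @ [i]" using less.prems(3) by (cases ds rule: rev_cases) auto
  moreover have "c \<noteq> []" using less.prems(3) ds by auto
  ultimately have "Delta Q ds dvd mu P ds - mu Q ds"
    using less.prems D mu_move[OF M P Q, of i c "Delta Q ds"] by auto
  then have "[mu P ds = mu Q ds] (mod Delta Q ds)" by (simp add: cong_iff_dvd_diff)
  then show ?case unfolding mu_bar_def D by (auto intro: cong_trans cong_sym)
qed

theorem theorem8p2:
  fixes n :: nat and P P' :: "'a nanophrase" and c :: "nat list" and i :: nat
  assumes "nanophrase n P" and "nanophrase n P'"
    and "M_homotopic n P P'"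
    and "length c \<ge> 1"
    and "set (c @ [i]) \<subseteq> {..<n}" and "distinct (c @ [i])"
  shows "mu_bar P (c @ [i]) = mu_bar P' (c @ [i])"
  using assms(3) unfolding M_homotopic_def
proof (induction rule: equivclp_induct)
  case (step Q R)
  \<comment> \<open>A link in the chain may be a move read backwards; equality of
    \<open>mu_bar\<close> covers both directions.\<close>
  then show ?case using mu_bar_move[of _ _ n "c @ [i]"] assms(4-6) by fastforce
qed simp

end
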